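(* Let $G$ be a compact Lie group and let $X$ be a closed, connected smooth manifold. If $G$ acts locally smoothly, non-trivially and semi-freely on $X$, then \[ \mathsf{TC}(X)\leq 2\dim(X)-\dim(G)+1. \] If $G$ acts locally smoothly and freely on $X$, then \[ \mathsf{TC}(X)\leq\mathsf{cat}((X\times X)/G)\leq 2\dim(X)-\dim(G)+1, \] where $(X\times X)/G$ is the orbit space of the diagonal action $g\cdot(x,y)=(g\cdot x,g\cdot y)$ of $G$ on $X\times X$.
   Context: For a path-connected space $X$, let $\mathscr{P}X=\{\gamma\colon [0,1]\to X\}$ be the space of continuous paths in $X$ with the compact-open topology, and let $\pi\colon\mathscr{P}X\to X\times X$, $\pi(\gamma)=(\gamma(0),\gamma(1))$. The topological complexity $\mathsf{TC}(X)$ is the smallest integer $k$ such that $X\times X$ can be covered by $k$ open sets $U_1,\dots,U_k$, each admitting a continuous map $s_i\colon U_i\to\mathscr{P}X$ with $\pi\circ s_i$ equal to the inclusion $U_i\hookrightarrow X\times X$; it is $\infty$ if no such integer exists (not reduced: $\mathsf{TC}(\text{point})=1$). For a path-connected space $X$, the Lusternik–Schnirelmann category $\mathsf{cat}(X)$ is the smallest integer $k$ such that $X$ has an open cover $X=U_1\cup\dots\cup U_k$ with each inclusion $U_j\hookrightarrow X$ null-homotopic, and $\infty$ if no such integer exists (not reduced: $\mathsf{cat}(\text{point})=1$). For an action of $G$ on $X$, $G_x=\{g\in G\mid g\cdot x=x\}$ is the stabiliser of $x$. The action is free if every $G_x$ is trivial, and semi-free if every $G_x$ is either $\{e\}$ or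 $G$. An orbit $G(x)$ is of type $G/G_x$. The action is locally smooth if for every orbit of type $G/H$ there is a $G$-equivariant homeomorphism $\varphi\colon G\times_H V\to X$ onto an open neighbourhood of the orbit, carrying the zero section onto the orbit, where $V$ is an orthogonal representation of $H$ (a linear tube). Smooth actions are locally smooth. *)

theory Defs
  imports "HOL-Analysis.Analysis" "HOL-Algebra.Group_Action"
begin

section \<open>Smooth manifolds\<close>

text \<open>
  The model space of an \<open>n\<close>-manifold is \<^const>\<open>Euclidean_space\<close>~\<open>n\<close>, that is, the sequences vanishing
  from index \<open>n\<close> on.  Unlike the types of class \<^class>\<open>euclidean_space\<close> this includes dimension \<open>0\<close>,
  which is needed for finite groups.
\<close>

text \<open>
  Continuous partial derivatives up to order \<open>k\<close>, for real functions on an open subset \<open>W\<close> of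
  \<^const>\<open>Euclidean_space\<close>~\<open>n\<close>.  The function \<open>g\<close> is the \<open>i\<close>-th partial derivative of \<open>f\<close>.
\<close>
primrec Ck_on :: "nat \<Rightarrow> (nat \<Rightarrow> real) set \<Rightarrow> nat \<Rightarrow> ((nat \<Rightarrow> real) \<Rightarrow> real) \<Rightarrow> bool" where
  "Ck_on n W 0 f \<longleftrightarrow> continuous_map (subtopology (Euclidean_space n) W) euclideanreal f"
| "Ck_on n W (Suc k) f \<longleftrightarrow>
     continuous_map (subtopology (Euclidean_space n) W) euclideanreal f \<and>
     (\<forall>i<n. \<exists>g. (\<forall>x\<in>W. ((\<lambda>t. f (x(i := t))) has_real_derivative g x) (at (x i))) \<and> Ck_on n W k g)"

definition smooth_on :: "nat \<Rightarrow> (nat \<Rightarrow> real) set \<Rightarrow> nat \<Rightarrow> ((nat \<Rightarrow> real) \<Rightarrow> nat \<Rightarrow> real) \<Rightarrow> bool" where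
  "smooth_on n W m F \<longleftrightarrow> (\<forall>j<m. \<forall>k. Ck_on n W k (\<lambda>x. F x j))"

type_synonym 'a chart = "'a set \<times> ('a \<Rightarrow> nat \<Rightarrow> real)"

definition is_chart :: "nat \<Rightarrow> 'a topology \<Rightarrow> 'a chart \<Rightarrow> bool" where
  "is_chart n X = (\<lambda>(U, p). openin X U \<and> openin (Euclidean_space n) (p ` U) \<and>
     homeomorphic_map (subtopology X U) (subtopology (Euclidean_space n) (p ` U)) p)"

text \<open>Atlases are not required to be maximal.\<close>
definition smooth_atlas :: "nat \<Rightarrow> 'a topology \<Rightarrow> 'a chart set \<Rightarrow> bool" where
  "smooth_atlas n X A \<longleftrightarrow>
     (\<forall>c\<in>A. is_chart n X c) \<and> (\<Union>(U, p)\<in>A. U) = topspace X \<and>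
     (\<forall>(U, p)\<in>A. \<forall>(V, q)\<in>A. smooth_on n (p ` (U \<inter> V)) n (q \<circ> inv_into U p))"

definition second_countable_space :: "'a topology \<Rightarrow> bool" where
  "second_countable_space X \<longleftrightarrow>
     (\<exists>\<B>. countable \<B> \<and> (\<forall>B\<in>\<B>. openin X B) \<and>
       (\<forall>U x. openin X U \<and> x \<in> U \<longrightarrow> (\<exists>B\<in>\<B>. x \<in> B \<and> B \<subseteq> U)))"

definition smooth_manifold :: "nat \<Rightarrow> 'a topology \<Rightarrow> 'a chart set \<Rightarrow> bool" where
  "smooth_manifold n X A \<longleftrightarrow>
     Hausdorff_space X \<and> second_countable_space X \<and> smooth_atlas n X A"

text \<open>All charts map to open subsets of Euclidean space, so manifolds have no boundary.\<close>
definition closed_smooth_manifold :: "nat \<Rightarrow> 'a topology \<Rightarrow> 'a chart set \<Rightarrow> bool" where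
  "closed_smooth_manifold n X A \<longleftrightarrow> smooth_manifold n X A \<and> compact_space X"

definition smooth_map ::
  "nat \<Rightarrow> 'a topology \<Rightarrow> 'a chart set \<Rightarrow> nat \<Rightarrow> 'b topology \<Rightarrow> 'b chart set \<Rightarrow> ('a \<Rightarrow> 'b) \<Rightarrow> bool" where
  "smooth_map n X A m Y B f \<longleftrightarrow>
     continuous_map X Y f \<and>
     (\<forall>(U, p)\<in>A. \<forall>(V, q)\<in>B. smooth_on n (p ` {x \<in> U. f x \<in> V}) m (q \<circ> f \<circ> inv_into U p))"

text \<open>The first \<open>m\<close> coordinates of a product chart come from the first factor (of dimension \<open>m\<close>).\<close>
definition prod_chart :: "nat \<Rightarrow> 'a chart \<Rightarrow> 'b chart \<Rightarrow> ('a \<times> 'b) chart" where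
  "prod_chart m = (\<lambda>(U, p) (V, q). (U \<times> V, \<lambda>(x, y) i. if i < m then p x i else q y (i - m)))"

definition prod_atlas :: "nat \<Rightarrow> 'a chart set \<Rightarrow> 'b chart set \<Rightarrow> ('a \<times> 'b) chart set" where
  "prod_atlas m A B = {prod_chart m c c' | c c'. c \<in> A \<and> c' \<in> B}"

section \<open>Compact Lie groups\<close>

definition lie_group :: "nat \<Rightarrow> 'g monoid \<Rightarrow> 'g topology \<Rightarrow> 'g chart set \<Rightarrow> bool" where
  "lie_group d G T A \<longleftrightarrow>
     group G \<and> topspace T = carrier G \<and> smooth_manifold d T A \<and>
     smooth_map (d + d) (prod_topology T T) (prod_atlas d A A) d T A (\<lambda>(g, h). g \<otimes>\<^bsub>G\<^esub> h) \<and>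
     smooth_map d T A d T A (\<lambda>g. inv\<^bsub>G\<^esub> g)"

definition compact_lie_group :: "nat \<Rightarrow> 'g monoid \<Rightarrow> 'g topology \<Rightarrow> 'g chart set \<Rightarrow> bool" where
  "compact_lie_group d G T A \<longleftrightarrow> lie_group d G T A \<and> compact_space T"

section \<open>Group actions\<close>

definition continuous_action ::
  "'g monoid \<Rightarrow> 'g topology \<Rightarrow> 'a topology \<Rightarrow> ('g \<Rightarrow> 'a \<Rightarrow> 'a) \<Rightarrow> bool" where
  "continuous_action G T X \<phi> \<longleftrightarrow>
     group_action G (topspace X) \<phi> \<and> continuous_map (prod_topology T X) X (\<lambda>(g, x). \<phi> g x)"

definition free_action :: "'g monoid \<Rightarrow> 'a topology \<Rightarrow> ('g \<Rightarrow> 'a \<Rightarrow> 'a) \<Rightarrow> bool" where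
  "free_action G X \<phi> \<longleftrightarrow> (\<forall>x\<in>topspace X. stabilizer G \<phi> x = {\<one>\<^bsub>G\<^esub>})"

definition semi_free_action :: "'g monoid \<Rightarrow> 'a topology \<Rightarrow> ('g \<Rightarrow> 'a \<Rightarrow> 'a) \<Rightarrow> bool" where
  "semi_free_action G X \<phi> \<longleftrightarrow>
     (\<forall>x\<in>topspace X. stabilizer G \<phi> x = {\<one>\<^bsub>G\<^esub>} \<or> stabilizer G \<phi> x = carrier G)"

definition nontrivial_action :: "'g monoid \<Rightarrow> 'a topology \<Rightarrow> ('g \<Rightarrow> 'a \<Rightarrow> 'a) \<Rightarrow> bool" where
  "nontrivial_action G X \<phi> \<longleftrightarrow> (\<exists>g\<in>carrier G. \<exists>x\<in>topspace X. \<phi> g x \<noteq> x)"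

text \<open>The restriction to \<open>E \<times> E\<close> is the extensionality convention of \<^const>\<open>group_action\<close>.\<close>
definition diagonal_action :: "'a set \<Rightarrow> ('g \<Rightarrow> 'a \<Rightarrow> 'a) \<Rightarrow> 'g \<Rightarrow> 'a \<times> 'a \<Rightarrow> 'a \<times> 'a" where
  "diagonal_action E \<phi> g = restrict (\<lambda>(x, y). (\<phi> g x, \<phi> g y)) (E \<times> E)"

definition orbit_space :: "'g monoid \<Rightarrow> 'a topology \<Rightarrow> ('g \<Rightarrow> 'a \<Rightarrow> 'a) \<Rightarrow> 'a set topology" where
  "orbit_space G X \<phi> = topology (\<lambda>W. W \<subseteq> orbits G (topspace X) \<phi> \<and>
     openin X {x \<in> topspace X. orbit G \<phi> x \<in> W})"

lemma openin_orbit_space: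
  "openin (orbit_space G X \<phi>) W \<longleftrightarrow>
     W \<subseteq> orbits G (topspace X) \<phi> \<and> openin X {x \<in> topspace X. orbit G \<phi> x \<in> W}"
proof -
  have "istopology (\<lambda>W. W \<subseteq> orbits G (topspace X) \<phi> \<and>
          openin X {x \<in> topspace X. orbit G \<phi> x \<in> W})"
    unfolding istopology_def
  proof (rule conjI; intro allI impI)
    fix S T
    assume "S \<subseteq> orbits G (topspace X) \<phi> \<and> openin X {x \<in> topspace X. orbit G \<phi> x \<in> S}"
      and "T \<subseteq> orbits G (topspace X) \<phi> \<and> openin X {x \<in> topspace X. orbit G \<phi> x \<in> T}"
    moreover have "{x \<in> topspace X. orbit G \<phi> x \<in> S \<inter> T} =
        {x \<in> topspace X. orbit G \<phi> x \<in> S} \<inter> {x \<in> topspace X. orbit G \<phi> x \<in> T}"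
      by auto
    ultimately show "S \<inter> T \<subseteq> orbits G (topspace X) \<phi> \<and>
        openin X {x \<in> topspace X. orbit G \<phi> x \<in> S \<inter> T}"
      by auto
  next
    fix \<K>
    assume *: "\<forall>K\<in>\<K>. K \<subseteq> orbits G (topspace X) \<phi> \<and> openin X {x \<in> topspace X. orbit G \<phi> x \<in> K}"
    have "{x \<in> topspace X. orbit G \<phi> x \<in> \<Union>\<K>} =
        (\<Union>K\<in>\<K>. {x \<in> topspace X. orbit G \<phi> x \<in> K})"
      by auto
    with * show "\<Union>\<K> \<subseteq> orbits G (topspace X) \<phi> \<and>
        openin X {x \<in> topspace X. orbit G \<phi> x \<in> \<Union>\<K>}"
      by (auto intro!: openin_Union)
  qed
  then show ?thesis
    by (simp add: orbit_space_def)
qed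

lemma topspace_orbit_space: "topspace (orbit_space G X \<phi>) = orbits G (topspace X) \<phi>"
proof -
  have "{x \<in> topspace X. orbit G \<phi> x \<in> orbits G (topspace X) \<phi>} = topspace X"
    by (auto simp: orbits_def)
  then have "openin (orbit_space G X \<phi>) (orbits G (topspace X) \<phi>)"
    by (simp add: openin_orbit_space)
  then show ?thesis
    by (metis openin_orbit_space openin_subset openin_topspace subset_antisym)
qed

section \<open>Linear tubes and locally smooth actions\<close>

definition orthogonal_representation ::
  "'g monoid \<Rightarrow> 'g topology \<Rightarrow> 'g set \<Rightarrow> nat \<Rightarrow> ('g \<Rightarrow> (nat \<Rightarrow> real) \<Rightarrow> nat \<Rightarrow> real) \<Rightarrow> bool" where
  "orthogonal_representation G T H k \<rho> \<longleftrightarrow>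
     continuous_action (G\<lparr>carrier := H\<rparr>) (subtopology T H) (Euclidean_space k) \<rho> \<and>
     (\<forall>h\<in>H. \<forall>v\<in>topspace (Euclidean_space k). \<forall>w\<in>topspace (Euclidean_space k).
        (\<forall>a b. \<rho> h (\<lambda>i. a * v i + b * w i) = (\<lambda>i. a * \<rho> h v i + b * \<rho> h w i)) \<and>
        (\<Sum>i<k. \<rho> h v i * \<rho> h w i) = (\<Sum>i<k. v i * w i))"

text \<open>
  The twisted product \<open>G \<times>\<^sub>H V\<close> is the orbit space of the action \<open>h \<cdot> (g, v) = (g h\<^sup>-\<^sup>1, h v)\<close>
  of \<open>H\<close> on \<open>G \<times> V\<close>, and \<open>twisted_class\<close> gives the class \<open>[g, v]\<close>.
\<close>
definition twisted_action ::
  "'g monoid \<Rightarrow> nat \<Rightarrow> ('g \<Rightarrow> (nat \<Rightarrow> real) \<Rightarrow> nat \<Rightarrow> real) \<Rightarrow>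
     'g \<Rightarrow> 'g \<times> (nat \<Rightarrow> real) \<Rightarrow> 'g \<times> (nat \<Rightarrow> real)" where
  "twisted_action G k \<rho> h =
     restrict (\<lambda>(g, v). (g \<otimes>\<^bsub>G\<^esub> inv\<^bsub>G\<^esub> h, \<rho> h v)) (carrier G \<times> topspace (Euclidean_space k))"

definition twisted_product ::
  "'g monoid \<Rightarrow> 'g topology \<Rightarrow> 'g set \<Rightarrow> nat \<Rightarrow> ('g \<Rightarrow> (nat \<Rightarrow> real) \<Rightarrow> nat \<Rightarrow> real) \<Rightarrow>
     ('g \<times> (nat \<Rightarrow> real)) set topology" where
  "twisted_product G T H k \<rho> =
     orbit_space (G\<lparr>carrier := H\<rparr>) (prod_topology T (Euclidean_space k)) (twisted_action G k \<rho>)"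

definition twisted_class ::
  "'g monoid \<Rightarrow> 'g set \<Rightarrow> nat \<Rightarrow> ('g \<Rightarrow> (nat \<Rightarrow> real) \<Rightarrow> nat \<Rightarrow> real) \<Rightarrow>
     'g \<Rightarrow> (nat \<Rightarrow> real) \<Rightarrow> ('g \<times> (nat \<Rightarrow> real)) set" where
  "twisted_class G H k \<rho> g v = orbit (G\<lparr>carrier := H\<rparr>) (twisted_action G k \<rho>) (g, v)"

text \<open>\<open>f\<close> is a linear tube about the orbit of \<open>x\<close>, where \<open>H\<close> acts on the \<open>k\<close>-dimensional space via \<open>\<rho>\<close>.\<close>
definition linear_tube ::
  "'g monoid \<Rightarrow> 'g topology \<Rightarrow> 'a topology \<Rightarrow> ('g \<Rightarrow> 'a \<Rightarrow> 'a) \<Rightarrow> 'a \<Rightarrow> 'g set \<Rightarrow> nat \<Rightarrow>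
     ('g \<Rightarrow> (nat \<Rightarrow> real) \<Rightarrow> nat \<Rightarrow> real) \<Rightarrow> (('g \<times> (nat \<Rightarrow> real)) set \<Rightarrow> 'a) \<Rightarrow> bool" where
  "linear_tube G T X \<phi> x H k \<rho> f \<longleftrightarrow>
     orthogonal_representation G T H k \<rho> \<and>
     embedding_map (twisted_product G T H k \<rho>) X f \<and>
     openin X (f ` topspace (twisted_product G T H k \<rho>)) \<and>
     (\<forall>g\<in>carrier G. \<forall>g'\<in>carrier G. \<forall>v\<in>topspace (Euclidean_space k).
        f (twisted_class G H k \<rho> (g \<otimes>\<^bsub>G\<^esub> g') v) = \<phi> g (f (twisted_class G H k \<rho> g' v))) \<and>
     f ` {twisted_class G H k \<rho> g (\<lambda>_. 0) | g. g \<in> carrier G} = orbit G \<phi> x"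

definition locally_smooth_action ::
  "'g monoid \<Rightarrow> 'g topology \<Rightarrow> 'a topology \<Rightarrow> ('g \<Rightarrow> 'a \<Rightarrow> 'a) \<Rightarrow> bool" where
  "locally_smooth_action G T X \<phi> \<longleftrightarrow>
     continuous_action G T X \<phi> \<and>
     (\<forall>x\<in>topspace X. \<exists>k \<rho> f. linear_tube G T X \<phi> x (stabilizer G \<phi> x) k \<rho> f)"

section \<open>Topological complexity and Lusternik--Schnirelmann category\<close>

definition compact_open_topology :: "'a topology \<Rightarrow> 'b topology \<Rightarrow> ('a \<Rightarrow> 'b) topology" where
  "compact_open_topology Y X =
     topology_generated_by
       {{\<gamma> \<in> extensional (topspace Y). continuous_map Y X \<gamma> \<and> \<gamma> ` K \<subseteq> U} | K U.
          compactin Y K \<and> openin X U}"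

lemma topspace_compact_open_topology:
  "topspace (compact_open_topology Y X) =
     {\<gamma> \<in> extensional (topspace Y). continuous_map Y X \<gamma>}" (is "_ = ?C")
proof -
  have "?C = {\<gamma> \<in> extensional (topspace Y). continuous_map Y X \<gamma> \<and> \<gamma> ` {} \<subseteq> {}}"
    by simp
  then have "?C \<in> {{\<gamma> \<in> extensional (topspace Y). continuous_map Y X \<gamma> \<and> \<gamma> ` K \<subseteq> U} | K U.
          compactin Y K \<and> openin X U}"
    by (intro CollectI exI[of _ "{}"] conjI) auto
  then show ?thesis
    unfolding compact_open_topology_def topology_generated_by_topspace by blast
qed

definition path_space :: "'a topology \<Rightarrow> (real \<Rightarrow> 'a) topology" where
  "path_space X = compact_open_topology (top_of_set {0..1}) X"

definition path_endpoints :: "(real \<Rightarrow> 'a) \<Rightarrow> 'a \<times> 'a" where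
  "path_endpoints \<gamma> = (\<gamma> 0, \<gamma> 1)"

text \<open>In the next two definitions the infimum of the empty set of numbers is \<open>\<infinity>\<close>.\<close>
definition TC :: "'a topology \<Rightarrow> enat" where
  "TC X = Inf {enat k | k. \<exists>U :: nat \<Rightarrow> ('a \<times> 'a) set.
     (\<Union>i<k. U i) = topspace (prod_topology X X) \<and>
     (\<forall>i<k. openin (prod_topology X X) (U i) \<and>
        (\<exists>s. continuous_map (subtopology (prod_topology X X) (U i)) (path_space X) s \<and>
             (\<forall>z\<in>U i. path_endpoints (s z) = z)))}"

definition LS_cat :: "'a topology \<Rightarrow> enat" where
  "LS_cat X = Inf {enat k | k. \<exists>U :: nat \<Rightarrow> 'a set.
     (\<Union>i<k. U i) = topspace X \<and>
     (\<forall>i<k. openin X (U i) \<and>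
        (\<exists>c\<in>topspace X. homotopic_with (\<lambda>_. True) (subtopology X (U i)) X id (\<lambda>_. c)))}"

end

theory Submission
  imports Defs "HOL-Homology.Invariance_of_Domain"
begin

text \<open>
  Let \<open>E = X \<times> X\<close> with orbit map \<open>q : E \<rightarrow> Y\<close> and \<open>N = 2n - d\<close>.  Near an orbit with trivial stabiliser, linear tubes
  give a contractible slice in \<open>E\<close>, on which \<open>Y\<close> has at most \<open>N\<close> coordinates by invariance of domain; near a
  pair of fixed points, the image of \<open>X\<^sup>G \<times> X\<^sup>G\<close> in \<open>Y\<close> has at most \<open>2(n - d) \<le> N\<close> coordinates.  Hence every open cover of \<open>Y\<close>
  is refined by \<open>N + 1\<close> families of disjoint open sets covering \<open>Y\<close>.  Over a small invariant open set there is a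
  motion planner: retract to the slice, move there, and transport back by the group.  Its image in \<open>Y\<close> is
  null-homotopic if the action is free.  Both properties pass to disjoint unions, which gives the bounds by \<open>N + 1\<close>.

  If the action is free and an open subset \<open>U\<close> of \<open>Y\<close> contracts in \<open>Y\<close>, then lifting the contraction deforms \<open>q\<^sup>-\<^sup>1 U\<close>
  (after shrinking \<open>U\<close>) into a single orbit \<open>{(g x\<^sub>0, g y\<^sub>0)}\<close>, where \<open>g\<close> times a fixed path from \<open>x\<^sub>0\<close> to \<open>y\<^sub>0\<close> is a planner.
  Hence \<open>TC X \<le> cat Y\<close>.
\<close>

section \<open>Coloured closed covers\<close>

text \<open>The number 2n - d has to come from the orbit space, since E itself has dimension 2n; so
  covers are found on Y and pulled back. The obstacle is that Y need not be a manifold: around a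
  pair of fixed points it is a quotient of a linear representation, without an evident system of N
  coordinates. There only the closed image of the pairs of fixed points is coloured, on which the
  orbit map is injective. The colouring is then thickened to a neighbourhood, and what remains is
  compact and consists of free orbits. A pair is free as soon as one component is, because its
  stabiliser is the intersection of the two; so semi-freeness leaves no third kind of pair. What the
  colouring takes from dimension theory is N continuous coordinates that separate the points of a
  compact piece. Non-triviality puts a free orbit into every tube about a fixed point; that orbit
  and the fixed directions together inject into an n-manifold, which bounds the fixed directions by
  n - d. A free orbit also forces d \<le> n, so the truncated difference 2n - d is the true
  one.\<close>

definition closed_coloring :: "'a topology \<Rightarrow> nat \<Rightarrow> 'a set set \<Rightarrow> (nat \<Rightarrow> 'a set set) \<Rightarrow> bool" where
  "closed_coloring Y N \<U> \<V> \<longleftrightarrow>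
     (\<forall>j\<le>N. finite (\<V> j) \<and> pairwise disjnt (\<V> j) \<and>
        (\<forall>V\<in>\<V> j. closedin Y V \<and> (\<exists>U\<in>\<U>. V \<subseteq> U)))"

text \<open>
  For \<open>K = topspace Y\<close> and \<open>Y\<close> compact Hausdorff this says that the covering dimension of \<open>Y\<close> is at most
  \<open>N\<close>, in Ostrand's form with \<open>N + 1\<close> disjoint families.
\<close>
definition colorable :: "'a topology \<Rightarrow> nat \<Rightarrow> 'a set \<Rightarrow> bool" where
  "colorable Y N K \<longleftrightarrow>
     (\<forall>\<U>. (\<forall>U\<in>\<U>. openin Y U) \<and> topspace Y \<subseteq> \<Union>\<U> \<longrightarrow>
        (\<exists>\<V>. closed_coloring Y N \<U> \<V> \<and> K \<subseteq> (\<Union>j\<le>N. \<Union>(\<V> j))))"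

lemma colorableD:
  assumes "colorable Y N K" "\<And>U. U \<in> \<U> \<Longrightarrow> openin Y U" "topspace Y \<subseteq> \<Union>\<U>"
  obtains \<V> where "closed_coloring Y N \<U> \<V>" "K \<subseteq> (\<Union>j\<le>N. \<Union>(\<V> j))"
  using assms unfolding colorable_def by meson

lemma colorable_subset: "colorable Y N K \<Longrightarrow> L \<subseteq> K \<Longrightarrow> colorable Y N L"
  unfolding colorable_def by (meson order_trans)

lemma colorable_empty: "colorable Y N {}"
  unfolding colorable_def closed_coloring_def by (auto intro!: exI[of _ "\<lambda>_. {}"])

text \<open>Induction on the family: deleting the new member A from all prescribed neighbourhoods
  keeps the closures found so far away from A, and normality then separates A from their finite
  union. The closures, and not just the open sets, are kept disjoint because
  \<open>colorable_topspace\<close> uses them as members of a new closed colouring.\<close>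

lemma disjoint_closed_expansion:
  assumes "normal_space Y" "finite \<V>"
    and "pairwise disjnt \<V>" "\<And>V. V \<in> \<V> \<Longrightarrow> closedin Y V"
    and "\<And>V. V \<in> \<V> \<Longrightarrow> openin Y (U V) \<and> V \<subseteq> U V"
  shows "\<exists>P. (\<forall>V\<in>\<V>. openin Y (P V) \<and> V \<subseteq> P V \<and> Y closure_of P V \<subseteq> U V) \<and>
             (\<forall>V\<in>\<V>. \<forall>W\<in>\<V>. V \<noteq> W \<longrightarrow> disjnt (Y closure_of P V) (Y closure_of P W))"
  using assms(2-)
proof (induction \<V> arbitrary: U rule: finite_induct)
  case empty
  then show ?case by auto
next
  case (insert A \<V>)
  let ?U = "\<lambda>V. U V - A"
  have "closedin Y A" using insert.prems by auto
  have "\<exists>P. (\<forall>V\<in>\<V>. openin Y (P V) \<and> V \<subseteq> P V \<and> Y closure_of P V \<subseteq> ?U V) \<and>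
             (\<forall>V\<in>\<V>. \<forall>W\<in>\<V>. V \<noteq> W \<longrightarrow> disjnt (Y closure_of P V) (Y closure_of P W))"
  proof (rule insert.IH)
    show "pairwise disjnt \<V>" using insert.prems(1) by (simp add: pairwise_insert)
    show "openin Y (U V - A) \<and> V \<subseteq> U V - A" if "V \<in> \<V>" for V
      using insert.prems(1) insert.prems(3)[of V] insert.hyps that \<open>closedin Y A\<close>
      by (fastforce simp: pairwise_insert disjnt_def openin_diff)
  qed (use insert.prems in auto)
  then obtain P where P: "\<And>V. V\<in>\<V> \<Longrightarrow> openin Y (P V) \<and> V \<subseteq> P V \<and> Y closure_of P V \<subseteq> U V - A"
    and Pd: "\<And>V W. V\<in>\<V> \<Longrightarrow> W\<in>\<V> \<Longrightarrow> V \<noteq> W \<Longrightarrow> disjnt (Y closure_of P V) (Y closure_of P W)"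
    by metis
  let ?C = "\<Union>V\<in>\<V>. Y closure_of P V"
  have "closedin Y ?C"
    using insert.hyps by (intro closedin_Union) auto
  moreover have "A \<subseteq> U A - ?C" using P insert.prems(3)[of A] by fastforce
  ultimately obtain Q where Q: "openin Y Q" "A \<subseteq> Q" "Y closure_of Q \<subseteq> U A - ?C"
    using \<open>normal_space Y\<close> \<open>closedin Y A\<close> insert.prems(3)[of A] unfolding normal_space_alt
    by (metis insertI1 openin_diff)
  have "\<And>V. V \<in> \<V> \<Longrightarrow> V \<noteq> A" using insert.hyps by auto
  then show ?case
    using P Q Pd by (intro exI[of _ "P(A := Q)"]) (fastforce simp: disjnt_def)
qed

lemma closed_coloring_expansion:
  assumes "normal_space Y" "closed_coloring Y N \<U> \<V>" "\<And>U. U \<in> \<U> \<Longrightarrow> openin Y U"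
  obtains P where
    "\<And>j V. j \<le> N \<Longrightarrow> V \<in> \<V> j \<Longrightarrow> openin Y (P j V) \<and> V \<subseteq> P j V \<and> (\<exists>U\<in>\<U>. Y closure_of P j V \<subseteq> U)"
    "\<And>j V W. j \<le> N \<Longrightarrow> V \<in> \<V> j \<Longrightarrow> W \<in> \<V> j \<Longrightarrow> V \<noteq> W \<Longrightarrow>
       disjnt (Y closure_of P j V) (Y closure_of P j W)"
proof -
  have "\<exists>Q. (\<forall>V\<in>\<V> j. openin Y (Q V) \<and> V \<subseteq> Q V \<and> (\<exists>U\<in>\<U>. Y closure_of Q V \<subseteq> U)) \<and>
          (\<forall>V\<in>\<V> j. \<forall>W\<in>\<V> j. V \<noteq> W \<longrightarrow> disjnt (Y closure_of Q V) (Y closure_of Q W))" if "j \<le> N" for j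
  proof -
    obtain U where U: "\<And>V. V \<in> \<V> j \<Longrightarrow> U V \<in> \<U> \<and> V \<subseteq> U V"
      using assms(2) \<open>j \<le> N\<close> unfolding closed_coloring_def by metis
    have "\<exists>P. (\<forall>V\<in>\<V> j. openin Y (P V) \<and> V \<subseteq> P V \<and> Y closure_of P V \<subseteq> U V) \<and>
             (\<forall>V\<in>\<V> j. \<forall>W\<in>\<V> j. V \<noteq> W \<longrightarrow> disjnt (Y closure_of P V) (Y closure_of P W))"
    proof (rule disjoint_closed_expansion[OF assms(1)])
      show "finite (\<V> j)" "pairwise disjnt (\<V> j)" "\<And>V. V \<in> \<V> j \<Longrightarrow> closedin Y V"
        using assms(2) that unfolding closed_coloring_def by blast+
      show "openin Y (U V) \<and> V \<subseteq> U V" if "V \<in> \<V> j" for V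
        using U[OF that] assms(3) by simp
    qed
    then obtain P where
        P: "\<forall>V\<in>\<V> j. openin Y (P V) \<and> V \<subseteq> P V \<and> Y closure_of P V \<subseteq> U V"
        and Pd: "\<forall>V\<in>\<V> j. \<forall>W\<in>\<V> j. V \<noteq> W \<longrightarrow> disjnt (Y closure_of P V) (Y closure_of P W)"
      by (elim exE conjE)
    have "openin Y (P V) \<and> V \<subseteq> P V \<and> (\<exists>U\<in>\<U>. Y closure_of P V \<subseteq> U)" if V: "V \<in> \<V> j" for V
      using bspec[OF P V] U[OF V] by auto
    with Pd show ?thesis by (intro exI[of _ P] conjI ballI) simp_all
  qed
  then obtain Q where Q: "\<And>j. j \<le> N \<Longrightarrow> (\<forall>V\<in>\<V> j. openin Y (Q j V) \<and> V \<subseteq> Q j V \<and> (\<exists>U\<in>\<U>. Y closure_of Q j V \<subseteq> U)) \<and>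
          (\<forall>V\<in>\<V> j. \<forall>W\<in>\<V> j. V \<noteq> W \<longrightarrow> disjnt (Y closure_of Q j V) (Y closure_of Q j W))"
    by metis
  show thesis by (rule that[of Q]) (use Q in blast)+
qed

text \<open>
  The colouring of \<open>B\<close> is chosen so fine that each of its members meets at most one member of \<open>\<V> j\<close>, and
  then lies in a prescribed neighbourhood of it; the members that meet \<open>V\<close> are merged with \<open>V\<close>.
\<close>
lemma closed_coloring_extend:
  assumes Y: "normal_space Y" and \<U>: "\<And>U. U \<in> \<U> \<Longrightarrow> openin Y U" "topspace Y \<subseteq> \<Union>\<U>"
    and \<V>: "closed_coloring Y N \<U> \<V>" and B: "colorable Y N B"
  obtains \<V>' where "closed_coloring Y N \<U> \<V>'"
    "(\<Union>j\<le>N. \<Union>(\<V> j)) \<union> B \<subseteq> (\<Union>j\<le>N. \<Union>(\<V>' j))"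
proof -
  obtain P where P: "\<And>j V. j \<le> N \<Longrightarrow> V \<in> \<V> j \<Longrightarrow>
        openin Y (P j V) \<and> V \<subseteq> P j V \<and> (\<exists>U\<in>\<U>. Y closure_of P j V \<subseteq> U)"
    and Pd: "\<And>j V W. j \<le> N \<Longrightarrow> V \<in> \<V> j \<Longrightarrow> W \<in> \<V> j \<Longrightarrow> V \<noteq> W \<Longrightarrow>
       disjnt (Y closure_of P j V) (Y closure_of P j W)"
    using closed_coloring_expansion[OF Y \<V> \<U>(1)] by blast
  have Pcl: "P j V \<subseteq> Y closure_of P j V" if "j \<le> N" "V \<in> \<V> j" for j V
    using P[OF that] by (simp add: closure_of_subset openin_subset)
  have PU: "\<exists>U\<in>\<U>. P j V \<subseteq> U" if "j \<le> N" "V \<in> \<V> j" for j V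
    using P[OF that] Pcl[OF that] by (meson order_trans)
  have Pdj: "P j V \<inter> P j W = {}" if "j \<le> N" "V \<in> \<V> j" "W \<in> \<V> j" "V \<noteq> W" for j V W
    using Pd[OF that] Pcl that unfolding disjnt_def by blast
  have V: "finite (\<V> j)" "pairwise disjnt (\<V> j)" "V \<in> \<V> j \<Longrightarrow> closedin Y V" if "j \<le> N" for j V
    using \<V> that unfolding closed_coloring_def by auto
  \<comment> \<open>A set of \<open>\<S> j\<close> either misses every member of
    \<open>\<V> j\<close> or is one of the disjoint neighbourhoods, so a subset of it touches at
    most one member.\<close>
  define \<S> where "\<S> j = insert (topspace Y - \<Union>(\<V> j)) (P j ` \<V> j)" for j
  \<comment> \<open>Common refinement of \<open>\<U>\<close> and of the covers
    \<open>\<S> j\<close>: a colouring subordinate to it is fine enough for all colours at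
    once.\<close>
  define \<W> where "\<W> = {U \<inter> (\<Inter>j\<le>N. S j) | U S. U \<in> \<U> \<and> (\<forall>j\<le>N. S j \<in> \<S> j)}"
  have "openin Y S" if "j \<le> N" "S \<in> \<S> j" for S j
  proof -
    have "closedin Y (\<Union>(\<V> j))"
      using V that by (intro closedin_Union) auto
    then show ?thesis
      using that P unfolding \<S>_def by auto
  qed
  then have W_open: "openin Y W" if "W \<in> \<W>" for W
    using that \<U>(1) unfolding \<W>_def by (auto intro!: openin_Int openin_INT2)
  have "y \<in> \<Union>\<W>" if y: "y \<in> topspace Y" for y
  proof -
    obtain U where U: "U \<in> \<U>" "y \<in> U" using y \<U>(2) by blast
    have "\<exists>S\<in>\<S> j. y \<in> S" if "j \<le> N" for j
      using P[OF that] y unfolding \<S>_def by auto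
    then obtain S where "\<And>j. j \<le> N \<Longrightarrow> S j \<in> \<S> j \<and> y \<in> S j" by metis
    then show ?thesis using U unfolding \<W>_def by blast
  qed
  then have "topspace Y \<subseteq> \<Union>\<W>" by blast
  then obtain \<T> where \<T>: "closed_coloring Y N \<W> \<T>" and BT: "B \<subseteq> (\<Union>j\<le>N. \<Union>(\<T> j))"
    using colorableD[OF B W_open] by blast
  have T: "finite (\<T> j)" "pairwise disjnt (\<T> j)" "T \<in> \<T> j \<Longrightarrow> closedin Y T" if "j \<le> N" for j T
    using \<T> that unfolding closed_coloring_def by auto
  have TW: "\<exists>W\<in>\<W>. T \<subseteq> W" if "j \<le> N" "T \<in> \<T> j" for j T
    using \<T> that unfolding closed_coloring_def by blast
  have WS: "\<exists>S\<in>\<S> j. W \<subseteq> S" if "j \<le> N" "W \<in> \<W>" for j W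
    using that unfolding \<W>_def by blast
  have WU: "\<exists>U\<in>\<U>. W \<subseteq> U" if "W \<in> \<W>" for W
    using that unfolding \<W>_def by blast
  \<comment> \<open>T lies in one set of \<open>\<S> j\<close>. Meeting V excludes the complement,
    and the neighbourhood containing T meets \<open>P j V\<close> in a common point of T and V, so
    it equals \<open>P j V\<close>.\<close>
  have key: "T \<subseteq> P j V" if TV: "j \<le> N" "T \<in> \<T> j" "V \<in> \<V> j" "T \<inter> V \<noteq> {}" for T V j
  proof -
    obtain S where S: "T \<subseteq> S" "S \<in> \<S> j"
      using TW[OF TV(1,2)] WS[OF TV(1)] by (meson order_trans)
    then obtain V' where "S = P j V'" "V' \<in> \<V> j"
      using S TV unfolding \<S>_def by auto
    moreover have "P j V' \<inter> P j V \<noteq> {}"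
      using P[OF TV(1,3)] TV(4) S(1) \<open>S = P j V'\<close> by blast
    ultimately show ?thesis using Pdj TV S(1) by metis
  qed
  have TU: "\<exists>U\<in>\<U>. T \<subseteq> U" if "j \<le> N" "T \<in> \<T> j" for j T
    using TW[OF that] WU by (meson order_trans)
  define M where "M j V = V \<union> \<Union>{T\<in>\<T> j. T \<inter> V \<noteq> {}}" for j V
  have M: "M j V \<subseteq> P j V" if "j \<le> N" "V \<in> \<V> j" for j V
    using P[OF that] key[OF that(1)] that unfolding M_def by blast
  define \<V>' where "\<V>' j = M j ` \<V> j \<union> {T\<in>\<T> j. \<forall>V\<in>\<V> j. T \<inter> V = {}}" for j
  show thesis
  proof
    show "closed_coloring Y N \<U> \<V>'"
      unfolding closed_coloring_def
    proof (intro allI impI conjI ballI)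
      fix j assume j: "j \<le> N"
      show "finite (\<V>' j)" using V[OF j] T[OF j] unfolding \<V>'_def by auto
      show "pairwise disjnt (\<V>' j)"
      proof (rule pairwiseI)
        fix A A' assume A: "A \<in> \<V>' j" "A' \<in> \<V>' j" "A \<noteq> A'"
        have TT: "T \<inter> T' = {}" if "T \<in> \<T> j" "T' \<in> \<T> j" "T \<noteq> T'" for T T'
          using T(2)[OF j] that by (auto simp: pairwise_def disjnt_def)
        have MM: "M j V \<inter> M j V' = {}" if "V \<in> \<V> j" "V' \<in> \<V> j" "V \<noteq> V'" for V V'
          using M[OF j] Pdj[OF j] that by blast
        \<comment> \<open>A leftover T differs from all merged sets, because each of those meets
          some V; so disjointness within \<open>\<T> j\<close> applies.\<close>
        have MT: "M j V \<inter> T = {}" if "V \<in> \<V> j" "T \<in> \<T> j" "\<forall>V\<in>\<V> j. T \<inter> V = {}" for V T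
          using TT that unfolding M_def by blast
        have "A \<inter> A' = {}"
          using A(1,2) unfolding \<V>'_def
        proof (elim UnE imageE CollectE conjE)
          show ?thesis if "A = M j V" "V \<in> \<V> j" "A' = M j V'" "V' \<in> \<V> j" for V V'
            using MM[of V V'] that A(3) by auto
          show ?thesis if "A = M j V" "V \<in> \<V> j" "A' \<in> \<T> j" "\<forall>V\<in>\<V> j. A' \<inter> V = {}" for V
            using MT[of V A'] that by auto
          show ?thesis if "A' = M j V" "V \<in> \<V> j" "A \<in> \<T> j" "\<forall>V\<in>\<V> j. A \<inter> V = {}" for V
            using MT[of V A] that by auto
          show ?thesis if "A \<in> \<T> j" "A' \<in> \<T> j" 
            using TT[of A A'] that A(3) by auto
        qed
        then show "disjnt A A'" by (simp add: disjnt_def)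
      qed
      fix A assume A: "A \<in> \<V>' j"
      have "closedin Y (M j V)" if "V \<in> \<V> j" for V
        unfolding M_def using V[OF j] T[OF j] that by (intro closedin_Un closedin_Union) auto
      then show "closedin Y A" using A T(3)[OF j] unfolding \<V>'_def by auto
      show "\<exists>U\<in>\<U>. A \<subseteq> U"
        using A M[OF j] PU[OF j] TU[OF j] unfolding \<V>'_def
        by (smt (verit) Un_iff imageE mem_Collect_eq order_trans)
    qed
    have "\<Union>(\<V> j) \<union> \<Union>(\<T> j) \<subseteq> \<Union>(\<V>' j)" for j
      unfolding \<V>'_def M_def by blast
    then have "(\<Union>j\<le>N. \<Union>(\<V> j)) \<union> (\<Union>j\<le>N. \<Union>(\<T> j)) \<subseteq> (\<Union>j\<le>N. \<Union>(\<V>' j))"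
      unfolding UN_Un_distrib[symmetric] by (intro UN_mono) auto
    then show "(\<Union>j\<le>N. \<Union>(\<V> j)) \<union> B \<subseteq> (\<Union>j\<le>N. \<Union>(\<V>' j))"
      using BT by (meson Un_least Un_subset_iff order_trans)
  qed
qed

text \<open>The finite sum theorem of dimension theory. No colours are added, because the colouring
  of A is extended over B instead of being placed beside a colouring of B.\<close>

lemma colorable_Un:
  assumes "normal_space Y" "colorable Y N A" "colorable Y N B"
  shows "colorable Y N (A \<union> B)"
  unfolding colorable_def
proof (intro allI impI, elim conjE)
  fix \<U> assume \<U>: "\<forall>U\<in>\<U>. openin Y U" "topspace Y \<subseteq> \<Union>\<U>"
  then obtain \<V> where \<V>: "closed_coloring Y N \<U> \<V>" "A \<subseteq> (\<Union>j\<le>N. \<Union>(\<V> j))"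
    using colorableD[OF assms(2)] by metis
  obtain \<V>' where "closed_coloring Y N \<U> \<V>'" "(\<Union>j\<le>N. \<Union>(\<V> j)) \<union> B \<subseteq> (\<Union>j\<le>N. \<Union>(\<V>' j))"
    using closed_coloring_extend[OF assms(1) _ \<U>(2) \<V>(1) assms(3)] \<U>(1) by blast
  then show "\<exists>\<V>. closed_coloring Y N \<U> \<V> \<and> A \<union> B \<subseteq> (\<Union>j\<le>N. \<Union>(\<V> j))"
    using \<V>(2) by (meson Un_subset_iff order_trans)
qed

lemma colorable_UN:
  assumes "normal_space Y" "finite I" "\<And>i. i \<in> I \<Longrightarrow> colorable Y N (K i)"
  shows "colorable Y N (\<Union>i\<in>I. K i)"
  using assms(2,3) by (induction) (auto simp: colorable_empty colorable_Un[OF assms(1)])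

section \<open>From local to global colourability by compactness\<close>

lemma compactin_finite_subcover:
  assumes "compactin Y B" "\<And>y. y \<in> B \<Longrightarrow> openin Y (W y) \<and> y \<in> W y"
  obtains F where "finite F" "F \<subseteq> B" "B \<subseteq> \<Union>(W ` F)"
proof -
  have "\<exists>\<F>. finite \<F> \<and> \<F> \<subseteq> W ` B \<and> B \<subseteq> \<Union>\<F>"
    using assms(2) by (intro compactinD[OF assms(1)]) auto
  then show thesis using that by (metis finite_subset_image)
qed

text \<open>Only the trace of a neighbourhood on B has to be colourable; this weak form is what is
  available around the image of a pair of fixed points.\<close>

lemma colorable_compactin:
  assumes Y: "normal_space Y" and B: "compactin Y B"
    and loc: "\<And>y. y \<in> B \<Longrightarrow> \<exists>W K. openin Y W \<and> y \<in> W \<and> colorable Y N K \<and> W \<inter> B \<subseteq> K"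
  shows "colorable Y N B"
proof -
  obtain W K where WK: "\<And>y. y \<in> B \<Longrightarrow> openin Y (W y) \<and> y \<in> W y \<and> colorable Y N (K y) \<and> W y \<inter> B \<subseteq> K y"
    using loc by metis
  then obtain F where F: "finite F" "F \<subseteq> B" "B \<subseteq> \<Union>(W ` F)"
    using compactin_finite_subcover[OF B, of W] by metis
  have "colorable Y N (\<Union>y\<in>F. K y)"
    using F WK by (intro colorable_UN[OF Y]) auto
  moreover have "B \<subseteq> (\<Union>y\<in>F. K y)"
  proof
    fix b assume "b \<in> B"
    then obtain y where "y \<in> F" "b \<in> W y" using F(3) by auto
    then show "b \<in> (\<Union>y\<in>F. K y)" using WK[of y] F(2) \<open>b \<in> B\<close> by auto
  qed
  ultimately show ?thesis by (rule colorable_subset)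
qed

text \<open>Around a point of A only the part of a neighbourhood inside A is under control.
  Therefore A is coloured first and its members are thickened; their closures colour an open set
  containing A, whose complement is compact and lies in the region where whole neighbourhoods are
  colourable.\<close>

lemma colorable_topspace:
  assumes cpt: "compact_space Y" and Hd: "Hausdorff_space Y" and A: "closedin Y A"
    and locA: "\<And>y. y \<in> A \<Longrightarrow> \<exists>W K. openin Y W \<and> y \<in> W \<and> colorable Y N K \<and> W \<inter> A \<subseteq> K"
    and loc: "\<And>y. y \<in> topspace Y - A \<Longrightarrow> \<exists>W K. openin Y W \<and> y \<in> W \<and> colorable Y N K \<and> W \<subseteq> K"
  shows "colorable Y N (topspace Y)"
  unfolding colorable_def
proof (intro allI impI, elim conjE)
  fix \<U> assume \<U>: "\<forall>U\<in>\<U>. openin Y U" "topspace Y \<subseteq> \<Union>\<U>"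
  have Y: "normal_space Y" using cpt Hd by (simp add: compact_Hausdorff_or_regular_imp_normal_space)
  have "colorable Y N A"
    using closedin_compact_space[OF cpt A] locA by (rule colorable_compactin[OF Y])
  then obtain \<V> where \<V>: "closed_coloring Y N \<U> \<V>" "A \<subseteq> (\<Union>j\<le>N. \<Union>(\<V> j))"
    using colorableD \<U> by metis
  then obtain P where P: "\<And>j V. j \<le> N \<Longrightarrow> V \<in> \<V> j \<Longrightarrow>
        openin Y (P j V) \<and> V \<subseteq> P j V \<and> (\<exists>U\<in>\<U>. Y closure_of P j V \<subseteq> U)"
    and Pd: "\<And>j V W. j \<le> N \<Longrightarrow> V \<in> \<V> j \<Longrightarrow> W \<in> \<V> j \<Longrightarrow> V \<noteq> W \<Longrightarrow>
       disjnt (Y closure_of P j V) (Y closure_of P j W)"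
    using closed_coloring_expansion[OF Y \<V>(1)] \<U>(1) by metis
  define Q where "Q = (\<Union>j\<le>N. \<Union>(P j ` \<V> j))"
  define \<V>' where "\<V>' j = (\<lambda>V. Y closure_of P j V) ` \<V> j" for j
  have "openin Y Q" unfolding Q_def using P by auto
  have "A \<subseteq> Q"
  proof
    fix a assume "a \<in> A"
    then obtain j V where "j \<le> N" "V \<in> \<V> j" "a \<in> V" using \<V>(2) by auto
    then show "a \<in> Q" using P[of j V] unfolding Q_def by auto
  qed
  let ?B = "topspace Y - Q"
  have "compactin Y ?B"
    using \<open>openin Y Q\<close> cpt closedin_compact_space by blast
  moreover have "\<exists>W K. openin Y W \<and> y \<in> W \<and> colorable Y N K \<and> W \<inter> ?B \<subseteq> K" if "y \<in> ?B" for y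
  proof -
    have "y \<in> topspace Y - A" using that \<open>A \<subseteq> Q\<close> by auto
    from loc[OF this] show ?thesis by (meson le_infI1)
  qed
  ultimately have B: "colorable Y N ?B"
    by (rule colorable_compactin[OF Y])
  have \<V>': "closed_coloring Y N \<U> \<V>'"
    unfolding closed_coloring_def
  proof (intro allI impI conjI ballI)
    fix j assume j: "j \<le> N"
    show "finite (\<V>' j)" using \<V>(1) j unfolding closed_coloring_def \<V>'_def by simp
    show "pairwise disjnt (\<V>' j)"
      unfolding \<V>'_def by (rule pairwise_imageI) (use Pd[OF j] in simp)
    fix S assume "S \<in> \<V>' j"
    then obtain V where V: "V \<in> \<V> j" "S = Y closure_of P j V" unfolding \<V>'_def by auto
    then show "closedin Y S" "\<exists>U\<in>\<U>. S \<subseteq> U" using P[OF j V(1)] by simp_all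
  qed
  have Q: "Q \<subseteq> (\<Union>j\<le>N. \<Union>(\<V>' j))"
  proof
    fix a assume "a \<in> Q"
    then obtain j V where jV: "j \<le> N" "V \<in> \<V> j" "a \<in> P j V" unfolding Q_def by auto
    then have "a \<in> Y closure_of P j V"
      using P[of j V] by (meson closure_of_subset openin_subset subsetD)
    then show "a \<in> (\<Union>j\<le>N. \<Union>(\<V>' j))" using jV unfolding \<V>'_def by auto
  qed
  obtain \<V>'' where \<V>'': "closed_coloring Y N \<U> \<V>''"
      "(\<Union>j\<le>N. \<Union>(\<V>' j)) \<union> ?B \<subseteq> (\<Union>j\<le>N. \<Union>(\<V>'' j))"
    using closed_coloring_extend[OF Y _ \<U>(2) \<V>' B] \<U>(1) by metis
  have "topspace Y \<subseteq> (\<Union>j\<le>N. \<Union>(\<V>' j)) \<union> ?B" using Q by auto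
  then show "\<exists>\<V>. closed_coloring Y N \<U> \<V> \<and> topspace Y \<subseteq> (\<Union>j\<le>N. \<Union>(\<V> j))"
    using \<V>'' by (meson order_trans)
qed

text \<open>Passage from closed to open families: merging works with closed members, while TC and
  category ask for open sets, so at the end each member is replaced by an open neighbourhood with
  disjointness preserved.\<close>

lemma colorable_topspaceD:
  assumes "normal_space Y" "colorable Y N (topspace Y)"
    and \<U>: "\<And>U. U \<in> \<U> \<Longrightarrow> openin Y U" "topspace Y \<subseteq> \<Union>\<U>"
  obtains \<O> where "\<And>j. j \<le> N \<Longrightarrow> pairwise disjnt (\<O> j)"
    "\<And>j W. j \<le> N \<Longrightarrow> W \<in> \<O> j \<Longrightarrow> openin Y W \<and> (\<exists>U\<in>\<U>. W \<subseteq> U)"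
    "(\<Union>j\<le>N. \<Union>(\<O> j)) = topspace Y"
proof -
  obtain \<V> where \<V>: "closed_coloring Y N \<U> \<V>" "topspace Y \<subseteq> (\<Union>j\<le>N. \<Union>(\<V> j))"
    using colorableD[OF assms(2) \<U>] .
  then obtain P where P: "\<And>j V. j \<le> N \<Longrightarrow> V \<in> \<V> j \<Longrightarrow>
        openin Y (P j V) \<and> V \<subseteq> P j V \<and> (\<exists>U\<in>\<U>. Y closure_of P j V \<subseteq> U)"
    and Pd: "\<And>j V W. j \<le> N \<Longrightarrow> V \<in> \<V> j \<Longrightarrow> W \<in> \<V> j \<Longrightarrow> V \<noteq> W \<Longrightarrow>
       disjnt (Y closure_of P j V) (Y closure_of P j W)"
    using closed_coloring_expansion[OF assms(1) \<V>(1) \<U>(1)] by metis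
  have Pcl: "P j V \<subseteq> Y closure_of P j V" if "j \<le> N" "V \<in> \<V> j" for j V
    using P[OF that] by (simp add: closure_of_subset openin_subset)
  show thesis
  proof
    show "pairwise disjnt (P j ` \<V> j)" if j: "j \<le> N" for j
    proof (rule pairwise_imageI)
      show "disjnt (P j V) (P j W)" if "V \<in> \<V> j" "W \<in> \<V> j" "V \<noteq> W" for V W
        using Pd[OF j that] Pcl[OF j that(1)] Pcl[OF j that(2)] by (meson disjnt_subset1 disjnt_subset2)
    qed
    show *: "openin Y W \<and> (\<exists>U\<in>\<U>. W \<subseteq> U)" if "j \<le> N" "W \<in> P j ` \<V> j" for j W
      using that(2) P[OF that(1)] Pcl[OF that(1)] by (elim imageE) (meson order_trans)
    show "(\<Union>j\<le>N. \<Union> (P j ` \<V> j)) = topspace Y"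
    proof
      show "(\<Union>j\<le>N. \<Union> (P j ` \<V> j)) \<subseteq> topspace Y"
      proof
        fix y assume "y \<in> (\<Union>j\<le>N. \<Union> (P j ` \<V> j))"
        then obtain j V where "j \<le> N" "V \<in> \<V> j" "y \<in> P j V" by auto
        then show "y \<in> topspace Y" using P[of j V] openin_subset[of Y "P j V"] by auto
      qed
      show "topspace Y \<subseteq> (\<Union>j\<le>N. \<Union> (P j ` \<V> j))"
      proof
        fix y assume "y \<in> topspace Y"
        then obtain j V where "j \<le> N" "V \<in> \<V> j" "y \<in> V" using \<V>(2) by auto
        then show "y \<in> (\<Union>j\<le>N. \<Union> (P j ` \<V> j))" using P[of j V] by auto
      qed
    qed
  qed
qed

section \<open>Colourings from coordinates\<close>

text \<open>
  Colour \<open>c\<close> uses the intervals that remain when the gaps \<open>(m + c/(N+1), m + (c+1)/(N+1))\<close> are removed from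
  the line.  A real number lies in a gap of at most one colour, so a point with \<open>N\<close> coordinates avoids
  the gaps of at least one of the \<open>N + 1\<close> colours.
\<close>
lemma Ostrand_gap_unique:
  fixes t :: real and N c :: nat
  assumes "c \<le> N"
    and gap: "\<And>m. \<not> (real_of_int m + (real c + 1) / (real N + 1) \<le> t \<and> t \<le> real_of_int m + 1 + real c / (real N + 1))"
  shows "int c = \<lfloor>t * (N + 1)\<rfloor> mod int (N + 1)"
proof -
  \<comment> \<open>The largest integer whose interval of colour c starts at or to the left of t. As
    t is not in that interval, it lies in the gap right after it, which multiplication by N + 1
    turns into the unit interval starting at (m + 1)(N + 1) + c.\<close>
  define m where "m = \<lfloor>t - (real c + 1) / (real N + 1)\<rfloor>"
  have 1: "m + (real c + 1) / (real N + 1) \<le> t" and 2: "t < m + 1 + (real c + 1) / (real N + 1)"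
    unfolding m_def by linarith+
  then have 3: "m + 1 + c / (real N + 1) < t" using gap[of m] by simp
  define D where "D = real N + 1"
  have "D > 0" by (simp add: D_def)
  have "(m + 1) * D + c = (m + 1 + c / D) * D" using \<open>D > 0\<close> by (simp add: distrib_right)
  also have "\<dots> < t * D" using 3 \<open>D > 0\<close> by (intro mult_strict_right_mono) (simp_all add: D_def ac_simps)
  finally have 4: "(m + 1) * D + c < t * D" .
  have "t * D < (m + 1 + (real c + 1) / D) * D"
    using 2 \<open>D > 0\<close> by (intro mult_strict_right_mono) (simp_all add: D_def ac_simps)
  also have "\<dots> = (m + 1) * D + (real c + 1)" using \<open>D > 0\<close> by (simp add: field_simps)
  finally have 5: "t * D < (m + 1) * D + (real c + 1)" .
  then have "\<lfloor>t * (N + 1)\<rfloor> = (m + 1) * (int N + 1) + int c"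
    using 4 5 by (intro floor_unique) (simp_all add: D_def ac_simps)
  then show ?thesis using \<open>c \<le> N\<close> by (simp add: ac_simps)
qed

lemma exists_good_color:
  fixes t :: "nat \<Rightarrow> real" and N :: nat
  obtains c :: nat where "c \<le> N"
    "\<And>i. i < N \<Longrightarrow> \<exists>m. real_of_int m + (real c + 1) / (real N + 1) \<le> t i \<and> t i \<le> real_of_int m + 1 + real c / (real N + 1)"
proof -
  \<comment> \<open>The colour spoilt by the i-th coordinate, if there is one, is this
    residue.\<close>
  let ?bad = "(\<lambda>i. nat (\<lfloor>t i * (N + 1)\<rfloor> mod int (N + 1))) ` {..<N}"
  have "card ?bad \<le> N" using card_image_le[of "{..<N}"] by (metis card_lessThan finite_lessThan)
  then have "\<not> {..N} \<subseteq> ?bad" using card_mono[of ?bad "{..N}"] by auto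
  then obtain c where c: "c \<le> N" "c \<notin> ?bad" by auto
  have "\<exists>m. real_of_int m + (real c + 1) / (real N + 1) \<le> t i \<and> t i \<le> real_of_int m + 1 + real c / (real N + 1)" if "i < N" for i
  proof (rule ccontr)
    assume "\<not> ?thesis"
    then have "int c = \<lfloor>t i * (N + 1)\<rfloor> mod int (N + 1)"
      using Ostrand_gap_unique[OF c(1), of "t i"] by blast
    then have "c = nat (\<lfloor>t i * (N + 1)\<rfloor> mod int (N + 1))" by simp
    then show False using c(2) that by blast
  qed
  then show thesis using that c(1) by blast
qed

text \<open>A Lebesgue number without a metric on C or Y: closeness is measured by the coordinates,
  which determine the value of q. Compactness makes this uniform, first over the points b that q
  sends outside U, then over a.\<close>

lemma coordinate_Lebesgue_number:
  fixes e :: "nat \<Rightarrow> 'c \<Rightarrow> real"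
  assumes C: "compact_space C" and q: "continuous_map C Y q"
    and e: "\<And>i. i < N \<Longrightarrow> continuous_map C euclideanreal (e i)"
    and inj: "\<And>a b. a \<in> topspace C \<Longrightarrow> b \<in> topspace C \<Longrightarrow> (\<And>i. i < N \<Longrightarrow> e i a = e i b) \<Longrightarrow> q a = q b"
    and \<U>: "\<And>U. U \<in> \<U> \<Longrightarrow> openin Y U" "topspace Y \<subseteq> \<Union>\<U>"
  obtains \<epsilon> where "\<epsilon> > 0" "\<And>a. a \<in> topspace C \<Longrightarrow>
     \<exists>U\<in>\<U>. \<forall>b\<in>topspace C. (\<forall>i<N. \<bar>e i a - e i b\<bar> < \<epsilon>) \<longrightarrow> q b \<in> U"
proof -
  have op: "openin C {b \<in> topspace C. e i b \<in> S}" if "i < N" "open S" for i S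
    using that by (intro openin_continuous_map_preimage[OF e]) simp_all
  have gt: "openin C {b \<in> topspace C. x < \<bar>r - e i b\<bar>}"
    and lt: "openin C {b \<in> topspace C. \<bar>r - e i b\<bar> < x}" if "i < N" for i r x
    using op[OF that, of "{y. x < \<bar>r - y\<bar>}"] op[OF that, of "{y. \<bar>r - y\<bar> < x}"]
    by (simp_all add: open_Collect_less continuous_on_rabs continuous_on_diff)
  have "\<exists>p. fst p \<in> \<U> \<and> snd p > 0 \<and>
      (\<forall>b\<in>topspace C. (\<forall>i<N. \<bar>e i a - e i b\<bar> < snd p) \<longrightarrow> q b \<in> fst p)"
    if a: "a \<in> topspace C" for a
  proof -
    have "q a \<in> topspace Y" using q a by (simp add: continuous_map_def Pi_iff)
    then obtain U where U: "U \<in> \<U>" "q a \<in> U" using \<U>(2) by blast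
    let ?D = "topspace C - {b \<in> topspace C. q b \<in> U}"
    \<comment> \<open>These open sets cover the compact set \<open>?D\<close>, because q a \<noteq>
      q b forces some coordinate to differ.\<close>
    define Q where "Q m = (\<Union>i<N. {b \<in> topspace C. inverse (Suc m) < \<bar>e i a - e i b\<bar>})" for m
    have "closedin C ?D"
      using openin_continuous_map_preimage[OF q \<U>(1)[OF U(1)]] by blast
    then have cD: "compactin C ?D" using C closedin_compact_space by blast
    have "openin C (Q m)" for m
      unfolding Q_def
      by (intro openin_Union) (use gt in auto)
    moreover have "?D \<subseteq> \<Union>(range Q)"
    proof
      fix b assume b: "b \<in> ?D"
      then have "q a \<noteq> q b" using U by auto
      then obtain i where i: "i < N" "e i a \<noteq> e i b" using inj a b by blast
      then obtain m where "inverse (Suc m) < \<bar>e i a - e i b\<bar>"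
        using reals_Archimedean[of "\<bar>e i a - e i b\<bar>"] by auto
      then show "b \<in> \<Union>(range Q)" using i b unfolding Q_def by auto
    qed
    ultimately have "\<exists>\<F>. finite \<F> \<and> \<F> \<subseteq> range Q \<and> ?D \<subseteq> \<Union>\<F>"
      by (intro compactinD[OF cD]) auto
    then obtain \<F> where \<F>: "finite \<F>" "\<F> \<subseteq> range Q" "?D \<subseteq> \<Union>\<F>"
      by (elim exE conjE)
    obtain F where "finite F" "\<F> = Q ` F"
      using finite_subset_image[OF \<F>(1,2)] by auto
    then have F: "finite F" "?D \<subseteq> \<Union>(Q ` F)" using \<F>(3) by simp_all
    \<comment> \<open>The element 0 keeps \<open>Max\<close> defined if \<open>F\<close> is
      empty.\<close>
    define M where "M = Max (insert 0 F)"
    have "q b \<in> U" if b: "b \<in> topspace C" "\<forall>i<N. \<bar>e i a - e i b\<bar> < inverse (Suc M)" for b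
    proof (rule ccontr)
      assume "q b \<notin> U"
      then have "b \<in> \<Union>(Q ` F)" using F(2) b(1) by auto
      then obtain m i where m: "m \<in> F" "i < N" "inverse (Suc m) < \<bar>e i a - e i b\<bar>"
        unfolding Q_def by auto
      have "m \<le> M" unfolding M_def using F m by simp
      then have "inverse (real (Suc M)) \<le> inverse (Suc m)" by (simp add: field_simps)
      moreover have "\<bar>e i a - e i b\<bar> < inverse (Suc M)" using b(2) m(2) by simp
      ultimately show False using m(3) by linarith
    qed
    then show ?thesis using U(1) by (intro exI[of _ "(U, inverse (real (Suc M)))"]) simp
  qed
  then have "\<forall>a\<in>topspace C. \<exists>p. fst p \<in> \<U> \<and> snd p > 0 \<and>
      (\<forall>b\<in>topspace C. (\<forall>i<N. \<bar>e i a - e i b\<bar> < snd p) \<longrightarrow> q b \<in> fst p)" by simp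
  then obtain p where p: "\<forall>a\<in>topspace C. fst (p a) \<in> \<U> \<and> snd (p a) > 0 \<and>
      (\<forall>b\<in>topspace C. (\<forall>i<N. \<bar>e i a - e i b\<bar> < snd (p a)) \<longrightarrow> q b \<in> fst (p a))"
    unfolding bchoice_iff by (elim exE)
  define U \<delta> where "U a = fst (p a)" and "\<delta> a = snd (p a)" for a
  have U: "U a \<in> \<U>" "\<delta> a > 0"
    "\<And>b. b \<in> topspace C \<Longrightarrow> (\<And>i. i < N \<Longrightarrow> \<bar>e i a - e i b\<bar> < \<delta> a) \<Longrightarrow> q b \<in> U a"
    if "a \<in> topspace C" for a
    using bspec[OF p that] by (simp_all add: U_def \<delta>_def)
  \<comment> \<open>Half of \<open>\<delta> a\<close> leaves room for the triangle inequality
    below.\<close>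
  define Q where "Q a = topspace C \<inter> \<Inter> ((\<lambda>i. {b \<in> topspace C. \<bar>e i a - e i b\<bar> < \<delta> a / 2}) ` {..<N})" for a
  have "openin C (Q a)" for a
    unfolding Q_def
    by (intro openin_Int_Inter) (simp, simp, elim imageE, simp only: lessThan_iff lt)
  moreover have "a \<in> Q a" if "a \<in> topspace C" for a
    using U[OF that] that unfolding Q_def by simp
  moreover have "compactin C (topspace C)" using C by (simp add: compact_space_def)
  ultimately obtain F where F: "finite F" "F \<subseteq> topspace C" "topspace C \<subseteq> \<Union>(Q ` F)"
    by (elim compactin_finite_subcover[of _ _ Q]) auto
  define \<epsilon> where "\<epsilon> = Min (insert 1 ((\<lambda>a. \<delta> a / 2) ` F))"
  have "\<epsilon> > 0" unfolding \<epsilon>_def using F(1,2) U(2) by (subst Min_gr_iff) auto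
  show thesis
  proof (rule that[OF \<open>\<epsilon> > 0\<close>])
    fix b assume b: "b \<in> topspace C"
    then obtain a where a: "a \<in> F" "b \<in> Q a" using F(3) by auto
    then have "\<epsilon> \<le> \<delta> a / 2" unfolding \<epsilon>_def using F(1) by (intro Min_le) blast+
    have aC: "a \<in> topspace C" using a F by auto
    have "q c \<in> U a" if c: "c \<in> topspace C" "\<forall>i<N. \<bar>e i b - e i c\<bar> < \<epsilon>" for c
    proof (rule U(3)[OF aC c(1)])
      fix i assume i: "i < N"
      have "\<bar>e i b - e i c\<bar> < \<epsilon>" using c(2) i by simp
      moreover have "\<bar>e i a - e i b\<bar> < \<delta> a / 2" using a(2) i unfolding Q_def by simp
      ultimately show "\<bar>e i a - e i c\<bar> < \<delta> a" using \<open>\<epsilon> \<le> \<delta> a / 2\<close> by linarith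
    qed
    then show "\<exists>U\<in>\<U>. \<forall>c\<in>topspace C. (\<forall>i<N. \<bar>e i b - e i c\<bar> < \<epsilon>) \<longrightarrow> q c \<in> U"
      using U(1)[OF aC] by (intro bexI[of _ "U a"]) simp_all
  qed
qed

text \<open>The coordinates live on C, not on Y; the equivalence in the last hypothesis says that
  they descend to an injective map on the image of q. Two boxes of one colour are separated by a gap
  in some coordinate, so their images are disjoint; the images are closed because C is compact and Y
  is Hausdorff.\<close>

lemma colorable_coordinates:
  fixes e :: "nat \<Rightarrow> 'c \<Rightarrow> real"
  assumes C: "compact_space C" and q: "continuous_map C Y q" and Y: "Hausdorff_space Y"
    and e: "\<And>i. i < N \<Longrightarrow> continuous_map C euclideanreal (e i)"
    and inj: "\<And>a b. a \<in> topspace C \<Longrightarrow> b \<in> topspace C \<Longrightarrow> q a = q b \<longleftrightarrow> (\<forall>i<N. e i a = e i b)"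
  shows "colorable Y N (q ` topspace C)"
  unfolding colorable_def
proof (intro allI impI, elim conjE)
  fix \<U> assume \<U>: "\<forall>U\<in>\<U>. openin Y U" "topspace Y \<subseteq> \<Union>\<U>"
  obtain \<epsilon> where "\<epsilon> > 0" and \<epsilon>: "\<And>a. a \<in> topspace C \<Longrightarrow>
     \<exists>U\<in>\<U>. \<forall>b\<in>topspace C. (\<forall>i<N. \<bar>e i a - e i b\<bar> < \<epsilon>) \<longrightarrow> q b \<in> U"
  proof (rule coordinate_Lebesgue_number[OF C q e _ _ \<U>(2)])
    show "q a = q b" if "a \<in> topspace C" "b \<in> topspace C" "\<And>i. i < N \<Longrightarrow> e i a = e i b" for a b
      using inj[OF that(1,2)] that(3) by simp
  qed (use \<U>(1) in simp_all)
  \<comment> \<open>After scaling by R the boxes have side at most 1, so the coordinates of two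
    points of a box differ by at most 1 / R, which is half of \<epsilon>.\<close>
  define R where "R = 2 / \<epsilon>"
  have "R > 0" "1 / R < \<epsilon>" using \<open>\<epsilon> > 0\<close> by (auto simp: R_def)
  define cell where "cell c \<mu> = {a \<in> topspace C. \<forall>i<N.
      R * e i a \<in> {real_of_int (\<mu> i) + (real c + 1) / (real N + 1) .. real_of_int (\<mu> i) + 1 + real c / (real N + 1)}}" for c and \<mu> :: "nat \<Rightarrow> int"
  have "\<exists>B. \<forall>a\<in>topspace C. \<bar>R * e i a\<bar> \<le> B" if "i < N" for i
  proof -
    have "continuous_map C euclideanreal (\<lambda>a. R * e i a)"
      using e[OF that] by (intro continuous_intros)
    then have "compact ((\<lambda>a. R * e i a) ` topspace C)"
      using C image_compactin unfolding compact_space_def by (metis compactin_euclidean_iff)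
    then show ?thesis using compact_imp_bounded by (fastforce simp: bounded_iff)
  qed
  then obtain B0 where B0: "\<And>i a. i < N \<Longrightarrow> a \<in> topspace C \<Longrightarrow> \<bar>R * e i a\<bar> \<le> B0 i" by metis
  \<comment> \<open>One integer bound for all scaled coordinates; the sum dominates each of its
    terms.\<close>
  define B where "B = \<lceil>\<Sum>i<N. \<bar>B0 i\<bar>\<rceil>"
  have B: "\<bar>R * e i a\<bar> \<le> B" if "i < N" "a \<in> topspace C" for i a
  proof -
    have "\<bar>R * e i a\<bar> \<le> \<bar>B0 i\<bar>" using B0[OF that] by simp
    also have "\<dots> \<le> (\<Sum>i<N. \<bar>B0 i\<bar>)" using that by (intro member_le_sum) auto
    finally show ?thesis unfolding B_def by linarith
  qed
  \<comment> \<open>Indices of boxes that can be non-empty: an interval of index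
    \<open>\<mu> i\<close> lies between \<open>\<mu> i\<close> and \<open>\<mu> i + 2\<close>, hence
    the margin 2. Extensionality makes two different indices differ at some i < N.\<close>
  define M where "M = PiE {..<N} (\<lambda>_. {-B-2..B+2})"
  define \<V> where "\<V> c = (\<lambda>\<mu>. q ` cell c \<mu>) ` M - {{}}" for c
  have "finite M" unfolding M_def by (intro finite_PiE) auto
  have cell_closed: "closedin C (cell c \<mu>)" for c \<mu>
  proof -
    have "cell c \<mu> = topspace C \<inter> (\<Inter>i<N. {a \<in> topspace C.
      R * e i a \<in> {real_of_int (\<mu> i) + (real c + 1) / (real N + 1) .. real_of_int (\<mu> i) + 1 + real c / (real N + 1)}})"
      unfolding cell_def by auto
    also have "closedin C \<dots>"
    \<comment> \<open>For N = 0 the intersection runs over no index and is the whole type, so the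
      single box is all of C.\<close>
    proof (cases "N = 0")
      case False
      then show ?thesis
        by (intro closedin_Int closedin_INT closedin_topspace closedin_continuous_map_preimage[where Y=euclideanreal]
            continuous_map_real_mult continuous_map_const[THEN iffD2]) (auto simp: e)
    qed auto
    finally show ?thesis .
  qed
  have cellD: "\<bar>R * e i a - R * e i b\<bar> \<le> 1" if "a \<in> cell c \<mu>" "b \<in> cell c \<mu>" "i < N" for a b c \<mu> i
  proof -
    have "real c / (real N + 1) \<le> (real c + 1) / (real N + 1)" by (simp add: field_simps)
    with that show ?thesis unfolding cell_def by fastforce
  qed
  have "closed_coloring Y N \<U> \<V>"
    unfolding closed_coloring_def
  proof (intro allI impI conjI ballI)
    fix c assume "c \<le> N"
    show "finite (\<V> c)" using \<open>finite M\<close> unfolding \<V>_def by auto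
    show "pairwise disjnt (\<V> c)"
    proof (rule pairwiseI)
      fix S T assume "S \<in> \<V> c" "T \<in> \<V> c" "S \<noteq> T"
      then obtain \<mu> \<nu> where \<mu>: "S = q ` cell c \<mu>" "T = q ` cell c \<nu>" "\<mu> \<in> M" "\<nu> \<in> M" "\<mu> \<noteq> \<nu>"
        unfolding \<V>_def by blast
      then obtain i where i: "i < N" "\<mu> i \<noteq> \<nu> i"
        unfolding M_def by (metis PiE_ext lessThan_iff)
      have "q a \<noteq> q b" if "a \<in> cell c \<mu>" "b \<in> cell c \<nu>" for a b
      proof
        assume "q a = q b"
        then have "e i a = e i b" using inj that i unfolding cell_def by blast
        \<comment> \<open>Intervals of one colour are shorter than 1 and are integer translates of
          each other, so a common point forces equal indices.\<close>
        then have ab: "\<mu> i + (real c + 1) / (real N + 1) \<le> \<nu> i + 1 + real c / (real N + 1)"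
          "\<nu> i + (real c + 1) / (real N + 1) \<le> \<mu> i + 1 + real c / (real N + 1)"
          using that i unfolding cell_def by force+
        have lt: "real c / (real N + 1) < (real c + 1) / (real N + 1)" by (simp add: field_simps)
        have "real_of_int (\<mu> i) < \<nu> i + 1" "real_of_int (\<nu> i) < \<mu> i + 1" using ab lt by linarith+
        then have "\<mu> i = \<nu> i" by linarith
        then show False using i by simp
      qed
      then show "disjnt S T" using \<mu> by (auto simp: disjnt_def)
    qed
    fix S assume S: "S \<in> \<V> c"
    then obtain \<mu> where \<mu>: "S = q ` cell c \<mu>" "S \<noteq> {}" unfolding \<V>_def by blast
    have "compactin C (cell c \<mu>)" using cell_closed C closedin_compact_space by blast
    then show "closedin Y S" using \<mu> q Y image_compactin compactin_imp_closedin by metis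
    obtain a where a: "a \<in> cell c \<mu>" using \<mu> by blast
    then obtain U where U: "U \<in> \<U>" "\<forall>b\<in>topspace C. (\<forall>i<N. \<bar>e i a - e i b\<bar> < \<epsilon>) \<longrightarrow> q b \<in> U"
      using \<epsilon>[of a] unfolding cell_def by blast
    have "q b \<in> U" if b: "b \<in> cell c \<mu>" for b
    proof -
      have "\<bar>e i a - e i b\<bar> < \<epsilon>" if "i < N" for i
      proof -
        have "R * \<bar>e i a - e i b\<bar> \<le> 1"
          using cellD[OF a b that] \<open>R > 0\<close> by (simp flip: right_diff_distrib add: abs_mult)
        then have "\<bar>e i a - e i b\<bar> \<le> 1 / R" using \<open>R > 0\<close> by (simp add: field_simps)
        then show ?thesis using \<open>1 / R < \<epsilon>\<close> by linarith
      qed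
      then show ?thesis using U b unfolding cell_def by blast
    qed
    then show "\<exists>U\<in>\<U>. S \<subseteq> U" using U \<mu> by blast
  qed
  moreover have "q ` topspace C \<subseteq> (\<Union>j\<le>N. \<Union>(\<V> j))"
  proof
    fix y assume "y \<in> q ` topspace C"
    then obtain a where a: "a \<in> topspace C" "y = q a" by blast
    obtain c where c: "c \<le> N" and good: "\<And>i. i < N \<Longrightarrow>
        \<exists>m. real_of_int m + (real c + 1) / (real N + 1) \<le> R * e i a \<and> R * e i a \<le> real_of_int m + 1 + real c / (real N + 1)"
      by (rule exists_good_color[of N "\<lambda>i. R * e i a"]) blast
    define m where "m i = (SOME m. real_of_int m + (real c + 1) / (real N + 1) \<le> R * e i a \<and> R * e i a \<le> real_of_int m + 1 + real c / (real N + 1))" for i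
    have m: "m i + (real c + 1) / (real N + 1) \<le> R * e i a \<and> R * e i a \<le> m i + 1 + real c / (real N + 1)" if "i < N" for i
      using someI_ex[OF good[OF that]] unfolding m_def[symmetric] by (simp add: add.commute add.left_commute)
    have "m i \<in> {-B-2..B+2}" if i: "i < N" for i
    proof -
      have "real c / (real N + 1) \<le> 1" "0 \<le> (real c + 1) / (real N + 1)" using c by (simp_all add: field_simps)
      then have "real_of_int (m i) \<le> B" "real_of_int (m i) \<ge> - B - 2" using m[OF i] B[OF i a(1)] by linarith+
      then show ?thesis by auto
    qed
    then have "restrict m {..<N} \<in> M" unfolding M_def by auto
    moreover have "a \<in> cell c (restrict m {..<N})" using m a unfolding cell_def by auto
    ultimately have "y \<in> \<Union>(\<V> c)" using a unfolding \<V>_def by blast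
    then show "y \<in> (\<Union>j\<le>N. \<Union>(\<V> j))" using c by blast
  qed
  ultimately show "\<exists>\<V>. closed_coloring Y N \<U> \<V> \<and> q ` topspace C \<subseteq> (\<Union>j\<le>N. \<Union>(\<V> j))" by blast
qed

section \<open>Dimension, motion planners and category\<close>

text \<open>If n < k, the image is open in k-space by invariance of domain, yet it lies in the
  hyperplane where coordinate n vanishes. Moving an image point along that coordinate gives the
  contradiction.\<close>

lemma Euclidean_space_injection_dim_le:
  assumes W: "openin (Euclidean_space k) W" "W \<noteq> {}"
    and f: "continuous_map (subtopology (Euclidean_space k) W) (Euclidean_space n) f" "inj_on f W"
  shows "k \<le> n"
proof (rule ccontr)
  assume "\<not> k \<le> n"
  then have nk: "n < k" by simp
  have "continuous_map (Euclidean_space n) (Euclidean_space k) id"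
    unfolding Euclidean_space_def
    by (rule continuous_map_into_subtopology)
       (use nk in \<open>auto intro: continuous_map_from_subtopology\<close>)
  then have "continuous_map (subtopology (Euclidean_space k) W) (Euclidean_space k) f"
    using continuous_map_compose[OF f(1)] by fastforce
  then have op: "openin (Euclidean_space k) (f ` W)"
    using W(1) f(2) by (intro invariance_of_domain_Euclidean_space)
  obtain w where w: "w \<in> W" using W(2) by blast
  define p where "p = f w"
  have "w \<in> topspace (subtopology (Euclidean_space k) W)"
    using w W(1) openin_subset by fastforce
  have fn: "f x \<in> topspace (Euclidean_space n)" if "x \<in> W" for x
  proof -
    have "x \<in> topspace (subtopology (Euclidean_space k) W)"
      using that W(1) openin_subset by fastforce
    then show ?thesis using f(1) by (simp add: continuous_map_def Pi_iff)
  qed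
  have pn: "p \<in> topspace (Euclidean_space n)" using fn[OF w] by (simp add: p_def)
  have cm: "continuous_map euclideanreal (Euclidean_space k) (\<lambda>t. p(n := t))"
    unfolding Euclidean_space_def
  proof (rule continuous_map_into_subtopology)
    have "continuous_map euclideanreal euclideanreal (\<lambda>t. (p(n := t)) i)" for i
      by (cases "i = n") auto
    then show "continuous_map euclideanreal (powertop_real UNIV) (\<lambda>t. p(n := t))"
      by (simp add: continuous_map_componentwise_UNIV)
    show "(\<lambda>t. p(n := t)) \<in> topspace euclideanreal \<rightarrow> {x. \<forall>i\<ge>k. x i = 0}"
      using pn nk by (auto simp: topspace_Euclidean_space)
  qed
  have "open {t. p(n := t) \<in> f ` W}"
    using openin_continuous_map_preimage[OF cm op] by simp
  moreover have "p n = 0" using pn by (simp add: topspace_Euclidean_space)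
  then have "p(n := 0) = p" by (metis fun_upd_triv)
  then have "0 \<in> {t. p(n := t) \<in> f ` W}" using w by (simp add: p_def)
  ultimately obtain e where e: "e > 0" "ball 0 e \<subseteq> {t. p(n := t) \<in> f ` W}"
    using open_contains_ball by blast
  have "e / 2 \<in> ball 0 e" using e by simp
  then have "p(n := e / 2) \<in> f ` W" using e(2) by blast
  then have "p(n := e / 2) \<in> topspace (Euclidean_space n)" using fn by auto
  then have "(p(n := e / 2)) n = 0" unfolding topspace_Euclidean_space by blast
  then show False using e by simp
qed

section \<open>Homotopies on disjoint unions and motion planners\<close>

text \<open>Homotopies on disjoint open sets paste without any compatibility. Through this lemma a
  whole colour class, however many members it has, counts as one set of a cover.\<close>

lemma homotopic_with_Union_disjoint_open:
  assumes disj: "pairwise disjnt \<U>" and op: "\<And>U. U \<in> \<U> \<Longrightarrow> openin X U"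
    and hom: "\<And>U. U \<in> \<U> \<Longrightarrow> homotopic_with (\<lambda>_. True) (subtopology X U) Y f g"
  shows "homotopic_with (\<lambda>_. True) (subtopology X (\<Union>\<U>)) Y f g"
proof -
  have sub: "U \<subseteq> topspace X" if "U \<in> \<U>" for U using op[OF that] by (rule openin_subset)
  have "\<forall>U\<in>\<U>. \<exists>h. continuous_map (prod_topology (top_of_set {0..1::real}) (subtopology X U)) Y h \<and>
      (\<forall>x\<in>U. h (0, x) = f x \<and> h (1, x) = g x)"
  proof
    fix U assume U: "U \<in> \<U>"
    have "topspace (subtopology X U) = U" using sub[OF U] by auto
    then show "\<exists>h. continuous_map (prod_topology (top_of_set {0..1::real}) (subtopology X U)) Y h \<and>
      (\<forall>x\<in>U. h (0, x) = f x \<and> h (1, x) = g x)"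
      using hom[OF U] by (auto simp: homotopic_with)
  qed
  then obtain h where h: "\<And>U. U \<in> \<U> \<Longrightarrow> continuous_map (prod_topology (top_of_set {0..1::real}) (subtopology X U)) Y (h U)"
    and h01: "\<And>U x. U \<in> \<U> \<Longrightarrow> x \<in> U \<Longrightarrow> h U (0, x) = f x \<and> h U (1, x) = g x"
    by (metis (no_types, lifting) bchoice)
  define c where "c x = (THE U. U \<in> \<U> \<and> x \<in> U)" for x
  have c: "c x = U" if "U \<in> \<U>" "x \<in> U" for U x
    unfolding c_def by (rule the_equality) (use that disj in \<open>auto simp: pairwise_def disjnt_def\<close>)
  define H where "H = (\<lambda>(t, x). h (c x) (t, x))"
  let ?P = "prod_topology (top_of_set {0..1::real}) (subtopology X (\<Union>\<U>))"
  have "continuous_map ?P Y H"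
  proof (rule pasting_lemma[where I = \<U> and T = "\<lambda>U. {0..1} \<times> U" and f = h])
    fix U assume U: "U \<in> \<U>"
    have "openin (subtopology X (\<Union>\<U>)) U"
      using op[OF U] U by (metis Sup_upper openin_subset openin_subtopology_Int2 inf.absorb_iff2 openin_subtopology)
    then show "openin ?P ({0..1} \<times> U)"
      by (simp add: openin_prod_Times_iff)
    have "subtopology ?P ({0..1} \<times> U) = prod_topology (top_of_set {0..1}) (subtopology X U)"
      using U by (simp add: subtopology_Times subtopology_subtopology inf.absorb2 Sup_upper)
    then show "continuous_map (subtopology ?P ({0..1} \<times> U)) Y (h U)" using h[OF U] by simp
  next
    fix U V p assume UV: "U \<in> \<U>" "V \<in> \<U>" and p: "p \<in> topspace ?P \<inter> {0..1} \<times> U \<inter> {0..1} \<times> V"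
    have "U = V" using c[OF UV(1), of "snd p"] c[OF UV(2), of "snd p"] p by auto
    then show "h U p = h V p" by simp
  next
    fix p assume "p \<in> topspace ?P"
    then obtain t x U where "p = (t, x)" "t \<in> {0..1}" "U \<in> \<U>" "x \<in> U" by auto
    then show "\<exists>U. U \<in> \<U> \<and> p \<in> {0..1} \<times> U \<and> H p = h U p"
      using c by (intro exI[of _ U]) (simp add: H_def)
  qed
  moreover have "H (0, x) = f x" "H (1, x) = g x" if x: "x \<in> topspace (subtopology X (\<Union>\<U>))" for x
  proof -
    obtain U where U: "U \<in> \<U>" "x \<in> U" using x by auto
    then show "H (0, x) = f x" "H (1, x) = g x" using c h01 by (simp_all add: H_def)
  qed
  ultimately show ?thesis by (auto simp: homotopic_with)
qed

text \<open>The planner is the curried homotopy. Its continuity into the compact-open topology is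
  the tube lemma: for compact K, the points z such that h (t, z) leaves V for some t in K form the
  projection of a closed set along K, hence a closed set.\<close>

lemma homotopic_endpoints_imp_motion_planner:
  assumes U: "U \<subseteq> topspace (prod_topology X X)"
    and hom: "homotopic_with (\<lambda>_. True) (subtopology (prod_topology X X) U) X fst snd"
  shows "\<exists>s. continuous_map (subtopology (prod_topology X X) U) (path_space X) s \<and>
             (\<forall>z\<in>U. path_endpoints (s z) = z)"
proof -
  let ?Z = "subtopology (prod_topology X X) U" and ?I = "top_of_set {0..1::real}"
  have tZ: "topspace ?Z = U" using U by auto
  obtain h where h: "continuous_map (prod_topology ?I ?Z) X h"
    and h01: "\<And>z. z \<in> U \<Longrightarrow> h (0, z) = fst z \<and> h (1, z) = snd z"
    using hom tZ by (auto simp: homotopic_with)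
  \<comment> \<open>The restriction is there because the points of \<open>path_space\<close> are
    extensional functions.\<close>
  define s where "s z = restrict (\<lambda>t. h (t, z)) {0..1::real}" for z
  have path: "continuous_map ?I X (s z)" if "z \<in> U" for z
  proof -
    have "continuous_map ?I (prod_topology ?I ?Z) (\<lambda>t. (t, z))"
      using that tZ by (simp add: continuous_map_pairedI)
    from continuous_map_compose[OF this h] have "continuous_map ?I X (\<lambda>t. h (t, z))"
      by (simp add: o_def)
    then show ?thesis by (rule continuous_map_eq) (simp add: s_def)
  qed
  have "continuous_map ?Z (path_space X) s"
    unfolding path_space_def compact_open_topology_def
  proof (rule continuous_on_generated_topo)
    fix B assume "B \<in> {{\<gamma> \<in> extensional (topspace ?I). continuous_map ?I X \<gamma> \<and> \<gamma> ` K \<subseteq> V} | K V.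
          compactin ?I K \<and> openin X V}"
    then obtain K V where B: "B = {\<gamma> \<in> extensional (topspace ?I). continuous_map ?I X \<gamma> \<and> \<gamma> ` K \<subseteq> V}"
      and K: "compactin ?I K" and V: "openin X V" by blast
    have K01: "K \<subseteq> {0..1}" using compactin_subset_topspace[OF K] by simp
    let ?Q = "prod_topology (subtopology ?I K) ?Z"
    have hK: "continuous_map ?Q X h"
      using h continuous_map_from_subtopology[OF h, of "K \<times> UNIV"] by (simp add: subtopology_Times)
    define D where "D = {p \<in> topspace ?Q. h p \<in> topspace X - V}"
    have "closedin ?Q D"
      unfolding D_def using V by (intro closedin_continuous_map_preimage[OF hK]) blast
    moreover have "closed_map ?Q ?Z snd"
      using K by (intro closed_map_snd) (simp add: compact_space_subtopology)
    ultimately have cl: "closedin ?Z (snd ` D)" unfolding closed_map_def by blast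
    have "s -` B \<inter> topspace ?Z = topspace ?Z - snd ` D"
    proof (intro subset_antisym subsetI)
      fix z assume z: "z \<in> s -` B \<inter> topspace ?Z"
      have "z \<notin> snd ` D"
      proof
        assume "z \<in> snd ` D"
        then obtain t where t: "t \<in> K" "h (t, z) \<notin> V" unfolding D_def by auto
        then have "s z t \<notin> V" using K01 by (auto simp: s_def)
        moreover have "s z ` K \<subseteq> V" using z B by simp
        ultimately show False using t by blast
      qed
      then show "z \<in> topspace ?Z - snd ` D" using z by simp
    next
      fix z assume z: "z \<in> topspace ?Z - snd ` D"
      then have zU: "z \<in> U" using tZ by blast
      have "s z t \<in> V" if t: "t \<in> K" for t
      proof -
        have "(t, z) \<in> topspace ?Q" using t K01 z by auto
        moreover from this have "h (t, z) \<in> topspace X" using hK by (simp add: continuous_map_def Pi_iff)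
        moreover have "(t, z) \<notin> D" using z by force
        ultimately have "h (t, z) \<in> V" unfolding D_def by blast
        then show ?thesis using t K01 by (auto simp: s_def)
      qed
      then have "s z ` K \<subseteq> V" by blast
      then show "z \<in> s -` B \<inter> topspace ?Z" using path[OF zU] z B by (simp add: s_def)
    qed
    then show "openin ?Z (s -` B \<inter> topspace ?Z)"
      using openin_diff[OF openin_topspace cl] by (simp only:)
  next
    have "s z \<in> topspace (compact_open_topology ?I X)" if "z \<in> U" for z
      using path[OF that] by (simp add: topspace_compact_open_topology s_def)
    then show "s ` topspace ?Z \<subseteq> \<Union> {{\<gamma> \<in> extensional (topspace ?I). continuous_map ?I X \<gamma> \<and> \<gamma> ` K \<subseteq> V} | K V.
          compactin ?I K \<and> openin X V}"
      unfolding compact_open_topology_def topology_generated_by_topspace tZ by blast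
  qed
  moreover have "\<forall>z\<in>U. path_endpoints (s z) = z"
    using h01 by (simp add: path_endpoints_def s_def)
  ultimately show ?thesis by blast
qed

section \<open>Covers that bound TC and category\<close>

lemma TC_le:
  fixes U :: "nat \<Rightarrow> ('a \<times> 'a) set"
  assumes "(\<Union>i<k. U i) = topspace (prod_topology X X)"
    and "\<And>i. i < k \<Longrightarrow> openin (prod_topology X X) (U i)"
    and "\<And>i. i < k \<Longrightarrow> homotopic_with (\<lambda>_. True) (subtopology (prod_topology X X) (U i)) X fst snd"
  shows "TC X \<le> enat k"
proof -
  have "\<exists>s. continuous_map (subtopology (prod_topology X X) (U i)) (path_space X) s \<and>
             (\<forall>z\<in>U i. path_endpoints (s z) = z)" if "i < k" for i
    using assms(2,3)[OF that] by (intro homotopic_endpoints_imp_motion_planner openin_subset)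
  with assms(1,2) show ?thesis
    unfolding TC_def by (intro Inf_lower CollectI exI[of _ k] exI[of _ U] conjI refl) blast+
qed

lemma LS_cat_le:
  fixes U :: "nat \<Rightarrow> 'a set"
  assumes "(\<Union>i<k. U i) = topspace X"
    and "\<And>i. i < k \<Longrightarrow> openin X (U i)"
    and "\<And>i. i < k \<Longrightarrow> \<exists>c\<in>topspace X. homotopic_with (\<lambda>_. True) (subtopology X (U i)) X id (\<lambda>_. c)"
  shows "LS_cat X \<le> enat k"
  unfolding LS_cat_def using assms
  by (intro Inf_lower CollectI exI[of _ k] exI[of _ U] conjI refl) blast+

text \<open>This turns the connectedness assumed of the manifold into path-connectedness, on which
  every planner and every comparison of base points rests.\<close>

lemma locally_path_connected_space_charts:
  assumes "\<And>x. x \<in> topspace X \<Longrightarrow> \<exists>U p. x \<in> U \<and> is_chart n X (U, p)"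
  shows "locally_path_connected_space X"
  unfolding locally_path_connected_space
proof (intro allI impI, elim conjE)
  fix V x assume V: "openin X V" "x \<in> V"
  then have "x \<in> topspace X" using openin_subset by blast
  then obtain U p where U: "x \<in> U" "openin X U" "openin (Euclidean_space n) (p ` U)"
    "homeomorphic_map (subtopology X U) (subtopology (Euclidean_space n) (p ` U)) p"
    using assms unfolding is_chart_def by blast
  have "locally_path_connected_space (subtopology (Euclidean_space n) (p ` U))"
    using U(3) by (intro locally_path_connected_space_open_subset locally_path_connected_Euclidean_space)
  then have "locally_path_connected_space (subtopology X U)"
    using homeomorphic_locally_path_connected_space homeomorphic_map_imp_homeomorphic_space[OF U(4)] by blast
  moreover have "openin (subtopology X U) (U \<inter> V)"
    using V(1) by (rule openin_subtopology_Int2)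
  ultimately obtain W where W: "openin (subtopology X U) W" "path_connectedin (subtopology X U) W" "x \<in> W" "W \<subseteq> U \<inter> V"
    unfolding locally_path_connected_space using U(1) V(2) by blast
  have "openin X W" using W(1) U(2) by (rule openin_trans_full)
  moreover have "path_connectedin X W" using W(2) by (simp add: path_connectedin_subtopology)
  ultimately show "\<exists>U. openin X U \<and> path_connectedin X U \<and> x \<in> U \<and> U \<subseteq> V"
    using W(3,4) by blast
qed

section \<open>Lifting homotopies\<close>

text \<open>
  In a principal bundle, \<open>T (e, y)\<close> is the point over \<open>y\<close> with the same fibre coordinate as \<open>e\<close> in a
  trivialisation over \<open>W\<close>.
\<close>
definition local_transport :: "'e topology \<Rightarrow> 'y topology \<Rightarrow> ('e \<Rightarrow> 'y) \<Rightarrow> 'y set \<Rightarrow> ('e \<times> 'y \<Rightarrow> 'e) \<Rightarrow> bool" where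
  "local_transport E Y q W T \<longleftrightarrow>
     continuous_map (subtopology (prod_topology E Y) {(e, y). q e \<in> W \<and> y \<in> W}) E T \<and>
     (\<forall>e\<in>topspace E. \<forall>y\<in>W. q e \<in> W \<longrightarrow> q (T (e, y)) = y) \<and>
     (\<forall>e\<in>topspace E. q e \<in> W \<longrightarrow> T (e, q e) = e)"

text \<open>
  Instead of lifting the whole homotopy, a lift of its stage at time \<open>\<sigma> z\<close> is deformed into a lift of its
  stage at time \<open>\<tau> z\<close>.
\<close>
lemma lift_step:
  assumes q: "continuous_map E Y q" and T: "local_transport E Y q W T" and W: "W \<subseteq> topspace Y"
    and h: "continuous_map (prod_topology (top_of_set {0..1::real}) Z) Y h"
    and \<sigma>: "continuous_map Z euclideanreal \<sigma>" "\<And>z. z \<in> topspace Z \<Longrightarrow> \<sigma> z \<in> {0..1}"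
    and \<tau>: "continuous_map Z euclideanreal \<tau>" "\<And>z. z \<in> topspace Z \<Longrightarrow> \<tau> z \<in> {0..1}"
    and A: "openin Z A" and C: "closedin Z C" "C \<subseteq> A"
    and le: "\<And>z. z \<in> topspace Z \<Longrightarrow> \<sigma> z \<le> \<tau> z"
    and eq: "\<And>z. z \<in> topspace Z - C \<Longrightarrow> \<sigma> z = \<tau> z"
    and hW: "\<And>z t. z \<in> A \<Longrightarrow> \<sigma> z \<le> t \<Longrightarrow> t \<le> \<tau> z \<Longrightarrow> h (t, z) \<in> W"
    and f: "continuous_map Z E f" "\<And>z. z \<in> topspace Z \<Longrightarrow> q (f z) = h (\<sigma> z, z)"
  obtains f' where "continuous_map Z E f'" "\<And>z. z \<in> topspace Z \<Longrightarrow> q (f' z) = h (\<tau> z, z)"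
    "homotopic_with (\<lambda>_. True) Z E f f'"
proof -
  let ?I = "top_of_set {0..1::real}"
  let ?P = "prod_topology ?I Z"
  \<comment> \<open>A convex combination, so all intermediate times lie between
    \<open>\<sigma> z\<close> and \<open>\<tau> z\<close>, where \<open>hW\<close> keeps the
    homotopy inside W.\<close>
  define r where "r = (\<lambda>(s, z). (1 - s) * \<sigma> z + s * \<tau> z)"
  \<comment> \<open>Off C the two times agree, so the transport returns f z there. Hence the
    branches match on the overlap of the open set A with the complement of C, and they
    paste.\<close>
  define H where "H = (\<lambda>(s, z). if z \<in> A then T (f z, h (r (s, z), z)) else f z)"
  have AZ: "A \<subseteq> topspace Z" using A by (rule openin_subset)
  have r01: "\<sigma> z \<le> r (s, z) \<and> r (s, z) \<le> \<tau> z" if "s \<in> {0..1}" "z \<in> topspace Z" for s z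
  proof -
    have "0 \<le> s * (\<tau> z - \<sigma> z)" "0 \<le> (1 - s) * (\<tau> z - \<sigma> z)"
      using that le by (simp_all add: mult_nonneg_nonneg)
    then show ?thesis by (simp add: r_def algebra_simps)
  qed
  have rI: "r (s, z) \<in> {0..1}" if "s \<in> {0..1}" "z \<in> topspace Z" for s z
    using r01[OF that] \<sigma>(2)[OF that(2)] \<tau>(2)[OF that(2)] by auto
  have hr: "continuous_map ?P Y (\<lambda>p. h (r p, snd p))"
  proof -
    have fstI: "continuous_map ?P euclideanreal fst"
      using continuous_map_fst[of ?I Z] by (simp add: continuous_map_in_subtopology)
    have \<sigma>2: "continuous_map ?P euclideanreal (\<lambda>p. \<sigma> (snd p))"
      using continuous_map_compose[OF continuous_map_snd \<sigma>(1)] by (simp add: o_def)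
    have \<tau>2: "continuous_map ?P euclideanreal (\<lambda>p. \<tau> (snd p))"
      using continuous_map_compose[OF continuous_map_snd \<tau>(1)] by (simp add: o_def)
    have "continuous_map ?P euclideanreal (\<lambda>p. (1 - fst p) * \<sigma> (snd p) + fst p * \<tau> (snd p))"
      using fstI \<sigma>2 \<tau>2
      by (intro continuous_map_add continuous_map_real_mult continuous_map_diff) auto
    then have "continuous_map ?P euclideanreal r" by (simp add: r_def case_prod_unfold)
    then have "continuous_map ?P ?I r"
      using rI by (intro continuous_map_into_subtopology) auto
    then have "continuous_map ?P ?P (\<lambda>p. (r p, snd p))"
      by (intro continuous_map_pairedI continuous_map_snd)
    from continuous_map_compose[OF this h] show ?thesis by (simp add: o_def)
  qed
  have f2: "continuous_map ?P E (\<lambda>p. f (snd p))"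
    using continuous_map_compose[OF continuous_map_snd f(1)] by (simp add: o_def)
  have fW: "q (f z) \<in> W" if "z \<in> A" for z
    using f(2) hW[OF that order_refl] le that AZ by (metis subsetD)
  have hrW: "h (r (s, z), z) \<in> W" if "z \<in> A" "s \<in> {0..1}" for s z
    using hW[OF that(1)] r01[OF that(2)] that(1) AZ by blast
  have fE: "f z \<in> topspace E" if "z \<in> topspace Z" for z
    using f(1) that by (simp add: continuous_map_def Pi_iff)
  have Tq: "q (T (e, y)) = y" if "e \<in> topspace E" "y \<in> W" "q e \<in> W" for e y
    using T that unfolding local_transport_def by blast
  have Te: "T (e, q e) = e" if "e \<in> topspace E" "q e \<in> W" for e
    using T that unfolding local_transport_def by blast
  have H: "continuous_map ?P E H"
  proof (rule pasting_lemma[where I = "UNIV :: bool set"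
        and T = "\<lambda>b. {0..1} \<times> (if b then A else topspace Z - C)"
        and f = "\<lambda>b p. if b then T (f (snd p), h (r p, snd p)) else f (snd p)"])
    show "openin ?P ({0..1} \<times> (if b then A else topspace Z - C))" for b
      using A openin_diff[OF openin_topspace C(1)] by (cases b) (simp_all add: openin_prod_Times_iff)
  next
    fix b :: bool
    let ?S = "subtopology ?P ({0..1} \<times> (if b then A else topspace Z - C))"
    show "continuous_map ?S E (\<lambda>p. if b then T (f (snd p), h (r p, snd p)) else f (snd p))"
    proof (cases b)
      case True
      have "continuous_map ?S (subtopology (prod_topology E Y) {(e, y). q e \<in> W \<and> y \<in> W}) (\<lambda>p. (f (snd p), h (r p, snd p)))"
        using True fW hrW
        by (intro continuous_map_into_subtopology continuous_map_pairedI continuous_map_from_subtopology f2 hr) auto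
      then have "continuous_map ?S E (T \<circ> (\<lambda>p. (f (snd p), h (r p, snd p))))"
        using T unfolding local_transport_def by (intro continuous_map_compose) auto
      then show ?thesis using True by (simp add: o_def)
    next
      case False
      then show ?thesis using f2 by (simp add: continuous_map_from_subtopology)
    qed
  next
    fix b b' p assume p: "p \<in> topspace ?P \<inter> {0..1} \<times> (if b then A else topspace Z - C) \<inter> {0..1} \<times> (if b' then A else topspace Z - C)"
    have "T (f (snd p), h (r p, snd p)) = f (snd p)" if "snd p \<in> A" "snd p \<in> topspace Z - C"
    proof -
      have "r p = \<sigma> (snd p)" using eq[OF that(2)] by (simp add: r_def case_prod_unfold algebra_simps)
      then have "h (r p, snd p) = q (f (snd p))" using f(2) that(2) by simp
      then show ?thesis using Te fE fW that by simp
    qed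
    then show "(if b then T (f (snd p), h (r p, snd p)) else f (snd p)) = (if b' then T (f (snd p), h (r p, snd p)) else f (snd p))"
      using p by (cases b; cases b') auto
  next
    fix p assume p: "p \<in> topspace ?P"
    show "\<exists>b. b \<in> UNIV \<and> p \<in> {0..1} \<times> (if b then A else topspace Z - C) \<and>
          H p = (if b then T (f (snd p), h (r p, snd p)) else f (snd p))"
      using p C(2) by (intro exI[of _ "snd p \<in> A"]) (auto simp: H_def)
  qed
  have H0: "H (0, z) = f z" if "z \<in> topspace Z" for z
  proof (cases "z \<in> A")
    case True
    have "h (r (0, z), z) = q (f z)" using f(2)[OF that] by (simp add: r_def)
    then show ?thesis using True Te[OF fE[OF that] fW[OF True]] by (simp add: H_def)
  qed (simp add: H_def)
  define f' where "f' z = H (1, z)" for z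
  have f': "continuous_map Z E f'"
  proof -
    have "continuous_map Z ?P (\<lambda>z. (1, z))" by (intro continuous_map_pairedI) simp_all
    from continuous_map_compose[OF this H] show ?thesis by (simp add: o_def f'_def[abs_def])
  qed
  have qf': "q (f' z) = h (\<tau> z, z)" if z: "z \<in> topspace Z" for z
  proof (cases "z \<in> A")
    case True
    have "q (f' z) = q (T (f z, h (r (1, z), z)))" using True by (simp add: f'_def H_def)
    also have "\<dots> = h (r (1, z), z)" using fE[OF z] fW[OF True] hrW[OF True] by (intro Tq) simp_all
    finally show ?thesis by (simp add: r_def)
  next
    case False
    then have "z \<in> topspace Z - C" using C(2) z by blast
    then show ?thesis using False eq f(2)[OF z] by (simp add: f'_def H_def)
  qed
  have "homotopic_with (\<lambda>_. True) Z E f f'"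
    using H H0 by (auto simp: homotopic_with f'_def)
  then show thesis using that f' qf' by blast
qed

text \<open>Near a time t0 each point of Z has a neighbourhood that the homotopy keeps inside one
  trivialising set. Finitely many of these cover Z, and \<open>lift_step\<close> is applied to them
  in turn, raising the time from a to b on one neighbourhood after the other.\<close>

lemma lift_local:
  assumes q: "continuous_map E Y q"
    and loc: "\<And>y. y \<in> topspace Y \<Longrightarrow> \<exists>W T. openin Y W \<and> y \<in> W \<and> local_transport E Y q W T"
    and Z: "compact_space Z" "normal_space Z" "t1_space Z"
    and h: "continuous_map (prod_topology (top_of_set {0..1::real}) Z) Y h"
    and t0: "t0 \<in> {0..1}"
  shows "\<exists>d>0. \<forall>a b f. 0 \<le> a \<and> a \<le> t0 \<and> t0 \<le> b \<and> b \<le> 1 \<and> b - a < d \<and>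
      continuous_map Z E f \<and> (\<forall>z\<in>topspace Z. q (f z) = h (a, z)) \<longrightarrow>
      (\<exists>f'. continuous_map Z E f' \<and> (\<forall>z\<in>topspace Z. q (f' z) = h (b, z)) \<and>
         homotopic_with (\<lambda>_. True) Z E f f')"
proof -
  \<comment> \<open>Three nested neighbourhoods are chosen below: the time will reach b on B, remain
    unchanged off B', and the transport is available on A.\<close>
  let ?P = "prod_topology (top_of_set {0..1::real}) Z"
  have "\<exists>p. case p of (A, B, B', d, W, T) \<Rightarrow> openin Z A \<and> openin Z B \<and> openin Z B' \<and> z \<in> B \<and>
      Z closure_of B \<subseteq> B' \<and> Z closure_of B' \<subseteq> A \<and> d > (0::real) \<and> openin Y W \<and> local_transport E Y q W T \<and>
      (\<forall>t\<in>{0..1}. \<forall>z\<in>A. \<bar>t - t0\<bar> < d \<longrightarrow> h (t, z) \<in> W)" if z: "z \<in> topspace Z" for z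
  proof -
    have "h (t0, z) \<in> topspace Y" using h t0 z by (simp add: continuous_map_def Pi_iff)
    then obtain W T where W: "openin Y W" "h (t0, z) \<in> W" "local_transport E Y q W T"
      using loc by blast
    have "openin ?P {p \<in> topspace ?P. h p \<in> W}"
      using h W(1) by (rule openin_continuous_map_preimage)
    moreover have "(t0, z) \<in> {p \<in> topspace ?P. h p \<in> W}" using W(2) t0 z by simp
    ultimately obtain J A where J: "openin (top_of_set {0..1::real}) J" "t0 \<in> J"
      and A: "openin Z A" "z \<in> A" and JA: "J \<times> A \<subseteq> {p \<in> topspace ?P. h p \<in> W}"
      unfolding openin_prod_topology_alt by meson
    obtain d where d: "d > 0" "\<And>t. t \<in> {0..1} \<Longrightarrow> dist t t0 < d \<Longrightarrow> t \<in> J"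
      using J unfolding openin_euclidean_subtopology_iff by metis
    have "closedin Z {z}" using Z(3) z by (simp add: t1_space_closedin_singleton)
    then obtain B' where B': "openin Z B'" "{z} \<subseteq> B'" "Z closure_of B' \<subseteq> A"
      using Z(2) A unfolding normal_space_alt by (metis empty_subsetI insert_subset)
    then obtain B where B: "openin Z B" "{z} \<subseteq> B" "Z closure_of B \<subseteq> B'"
      using Z(2) \<open>closedin Z {z}\<close> unfolding normal_space_alt by metis
    have "\<forall>t\<in>{0..1}. \<forall>z\<in>A. \<bar>t - t0\<bar> < d \<longrightarrow> h (t, z) \<in> W"
    proof (intro ballI impI)
      fix t x assume "t \<in> {0..1}" "x \<in> A" "\<bar>t - t0\<bar> < d"
      then have "(t, x) \<in> J \<times> A" using d(2) by (simp add: dist_real_def)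
      then show "h (t, x) \<in> W" using JA by blast
    qed
    then show ?thesis using A B B' d(1) W by (intro exI[of _ "(A, B, B', d, W, T)"]) simp
  qed
  then have "\<forall>z\<in>topspace Z. \<exists>p. case p of (A, B, B', d, W, T) \<Rightarrow> openin Z A \<and> openin Z B \<and> openin Z B' \<and> z \<in> B \<and>
      Z closure_of B \<subseteq> B' \<and> Z closure_of B' \<subseteq> A \<and> d > (0::real) \<and> openin Y W \<and> local_transport E Y q W T \<and>
      (\<forall>t\<in>{0..1}. \<forall>z\<in>A. \<bar>t - t0\<bar> < d \<longrightarrow> h (t, z) \<in> W)" by simp
  then obtain p where p: "\<forall>z\<in>topspace Z. case p z of (A, B, B', d, W, T) \<Rightarrow> openin Z A \<and> openin Z B \<and> openin Z B' \<and> z \<in> B \<and>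
      Z closure_of B \<subseteq> B' \<and> Z closure_of B' \<subseteq> A \<and> d > (0::real) \<and> openin Y W \<and> local_transport E Y q W T \<and>
      (\<forall>t\<in>{0..1}. \<forall>z\<in>A. \<bar>t - t0\<bar> < d \<longrightarrow> h (t, z) \<in> W)"
    unfolding bchoice_iff by (elim exE)
  define A B B' d W T where "A z = fst (p z)" and "B z = fst (snd (p z))" and "B' z = fst (snd (snd (p z)))"
    and "d z = fst (snd (snd (snd (p z))))" and "W z = fst (snd (snd (snd (snd (p z)))))"
    and "T z = snd (snd (snd (snd (snd (p z)))))" for z
  have loc: "openin Z (A z)" "openin Z (B z)" "openin Z (B' z)" "z \<in> B z"
      "Z closure_of B z \<subseteq> B' z" "Z closure_of B' z \<subseteq> A z" "d z > 0" "openin Y (W z)" "local_transport E Y q (W z) (T z)"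
      "\<And>t x. t \<in> {0..1} \<Longrightarrow> x \<in> A z \<Longrightarrow> \<bar>t - t0\<bar> < d z \<Longrightarrow> h (t, x) \<in> W z"
    if "z \<in> topspace Z" for z
    using bspec[OF p that]
    by (simp_all add: A_def B_def B'_def d_def W_def T_def case_prod_unfold)
  have "compactin Z (topspace Z)" using Z(1) by (simp add: compact_space_def)
  then obtain F where F: "finite F" "F \<subseteq> topspace Z" "topspace Z \<subseteq> \<Union>(B ` F)"
    using loc(2,4) by (elim compactin_finite_subcover[of _ _ B]) auto
  \<comment> \<open>The element 1 keeps \<open>Min\<close> defined if Z is empty.\<close>
  define \<delta> where "\<delta> = Min (insert 1 (d ` F))"
  have "\<delta> > 0" unfolding \<delta>_def using F(1,2) loc(7) by (subst Min_gr_iff) auto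
  have \<delta>: "\<delta> \<le> d z" if "z \<in> F" for z unfolding \<delta>_def using F(1) that by (intro Min_le) auto
  show ?thesis
  proof (intro exI[of _ \<delta>] conjI \<open>\<delta> > 0\<close> allI impI, elim conjE)
    fix a b f assume ab: "0 \<le> a" "a \<le> t0" "t0 \<le> b" "b \<le> 1" "b - a < \<delta>"
      and f: "continuous_map Z E f" "\<forall>z\<in>topspace Z. q (f z) = h (a, z)"
    \<comment> \<open>Invariant of the induction: \<sigma> is the time to which the lift has been
      carried at each point, and it has reached b on the neighbourhoods treated so far.\<close>
    have "\<exists>\<sigma> f'. continuous_map Z euclideanreal \<sigma> \<and> (\<forall>z\<in>topspace Z. \<sigma> z \<in> {a..b}) \<and>
        (\<forall>z\<in>topspace Z \<inter> \<Union>(B ` G). \<sigma> z = b) \<and> continuous_map Z E f' \<and>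
        (\<forall>z\<in>topspace Z. q (f' z) = h (\<sigma> z, z)) \<and> homotopic_with (\<lambda>_. True) Z E f f'"
      if "finite G" "G \<subseteq> F" for G
      using that
    proof (induction G rule: finite_induct)
      case empty
      then show ?case using f ab by (intro exI[of _ "\<lambda>_. a"] exI[of _ f]) simp
    next
      case (insert w G)
      then obtain \<sigma> f' where \<sigma>: "continuous_map Z euclideanreal \<sigma>" "\<forall>z\<in>topspace Z. \<sigma> z \<in> {a..b}"
        "\<forall>z\<in>topspace Z \<inter> \<Union>(B ` G). \<sigma> z = b" and f': "continuous_map Z E f'"
        "\<forall>z\<in>topspace Z. q (f' z) = h (\<sigma> z, z)" "homotopic_with (\<lambda>_. True) Z E f f'"
        by auto
      have w: "w \<in> topspace Z" "w \<in> F" using insert.prems F(2) by auto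
      note lw = loc[OF w(1)]
      have "a \<le> b" using ab by simp
      have "disjnt (topspace Z - B' w) (Z closure_of B w)"
        using lw(5) by (auto simp: disjnt_def)
      then obtain u where u: "continuous_map Z (top_of_set {a..b}) u"
        "u ` (topspace Z - B' w) \<subseteq> {a}" "u ` (Z closure_of B w) \<subseteq> {b}"
        using Urysohn_lemma[OF Z(2), of "topspace Z - B' w" "Z closure_of B w" a b] lw(3) \<open>a \<le> b\<close> by auto
      have ur: "continuous_map Z euclideanreal u" "\<And>z. z \<in> topspace Z \<Longrightarrow> u z \<in> {a..b}"
        using u(1) by (auto simp: continuous_map_in_subtopology)
      \<comment> \<open>The maximum never lowers the time, so finished neighbourhoods stay finished.
        The Urysohn function u is b on the closure of \<open>B w\<close> and a off
        \<open>B' w\<close>.\<close>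
      define \<tau> where "\<tau> z = max (\<sigma> z) (u z)" for z
      have \<tau>: "continuous_map Z euclideanreal \<tau>"
        unfolding \<tau>_def[abs_def] using \<sigma>(1) ur(1) by (rule continuous_map_real_max)
      have \<tau>ab: "\<tau> z \<in> {a..b}" if "z \<in> topspace Z" for z
        using \<sigma>(2) ur(2) that by (auto simp: \<tau>_def)
      have "{a..b} \<subseteq> {0..1}" using ab by auto
      obtain g where g: "continuous_map Z E g" "\<And>z. z \<in> topspace Z \<Longrightarrow> q (g z) = h (\<tau> z, z)"
        "homotopic_with (\<lambda>_. True) Z E f' g"
      proof (rule lift_step[OF q lw(9) openin_subset[OF lw(8)] h \<sigma>(1) _ \<tau> _ lw(1) closedin_closure_of lw(6) _ _ _ f'(1)])
        show "\<sigma> z \<in> {0..1}" "\<tau> z \<in> {0..1}" if "z \<in> topspace Z" for z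
          using \<sigma>(2) \<tau>ab that \<open>{a..b} \<subseteq> {0..1}\<close> by blast+
        show "\<sigma> z \<le> \<tau> z" for z by (simp add: \<tau>_def)
        show "\<sigma> z = \<tau> z" if "z \<in> topspace Z - Z closure_of B' w" for z
        proof -
          have "z \<notin> B' w" using that closure_of_subset[OF openin_subset[OF lw(3)]] by blast
          then have "u z = a" using u(2) that by blast
          then show ?thesis using \<sigma>(2) that by (auto simp: \<tau>_def)
        qed
        show "h (t, z) \<in> W w" if "z \<in> A w" "\<sigma> z \<le> t" "t \<le> \<tau> z" for z t
        proof (rule lw(10)[OF _ that(1)])
          have z: "z \<in> topspace Z" using that(1) openin_subset[OF lw(1)] by blast
          have t: "a \<le> t" "t \<le> b" using \<sigma>(2) \<tau>ab z that(2,3) by fastforce+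
          then show "t \<in> {0..1}" using ab by auto
          show "\<bar>t - t0\<bar> < d w" using t ab \<delta>[OF w(2)] by linarith
        qed
        show "q (f' z) = h (\<sigma> z, z)" if "z \<in> topspace Z" for z using f'(2) that by simp
      qed blast
      have "\<tau> z = b" if z: "z \<in> topspace Z \<inter> \<Union>(B ` insert w G)" for z
      proof (cases "z \<in> B w")
        case True
        then have "z \<in> Z closure_of B w" using closure_of_subset[OF openin_subset[OF lw(2)]] by blast
        then have "u z = b" using u(3) by blast
        then show ?thesis using \<sigma>(2) z by (auto simp: \<tau>_def)
      next
        case False
        then have "\<sigma> z = b" using \<sigma>(3) z by auto
        then show ?thesis using ur(2)[of z] z by (auto simp: \<tau>_def)
      qed
      moreover have "homotopic_with (\<lambda>_. True) Z E f g"
        using f'(3) g(3) by (rule homotopic_with_trans)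
      ultimately show ?case
        using \<tau> \<tau>ab g(1,2) by (intro exI[of _ \<tau>] exI[of _ g] conjI ballI) simp_all
    qed
    from this[OF F(1) order_refl] obtain \<sigma> f' where
      "\<forall>z\<in>topspace Z \<inter> \<Union>(B ` F). \<sigma> z = b" "continuous_map Z E f'"
        "\<forall>z\<in>topspace Z. q (f' z) = h (\<sigma> z, z)" "homotopic_with (\<lambda>_. True) Z E f f'"
      by (elim exE conjE)
    moreover have "topspace Z \<inter> \<Union>(B ` F) = topspace Z" using F(3) by blast
    ultimately show "\<exists>f'. continuous_map Z E f' \<and> (\<forall>z\<in>topspace Z. q (f' z) = h (b, z)) \<and>
         homotopic_with (\<lambda>_. True) Z E f f'"
      by (intro exI[of _ f']) simp
  qed
qed

text \<open>Short time intervals are handled by \<open>lift_local\<close>, and a subdivision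
  argument composes them. The homotopy obtained is not claimed to lie over h; the later argument
  uses that it starts at f and ends over the last stage of h.\<close>

lemma lift_homotopic:
  assumes q: "continuous_map E Y q"
    and loc: "\<And>y. y \<in> topspace Y \<Longrightarrow> \<exists>W T. openin Y W \<and> y \<in> W \<and> local_transport E Y q W T"
    and Z: "compact_space Z" "normal_space Z" "t1_space Z"
    and h: "continuous_map (prod_topology (top_of_set {0..1::real}) Z) Y h"
    and f: "continuous_map Z E f" "\<And>z. z \<in> topspace Z \<Longrightarrow> q (f z) = h (0, z)"
  obtains f' where "continuous_map Z E f'" "\<And>z. z \<in> topspace Z \<Longrightarrow> q (f' z) = h (1, z)"
    "homotopic_with (\<lambda>_. True) Z E f f'"
proof -
  \<comment> \<open>The guard is part of P because the subdivision principle quantifies over all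
    short intervals around t0, including those that leave the unit interval.\<close>
  define P where "P a b \<longleftrightarrow> (0 \<le> a \<and> b \<le> 1 \<longrightarrow>
    (\<forall>f. continuous_map Z E f \<and> (\<forall>z\<in>topspace Z. q (f z) = h (a, z)) \<longrightarrow>
      (\<exists>f'. continuous_map Z E f' \<and> (\<forall>z\<in>topspace Z. q (f' z) = h (b, z)) \<and>
         homotopic_with (\<lambda>_. True) Z E f f')))" for a b :: real
  have "P 0 1"
  proof (rule Bolzano)
    show "(0::real) \<le> 1" by simp
  next
    fix a b c assume 1: "P a b" "P b c" "a \<le> b" "b \<le> c"
    show "P a c" unfolding P_def
    proof (intro impI allI, elim conjE)
      fix f assume f: "0 \<le> a" "c \<le> 1" "continuous_map Z E f" "\<forall>z\<in>topspace Z. q (f z) = h (a, z)"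
      then obtain f' where f': "continuous_map Z E f'" "\<forall>z\<in>topspace Z. q (f' z) = h (b, z)"
         "homotopic_with (\<lambda>_. True) Z E f f'" using 1 unfolding P_def by force
      then obtain f'' where f'': "continuous_map Z E f''" "\<forall>z\<in>topspace Z. q (f'' z) = h (c, z)"
         "homotopic_with (\<lambda>_. True) Z E f' f''" using 1 f unfolding P_def by force
      then show "\<exists>f'. continuous_map Z E f' \<and> (\<forall>z\<in>topspace Z. q (f' z) = h (c, z)) \<and>
         homotopic_with (\<lambda>_. True) Z E f f'" using f'(3) homotopic_with_trans by blast
    qed
  next
    fix t0 :: real assume "0 \<le> t0" "t0 \<le> 1"
    then have "t0 \<in> {0..1}" by simp
    with q loc Z h have "\<exists>d>0. \<forall>a b f. 0 \<le> a \<and> a \<le> t0 \<and> t0 \<le> b \<and> b \<le> 1 \<and> b - a < d \<and>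
      continuous_map Z E f \<and> (\<forall>z\<in>topspace Z. q (f z) = h (a, z)) \<longrightarrow>
      (\<exists>f'. continuous_map Z E f' \<and> (\<forall>z\<in>topspace Z. q (f' z) = h (b, z)) \<and>
         homotopic_with (\<lambda>_. True) Z E f f')"
      by (rule lift_local)
    then obtain d where d: "d > 0 \<and>
      (\<forall>a b f. 0 \<le> a \<and> a \<le> t0 \<and> t0 \<le> b \<and> b \<le> 1 \<and> b - a < d \<and>
      continuous_map Z E f \<and> (\<forall>z\<in>topspace Z. q (f z) = h (a, z)) \<longrightarrow>
      (\<exists>f'. continuous_map Z E f' \<and> (\<forall>z\<in>topspace Z. q (f' z) = h (b, z)) \<and>
         homotopic_with (\<lambda>_. True) Z E f f'))"
      by (elim exE)
    show "\<exists>d>0. \<forall>a b. a \<le> t0 \<and> t0 \<le> b \<and> b - a < d \<longrightarrow> P a b"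
      unfolding P_def
    proof (intro exI[of _ d] conjI allI impI)
      show "d > 0" using d by (rule conjunct1)
      fix a b f assume "a \<le> t0 \<and> t0 \<le> b \<and> b - a < d" "0 \<le> a \<and> b \<le> 1"
        "continuous_map Z E f \<and> (\<forall>z\<in>topspace Z. q (f z) = h (a, z))"
      then show "\<exists>f'. continuous_map Z E f' \<and> (\<forall>z\<in>topspace Z. q (f' z) = h (b, z)) \<and>
                  homotopic_with (\<lambda>_. True) Z E f f'"
        by (intro conjunct2[OF d, THEN spec, of a, THEN spec, of b, THEN spec, of f, THEN mp]) simp
    qed
  qed
  then show thesis using f that unfolding P_def by force
qed

section \<open>Orbit spaces of compact groups and slices\<close>

text \<open>The assumptions are topological, so that the same locale serves X and the product of X
  with itself under the diagonal action; charts and dimensions enter later as separate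
  hypotheses.\<close>

locale compact_group_action =
  fixes G :: "'g monoid" and T :: "'g topology" and X :: "'a topology" and \<phi> :: "'g \<Rightarrow> 'a \<Rightarrow> 'a"
  assumes group_G: "group G"
    and topspace_T: "topspace T = carrier G"
    and compact_T: "compact_space T"
    and mult: "continuous_map (prod_topology T T) T (\<lambda>(g, h). g \<otimes>\<^bsub>G\<^esub> h)"
    and minv: "continuous_map T T (\<lambda>g. inv\<^bsub>G\<^esub> g)"
    and action: "continuous_action G T X \<phi>"
    and compact_X: "compact_space X"
    and Hausdorff_X: "Hausdorff_space X"
begin

abbreviation "Y \<equiv> orbit_space G X \<phi>"
abbreviation "q \<equiv> orbit G \<phi>"

lemma ga: "group_action G (topspace X) \<phi>"
  using action by (simp add: continuous_action_def)

lemma act_closed: "g \<in> carrier G \<Longrightarrow> x \<in> topspace X \<Longrightarrow> \<phi> g x \<in> topspace X"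
  using group_action.element_image[OF ga] by blast

lemma act_one: "x \<in> topspace X \<Longrightarrow> \<phi> \<one>\<^bsub>G\<^esub> x = x"
  by (metis ga group_action.id_eq_one restrict_apply')

lemma act_mult: "g \<in> carrier G \<Longrightarrow> h \<in> carrier G \<Longrightarrow> x \<in> topspace X \<Longrightarrow> \<phi> (g \<otimes>\<^bsub>G\<^esub> h) x = \<phi> g (\<phi> h x)"
  using group_action.composition_rule[OF ga] by blast

lemma act_inv: "g \<in> carrier G \<Longrightarrow> x \<in> topspace X \<Longrightarrow> \<phi> (inv\<^bsub>G\<^esub> g) (\<phi> g x) = x"
  by (metis act_mult act_one group.inv_closed group.l_inv group_G)

lemma act_inv': "g \<in> carrier G \<Longrightarrow> x \<in> topspace X \<Longrightarrow> \<phi> g (\<phi> (inv\<^bsub>G\<^esub> g) x) = x"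
  by (metis act_mult act_one group.inv_closed group.r_inv group_G)

lemma continuous_map_act:
  assumes "continuous_map Z T a" "continuous_map Z X b"
  shows "continuous_map Z X (\<lambda>z. \<phi> (a z) (b z))"
proof -
  have "continuous_map (prod_topology T X) X (\<lambda>(g, x). \<phi> g x)"
    using action by (simp add: continuous_action_def)
  from continuous_map_compose[OF continuous_map_pairedI[OF assms] this] show ?thesis by (simp add: o_def)
qed

lemma continuous_map_mult:
  assumes "continuous_map Z T a" "continuous_map Z T b"
  shows "continuous_map Z T (\<lambda>z. a z \<otimes>\<^bsub>G\<^esub> b z)"
  using continuous_map_compose[OF continuous_map_pairedI[OF assms] mult] by (simp add: o_def)

lemma continuous_map_minv:
  assumes "continuous_map Z T a"
  shows "continuous_map Z T (\<lambda>z. inv\<^bsub>G\<^esub> (a z))"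
  using continuous_map_compose[OF assms minv] by (simp add: o_def)

lemma q_refl: "x \<in> topspace X \<Longrightarrow> x \<in> q x"
  using group_action.orbit_refl[OF ga] by blast

lemma q_eq_iff:
  assumes "x \<in> topspace X" "y \<in> topspace X"
  shows "q x = q y \<longleftrightarrow> (\<exists>g\<in>carrier G. y = \<phi> g x)"
proof
  assume "q x = q y"
  then have "y \<in> q x" using q_refl[OF assms(2)] by simp
  then show "\<exists>g\<in>carrier G. y = \<phi> g x" by (auto simp: orbit_def)
next
  assume "\<exists>g\<in>carrier G. y = \<phi> g x"
  then obtain g where g: "g \<in> carrier G" "y = \<phi> g x" by blast
  show "q x = q y"
  proof (intro subset_antisym subsetI)
    fix z assume "z \<in> q x"
    then obtain h where h: "h \<in> carrier G" "z = \<phi> h x" by (auto simp: orbit_def)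
    have "\<phi> (h \<otimes>\<^bsub>G\<^esub> inv\<^bsub>G\<^esub> g) y = \<phi> h (\<phi> (inv\<^bsub>G\<^esub> g) y)"
      using g h assms group.inv_closed[OF group_G] by (intro act_mult) auto
    also have "\<dots> = z" using g h assms by (simp add: act_inv)
    finally have "z = \<phi> (h \<otimes>\<^bsub>G\<^esub> inv\<^bsub>G\<^esub> g) y" by simp
    moreover have "h \<otimes>\<^bsub>G\<^esub> inv\<^bsub>G\<^esub> g \<in> carrier G"
      using g h group_G by (simp add: group.inv_closed group.is_monoid monoid.m_closed)
    ultimately show "z \<in> q y" unfolding orbit_def by blast
  next
    fix z assume "z \<in> q y"
    then obtain h where h: "h \<in> carrier G" "z = \<phi> h y" by (auto simp: orbit_def)
    then have "z = \<phi> (h \<otimes>\<^bsub>G\<^esub> g) x" using g assms by (simp add: act_mult)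
    moreover have "h \<otimes>\<^bsub>G\<^esub> g \<in> carrier G"
      using g h group_G by (simp add: group.is_monoid monoid.m_closed)
    ultimately show "z \<in> q x" unfolding orbit_def by blast
  qed
qed

lemma q_act: "g \<in> carrier G \<Longrightarrow> x \<in> topspace X \<Longrightarrow> q (\<phi> g x) = q x"
  using q_eq_iff act_closed by metis

lemma topspace_Y: "topspace Y = q ` topspace X"
  by (auto simp: topspace_orbit_space orbits_def)

lemma continuous_q: "continuous_map X Y q"
  unfolding continuous_map_def by (auto simp: topspace_Y openin_orbit_space)

lemma open_q: "open_map X Y q"
  unfolding open_map_def
proof (intro allI impI)
  fix U assume U: "openin X U"
  then have UX: "U \<subseteq> topspace X" by (rule openin_subset)
  have "{x \<in> topspace X. q x \<in> q ` U} = (\<Union>g\<in>carrier G. {x \<in> topspace X. \<phi> g x \<in> U})"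
  proof (intro subset_antisym subsetI)
    fix x assume "x \<in> {x \<in> topspace X. q x \<in> q ` U}"
    then obtain u where u: "x \<in> topspace X" "u \<in> U" "q x = q u" by blast
    then obtain g where "g \<in> carrier G" "u = \<phi> g x" using q_eq_iff[of x u] UX by auto
    then show "x \<in> (\<Union>g\<in>carrier G. {x \<in> topspace X. \<phi> g x \<in> U})" using u by auto
  next
    fix x assume "x \<in> (\<Union>g\<in>carrier G. {x \<in> topspace X. \<phi> g x \<in> U})"
    then obtain g where g: "g \<in> carrier G" "x \<in> topspace X" "\<phi> g x \<in> U" by blast
    then have "q (\<phi> g x) = q x" by (simp add: q_act)
    moreover have "q (\<phi> g x) \<in> q ` U" using g(3) by (rule imageI)
    ultimately show "x \<in> {x \<in> topspace X. q x \<in> q ` U}" using g(2) by simp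
  qed
  moreover have "openin X {x \<in> topspace X. \<phi> g x \<in> U}" if "g \<in> carrier G" for g
    using that topspace_T U
    by (intro openin_continuous_map_preimage[OF continuous_map_act]) auto
  ultimately have "openin X {x \<in> topspace X. q x \<in> q ` U}" by auto
  then show "openin Y (q ` U)" using UX by (auto simp: openin_orbit_space orbits_def)
qed

lemma open_q_image: "openin X W \<Longrightarrow> openin Y (q ` W)"
  using open_q unfolding open_map_def by blast

text \<open>Compactness of G enters here: the saturation of a closed C is the image of the compact
  product of G and C. That q is closed then makes the orbit space Hausdorff, hence normal, as the
  colourings require.\<close>

lemma closed_q: "closed_map X Y q"
  unfolding closed_map_def
proof (intro allI impI)
  fix C assume C: "closedin X C"
  then have CX: "C \<subseteq> topspace X" by (rule closedin_subset)
  let ?S = "(\<lambda>(g, x). \<phi> g x) ` (topspace T \<times> C)"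
  have "compactin (prod_topology T X) (topspace T \<times> C)"
    using C compact_T compact_X by (simp add: compactin_Times closedin_compact_space compact_space_def[symmetric])
  then have "compactin X ?S"
    using action image_compactin unfolding continuous_action_def by blast
  then have "closedin X ?S" using Hausdorff_X compactin_imp_closedin by blast
  moreover have "{x \<in> topspace X. q x \<in> q ` C} = ?S"
  proof (intro subset_antisym subsetI)
    fix x assume "x \<in> {x \<in> topspace X. q x \<in> q ` C}"
    then obtain c where c: "x \<in> topspace X" "c \<in> C" "q c = q x" by auto
    then obtain g where "g \<in> carrier G" "x = \<phi> g c" using q_eq_iff[of c x] CX by auto
    then show "x \<in> ?S" using c topspace_T by auto
  next
    fix x assume "x \<in> ?S"
    then obtain g c where g: "g \<in> carrier G" "c \<in> C" "x = \<phi> g c" using topspace_T by auto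
    then show "x \<in> {x \<in> topspace X. q x \<in> q ` C}"
      using q_act[of g c] act_closed[of g c] CX by auto
  qed
  ultimately have 1: "openin X (topspace X - {x \<in> topspace X. q x \<in> q ` C})" by auto
  have "{x \<in> topspace X. q x \<in> topspace Y - q ` C} = topspace X - {x \<in> topspace X. q x \<in> q ` C}"
    by (auto simp: topspace_Y)
  then have "openin Y (topspace Y - q ` C)"
    using 1 unfolding openin_orbit_space by (simp add: topspace_orbit_space[symmetric])
  then show "closedin Y (q ` C)"
    using CX unfolding closedin_def by (auto simp: topspace_Y)
qed

lemma compact_Y: "compact_space Y"
  using image_compactin[OF _ continuous_q] compact_X topspace_Y unfolding compact_space_def by metis

lemma Hausdorff_Y: "Hausdorff_space Y"
proof (rule Hausdorff_normal_space_closed_continuous_map_image[OF _ closed_q continuous_q])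
  show "normal_space X"
    using compact_X Hausdorff_X by (simp add: compact_Hausdorff_or_regular_imp_normal_space)
  show "q ` topspace X = topspace Y" by (simp add: topspace_Y)
  show "t1_space Y"
    unfolding t1_space_closedin_singleton
  proof
    fix y assume "y \<in> topspace Y"
    then obtain x where "x \<in> topspace X" "y = q x" by (auto simp: topspace_Y)
    moreover from this have "closedin X {x}"
      using Hausdorff_X by (simp add: closedin_Hausdorff_sing_eq)
    ultimately show "closedin Y {y}" using closed_q unfolding closed_map_def by force
  qed
qed

lemma normal_Y: "normal_space Y"
  using compact_Y Hausdorff_Y by (simp add: compact_Hausdorff_or_regular_imp_normal_space)

section \<open>Slices for free orbits\<close>

text \<open>Here \<gamma> is the group coordinate of a trivialisation of the invariant set W, and
  dividing by it carries W into S. Equivariance of \<gamma> forces the action on W to be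
  free.\<close>

definition slice :: "'a set \<Rightarrow> 'a set \<Rightarrow> ('a \<Rightarrow> 'g) \<Rightarrow> bool" where
  "slice W S \<gamma> \<longleftrightarrow> openin X W \<and> S \<subseteq> W \<and> continuous_map (subtopology X W) T \<gamma> \<and>
     (\<forall>e\<in>W. \<phi> (inv\<^bsub>G\<^esub> (\<gamma> e)) e \<in> S) \<and>
     (\<forall>g\<in>carrier G. \<forall>e\<in>W. \<phi> g e \<in> W \<and> \<gamma> (\<phi> g e) = g \<otimes>\<^bsub>G\<^esub> \<gamma> e)"

lemma sliceD:
  assumes "slice W S \<gamma>"
  shows "openin X W" "S \<subseteq> W" "W \<subseteq> topspace X" "continuous_map (subtopology X W) T \<gamma>"
    "\<And>e. e \<in> W \<Longrightarrow> \<gamma> e \<in> carrier G" "\<And>e. e \<in> W \<Longrightarrow> \<phi> (inv\<^bsub>G\<^esub> (\<gamma> e)) e \<in> S"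
    "\<And>g e. g \<in> carrier G \<Longrightarrow> e \<in> W \<Longrightarrow> \<phi> g e \<in> W"
    "\<And>g e. g \<in> carrier G \<Longrightarrow> e \<in> W \<Longrightarrow> \<gamma> (\<phi> g e) = g \<otimes>\<^bsub>G\<^esub> \<gamma> e"
proof -
  show *: "openin X W" "S \<subseteq> W" "continuous_map (subtopology X W) T \<gamma>"
    "\<And>e. e \<in> W \<Longrightarrow> \<phi> (inv\<^bsub>G\<^esub> (\<gamma> e)) e \<in> S"
    "\<And>g e. g \<in> carrier G \<Longrightarrow> e \<in> W \<Longrightarrow> \<phi> g e \<in> W"
    "\<And>g e. g \<in> carrier G \<Longrightarrow> e \<in> W \<Longrightarrow> \<gamma> (\<phi> g e) = g \<otimes>\<^bsub>G\<^esub> \<gamma> e"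
    using assms unfolding slice_def by auto
  show W: "W \<subseteq> topspace X" using *(1) by (rule openin_subset)
  show "\<gamma> e \<in> carrier G" if "e \<in> W" for e
    using *(3) that W topspace_T by (auto simp: continuous_map_def)
qed

text \<open>Moving e by g multiplies its group coordinate by g, which the inverse cancels; so the
  reduction to S depends only on the orbit.\<close>

lemma slice_reduce_eq:
  assumes "slice W S \<gamma>" "e \<in> W" "e' \<in> W" "q e = q e'"
  shows "\<phi> (inv\<^bsub>G\<^esub> (\<gamma> e)) e = \<phi> (inv\<^bsub>G\<^esub> (\<gamma> e')) e'"
proof -
  note s = sliceD[OF assms(1)]
  interpret group G by (rule group_G)
  have eX: "e \<in> topspace X" "e' \<in> topspace X" using s(3) assms by auto
  obtain g where g: "g \<in> carrier G" "e' = \<phi> g e" using q_eq_iff[OF eX] assms(4) by auto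
  have "\<phi> (inv\<^bsub>G\<^esub> (\<gamma> e')) e' = \<phi> (inv\<^bsub>G\<^esub> (g \<otimes>\<^bsub>G\<^esub> \<gamma> e)) (\<phi> g e)"
    using s(8)[OF g(1) assms(2)] g by simp
  also have "\<dots> = \<phi> (inv\<^bsub>G\<^esub> (\<gamma> e) \<otimes>\<^bsub>G\<^esub> inv\<^bsub>G\<^esub> g) (\<phi> g e)"
    using g s(5)[OF assms(2)] by (simp add: inv_mult_group)
  also have "\<dots> = \<phi> (inv\<^bsub>G\<^esub> (\<gamma> e)) (\<phi> (inv\<^bsub>G\<^esub> g) (\<phi> g e))"
    using g s(5)[OF assms(2)] eX by (intro act_mult act_closed) auto
  also have "\<dots> = \<phi> (inv\<^bsub>G\<^esub> (\<gamma> e)) e" using g eX by (simp add: act_inv)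
  finally show ?thesis by simp
qed

text \<open>The reduction to S descends to orbits and is there a section of q. It is continuous
  since q is open: the preimage of an open U under the section is the q-image of an open
  set.\<close>

lemma slice_section:
  assumes "slice W S \<gamma>"
  obtains s where "continuous_map (subtopology Y (q ` W)) (subtopology X S) s"
    "\<And>e. e \<in> W \<Longrightarrow> s (q e) = \<phi> (inv\<^bsub>G\<^esub> (\<gamma> e)) e"
proof -
  note sl = sliceD[OF assms]
  interpret group G by (rule group_G)
  define r where "r e = \<phi> (inv\<^bsub>G\<^esub> (\<gamma> e)) e" for e
  define s where "s y = r (SOME e. e \<in> W \<and> q e = y)" for y
  have s: "s (q e) = r e" if e: "e \<in> W" for e
  proof -
    have "(SOME e'. e' \<in> W \<and> q e' = q e) \<in> W \<and> q (SOME e'. e' \<in> W \<and> q e' = q e) = q e"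
      using e by (intro someI[of "\<lambda>e'. e' \<in> W \<and> q e' = q e" e]) simp
    then show ?thesis unfolding s_def r_def using slice_reduce_eq[OF assms _ e] by blast
  qed
  have WY: "q ` W \<subseteq> topspace Y" using sl(3) by (auto simp: topspace_Y)
  have r: "continuous_map (subtopology X W) X r"
    unfolding r_def[abs_def]
    by (intro continuous_map_act continuous_map_minv sl(4)) (simp add: continuous_map_from_subtopology)
  have "continuous_map (subtopology Y (q ` W)) X s"
    unfolding continuous_map_def
  proof (intro conjI allI impI)
    show "s \<in> topspace (subtopology Y (q ` W)) \<rightarrow> topspace X"
    proof
      fix y assume "y \<in> topspace (subtopology Y (q ` W))"
      then obtain e where "e \<in> W" "y = q e" by auto
      then show "s y \<in> topspace X" using s sl(2,3) sl(6)[of e] by (auto simp: r_def)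
    qed
    fix U assume U: "openin X U"
    have "openin (subtopology X W) {e \<in> topspace (subtopology X W). r e \<in> U}"
      using r U by (rule openin_continuous_map_preimage)
    then have "openin X {e \<in> topspace (subtopology X W). r e \<in> U}"
      using sl(1) by (rule openin_trans_full)
    then have "openin Y (q ` {e \<in> topspace (subtopology X W). r e \<in> U})"
      using open_q unfolding open_map_def by blast
    moreover have "q ` {e \<in> topspace (subtopology X W). r e \<in> U} = {y \<in> topspace (subtopology Y (q ` W)). s y \<in> U}"
      using s sl(3) by (auto simp: topspace_Y)
    ultimately show "openin (subtopology Y (q ` W)) {y \<in> topspace (subtopology Y (q ` W)). s y \<in> U}"
      using open_q_image[OF sl(1)] by (simp add: openin_open_subtopology) blast
  qed
  then have "continuous_map (subtopology Y (q ` W)) (subtopology X S) s"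
    using s sl(6) by (intro continuous_map_into_subtopology) (auto simp: r_def)
  then show thesis using that s by (simp add: r_def)
qed

text \<open>Transport keeps the group coordinate of e and changes its orbit: the section point over
  y is moved by \<open>\<gamma> e\<close>.\<close>

lemma slice_local_transport:
  assumes "slice W S \<gamma>"
  obtains R where "local_transport X Y q (q ` W) R"
proof -
  note sl = sliceD[OF assms]
  obtain s where s: "continuous_map (subtopology Y (q ` W)) (subtopology X S) s"
    "\<And>e. e \<in> W \<Longrightarrow> s (q e) = \<phi> (inv\<^bsub>G\<^esub> (\<gamma> e)) e"
    using slice_section[OF assms] by blast
  have W: "e \<in> W" if e: "e \<in> topspace X" "q e \<in> q ` W" for e
  proof -
    obtain w where w: "w \<in> W" "q w = q e" using e(2) by auto
    have "w \<in> topspace X" using w(1) sl(3) by auto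
    then obtain g where "g \<in> carrier G" "e = \<phi> g w" using q_eq_iff[of w e] w e by auto
    then show ?thesis using sl(7) w by blast
  qed
  have sX: "s (q e) \<in> topspace X" if "e \<in> W" for e
    using s(2)[OF that] sl(2,3,6) that by auto
  have se: "\<phi> (\<gamma> e) (s (q e)) = e" if "e \<in> W" for e
    using s(2)[OF that] sl(5)[OF that] that sl(3) by (auto simp: act_inv')
  have qs: "q (s (q e)) = q e" if "e \<in> W" for e
    using s(2)[OF that] sl(5)[OF that] that sl(3) group.inv_closed[OF group_G] by (auto simp: q_act)
  let ?D = "subtopology (prod_topology X Y) {(e, y). q e \<in> q ` W \<and> y \<in> q ` W}"
  have D: "topspace ?D \<subseteq> W \<times> q ` W" using W by auto
  have "continuous_map ?D (subtopology X W) fst"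
    using D by (intro continuous_map_into_subtopology continuous_map_from_subtopology continuous_map_fst) auto
  from continuous_map_compose[OF this sl(4)] have 1: "continuous_map ?D T (\<lambda>p. \<gamma> (fst p))" by (simp add: o_def)
  have "continuous_map ?D (subtopology Y (q ` W)) snd"
    using D by (intro continuous_map_into_subtopology continuous_map_from_subtopology continuous_map_snd) auto
  from continuous_map_compose[OF this s(1)] have "continuous_map ?D X (\<lambda>p. s (snd p))"
    by (simp add: o_def continuous_map_in_subtopology)
  from continuous_map_act[OF 1 this] have "continuous_map ?D X (\<lambda>p. \<phi> (\<gamma> (fst p)) (s (snd p)))" .
  moreover have "q (\<phi> (\<gamma> e) (s y)) = y" if "e \<in> topspace X" "y \<in> q ` W" "q e \<in> q ` W" for e y
    using that(2) qs sX sl(5)[OF W[OF that(1,3)]] by (auto simp: q_act)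
  moreover have "\<phi> (\<gamma> e) (s (q e)) = e" if "e \<in> topspace X" "q e \<in> q ` W" for e
    using se W[OF that] by simp
  ultimately have "local_transport X Y q (q ` W) (\<lambda>p. \<phi> (\<gamma> (fst p)) (s (snd p)))"
    unfolding local_transport_def by simp
  then show thesis by (rule that)
qed

text \<open>The section followed by q is the inclusion, which therefore factors through the
  contractible S.\<close>

lemma slice_nullhomotopic:
  assumes "slice W S \<gamma>" "contractible_space (subtopology X S)"
  obtains c where "homotopic_with (\<lambda>_. True) (subtopology Y (q ` W)) Y id (\<lambda>_. c)"
proof -
  note sl = sliceD[OF assms(1)]
  obtain s where s: "continuous_map (subtopology Y (q ` W)) (subtopology X S) s"
    "\<And>e. e \<in> W \<Longrightarrow> s (q e) = \<phi> (inv\<^bsub>G\<^esub> (\<gamma> e)) e"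
    using slice_section[OF assms(1)] by blast
  have "continuous_map (subtopology X S) Y q"
    by (intro continuous_map_from_subtopology continuous_q)
  then obtain c where c: "homotopic_with (\<lambda>_. True) (subtopology Y (q ` W)) Y (q \<circ> s) (\<lambda>_. c)"
    using nullhomotopic_through_contractible_space[OF s(1) _ assms(2)] by blast
  have "homotopic_with (\<lambda>_. True) (subtopology Y (q ` W)) Y id (\<lambda>_. c)"
  proof (rule homotopic_with_eq[OF c])
    show "id y = (q \<circ> s) y" if y: "y \<in> topspace (subtopology Y (q ` W))" for y
    proof -
      obtain e where e: "e \<in> W" "y = q e" using y by auto
      then show ?thesis
        using s(2)[OF e(1)] sl(5)[OF e(1)] sl(3) group.inv_closed[OF group_G] by (auto simp: q_act)
    qed
  qed auto
  then show thesis by (rule that)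
qed

end

section \<open>The diagonal action\<close>

context compact_group_action
begin

lemma diagonal_apply:
  "(x, y) \<in> topspace X \<times> topspace X \<Longrightarrow> diagonal_action (topspace X) \<phi> g (x, y) = (\<phi> g x, \<phi> g y)"
  by (simp add: diagonal_action_def)

lemma group_action_diagonal: "group_action G (topspace X \<times> topspace X) (diagonal_action (topspace X) \<phi>)"
proof -
  let ?E = "topspace X \<times> topspace X" and ?\<delta> = "diagonal_action (topspace X) \<phi>"
  interpret group G by (rule group_G)
  have Bij: "?\<delta> g \<in> Bij ?E" if g: "g \<in> carrier G" for g
  proof -
    have "bij_betw (?\<delta> g) ?E ?E"
    proof (rule bij_betw_byWitness[where f' = "?\<delta> (inv\<^bsub>G\<^esub> g)"])
      show "\<forall>z\<in>?E. ?\<delta> (inv\<^bsub>G\<^esub> g) (?\<delta> g z) = z" "\<forall>z\<in>?E. ?\<delta> g (?\<delta> (inv\<^bsub>G\<^esub> g) z) = z"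
        using g by (auto simp: diagonal_action_def act_closed act_inv act_inv')
      show "?\<delta> g ` ?E \<subseteq> ?E" "?\<delta> (inv\<^bsub>G\<^esub> g) ` ?E \<subseteq> ?E"
        using g by (auto simp: diagonal_action_def act_closed)
    qed
    then show ?thesis by (simp add: Bij_def diagonal_action_def)
  qed
  have "?\<delta> \<in> hom G (BijGroup ?E)"
  proof (rule homI)
    show "?\<delta> g \<in> carrier (BijGroup ?E)" if "g \<in> carrier G" for g
      using Bij[OF that] by (simp add: BijGroup_def)
    show "?\<delta> (g \<otimes>\<^bsub>G\<^esub> h) = ?\<delta> g \<otimes>\<^bsub>BijGroup ?E\<^esub> ?\<delta> h" if gh: "g \<in> carrier G" "h \<in> carrier G" for g h
    proof -
      have "?\<delta> (g \<otimes>\<^bsub>G\<^esub> h) = compose ?E (?\<delta> g) (?\<delta> h)"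
        using gh by (intro ext) (auto simp: compose_def diagonal_action_def restrict_def act_mult act_closed)
      then show ?thesis using Bij gh by (simp add: BijGroup_def)
    qed
  qed
  then show ?thesis
    unfolding group_action_def group_hom_def group_hom_axioms_def
    using group_G group_BijGroup by blast
qed

lemma compact_group_action_diagonal:
  "compact_group_action G T (prod_topology X X) (diagonal_action (topspace X) \<phi>)"
proof (rule compact_group_action.intro)
  show "group G" "topspace T = carrier G" "compact_space T"
    "continuous_map (prod_topology T T) T (\<lambda>(g, h). g \<otimes>\<^bsub>G\<^esub> h)" "continuous_map T T (\<lambda>g. inv\<^bsub>G\<^esub> g)"
    by (rule group_G topspace_T compact_T mult minv)+
  show "compact_space (prod_topology X X)" using compact_X by (simp add: compact_space_prod_topology)
  show "Hausdorff_space (prod_topology X X)" using Hausdorff_X by (simp add: Hausdorff_space_prod_topology)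
  let ?P = "prod_topology T (prod_topology X X)"
  have "continuous_map ?P (prod_topology X X) (\<lambda>p. (\<phi> (fst p) (fst (snd p)), \<phi> (fst p) (snd (snd p))))"
    by (intro continuous_map_pairedI continuous_map_act continuous_map_fst
        continuous_map_compose[OF continuous_map_snd continuous_map_fst, unfolded o_def]
        continuous_map_compose[OF continuous_map_snd continuous_map_snd, unfolded o_def])
  then have "continuous_map ?P (prod_topology X X) (\<lambda>(g, z). diagonal_action (topspace X) \<phi> g z)"
    by (rule continuous_map_eq) (auto simp: diagonal_action_def)
  then show "continuous_action G T (prod_topology X X) (diagonal_action (topspace X) \<phi>)"
    using group_action_diagonal by (simp add: continuous_action_def)
qed

end

text \<open>
  A separate locale, because a sublocale declaration for \<^locale>\<open>compact_group_action\<close> itself would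
  iterate the square forever.
\<close>
locale diagonal_square = compact_group_action

sublocale diagonal_square \<subseteq> E: compact_group_action G T "prod_topology X X" "diagonal_action (topspace X) \<phi>"
  by (rule compact_group_action_diagonal)

context diagonal_square
begin

abbreviation "E \<equiv> prod_topology X X"
abbreviation "\<delta> \<equiv> diagonal_action (topspace X) \<phi>"

text \<open>
  By \<open>homotopic_endpoints_imp_motion_planner\<close>, a motion planner on \<open>W\<close> amounts to a homotopy between the
  two projections.
\<close>
lemma slice_homotopic_endpoints:
  assumes X: "path_connected_space X" and sl: "E.slice W S \<gamma>" and S: "contractible_space (subtopology E S)"
  shows "homotopic_with (\<lambda>_. True) (subtopology E W) X fst snd"
proof -
  note s = E.sliceD[OF sl]
  let ?I = "top_of_set {0..1::real}"
  let ?r = "\<lambda>e. \<delta> (inv\<^bsub>G\<^esub> (\<gamma> e)) e"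
  have SE: "topspace (subtopology E S) = S" using s(2,3) by auto
  have WE: "topspace (subtopology E W) = W" using s(3) by auto
  have "homotopic_with (\<lambda>_. True) (subtopology E S) X fst snd"
    using X S by (intro homotopic_from_contractible_space conjI continuous_map_from_subtopology
        continuous_map_fst continuous_map_snd)
  then obtain k where k: "continuous_map (prod_topology ?I (subtopology E S)) X k"
    and k01: "\<And>e. e \<in> S \<Longrightarrow> k (0, e) = fst e" "\<And>e. e \<in> S \<Longrightarrow> k (1, e) = snd e"
    using SE by (subst (asm) homotopic_with, simp) (simp only: SE, blast)
  let ?P = "prod_topology ?I (subtopology E W)"
  have \<gamma>: "continuous_map ?P T (\<lambda>p. \<gamma> (snd p))"
    using continuous_map_compose[OF continuous_map_snd s(4)] by (simp add: o_def)
  have "continuous_map ?P E (\<lambda>p. ?r (snd p))"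
    by (intro E.continuous_map_act E.continuous_map_minv \<gamma>)
       (use continuous_map_snd[of ?I "subtopology E W"] in \<open>simp add: continuous_map_in_subtopology\<close>)
  then have "continuous_map ?P (subtopology E S) (\<lambda>p. ?r (snd p))"
    using s(6) WE by (intro continuous_map_into_subtopology) auto
  then have "continuous_map ?P (prod_topology ?I (subtopology E S)) (\<lambda>p. (fst p, ?r (snd p)))"
    by (intro continuous_map_pairedI continuous_map_fst)
  from continuous_map_compose[OF this k] have "continuous_map ?P X (\<lambda>p. k (fst p, ?r (snd p)))"
    by (simp add: o_def)
  then have H: "continuous_map ?P X (\<lambda>p. \<phi> (\<gamma> (snd p)) (k (fst p, ?r (snd p))))"
    by (intro continuous_map_act \<gamma>)
  have restore: "\<phi> (\<gamma> e) (fst (?r e)) = fst e \<and> \<phi> (\<gamma> e) (snd (?r e)) = snd e" if e: "e \<in> W" for e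
  proof -
    obtain x y where xy: "e = (x, y)" "x \<in> topspace X" "y \<in> topspace X"
      using e s(3) by (cases e) auto
    then show ?thesis using s(5)[OF e] by (simp add: diagonal_apply act_inv')
  qed
  have ends: "\<phi> (\<gamma> e) (k (0, ?r e)) = fst e" "\<phi> (\<gamma> e) (k (1, ?r e)) = snd e" if "e \<in> W" for e
    using restore[OF that] k01[OF s(6)[OF that]] by simp_all
  show ?thesis
  proof (subst homotopic_with)
    show "\<exists>h. continuous_map ?P X h \<and> (\<forall>e\<in>topspace (subtopology E W). h (0, e) = fst e) \<and>
        (\<forall>e\<in>topspace (subtopology E W). h (1, e) = snd e) \<and> (\<forall>t\<in>{0..1::real}. True)"
      unfolding WE using H ends
      by (intro exI[of _ "\<lambda>p. \<phi> (\<gamma> (snd p)) (k (fst p, ?r (snd p)))"]) simp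
  qed simp
qed

text \<open>Lifting is done over a compact Hausdorff space, whereas the sets of a cover are open. So
  each \<open>U j\<close> is shrunk to a finite union \<open>K j\<close> of closures, grouped by
  index so that the number k does not grow; the open sets \<open>V j\<close> inside them still
  cover.\<close>

lemma TC_le_LS_cat:
  assumes X: "path_connected_space X"
    and slices: "\<And>z. z \<in> topspace E \<Longrightarrow> \<exists>W S \<gamma>. z \<in> W \<and> E.slice W S \<gamma>"
  shows "TC X \<le> LS_cat E.Y"
  unfolding LS_cat_def
proof (rule Inf_greatest, elim CollectE exE conjE)
  fix m k U
  assume m: "m = enat k" and cov: "(\<Union>i<k. U i) = topspace E.Y"
    and U: "\<forall>i<k. openin E.Y (U i) \<and>
        (\<exists>c\<in>topspace E.Y. homotopic_with (\<lambda>_. True) (subtopology E.Y (U i)) E.Y id (\<lambda>_. c))"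
  have "\<exists>i B. i < k \<and> openin E.Y B \<and> y \<in> B \<and> E.Y closure_of B \<subseteq> U i" if y: "y \<in> topspace E.Y" for y
  proof -
    obtain i where i: "i < k" "y \<in> U i" using y cov by blast
    have "closedin E.Y {y}" using E.Hausdorff_Y y by (simp add: closedin_Hausdorff_sing_eq)
    then obtain B where "openin E.Y B" "{y} \<subseteq> B" "E.Y closure_of B \<subseteq> U i"
      using E.normal_Y U i unfolding normal_space_alt by (metis empty_subsetI insert_subset)
    then show ?thesis using i(1) by blast
  qed
  then obtain i B where iB: "\<And>y. y \<in> topspace E.Y \<Longrightarrow> i y < k \<and> openin E.Y (B y) \<and> y \<in> B y \<and> E.Y closure_of B y \<subseteq> U (i y)"
    by metis
  have "compactin E.Y (topspace E.Y)" using E.compact_Y by (simp add: compact_space_def)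
  then obtain F where F: "finite F" "F \<subseteq> topspace E.Y" "topspace E.Y \<subseteq> \<Union>(B ` F)"
    using iB by (elim compactin_finite_subcover[of _ _ B]) auto
  define V where "V j = \<Union>(B ` {y\<in>F. i y = j})" for j
  define K where "K j = \<Union>((\<lambda>y. E.Y closure_of B y) ` {y\<in>F. i y = j})" for j
  have V: "openin E.Y (V j)" for j unfolding V_def using iB F(2) by (intro openin_Union) auto
  have K: "closedin E.Y (K j)" for j unfolding K_def using F(1) by (intro closedin_Union) auto
  have VK: "V j \<subseteq> K j" for j
    unfolding V_def K_def using iB F(2) by (intro UN_mono) (auto intro!: closure_of_subset openin_subset)
  have KU: "K j \<subseteq> U j" for j unfolding K_def using iB F(2) by auto
  have Vcov: "topspace E.Y \<subseteq> (\<Union>j<k. V j)"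
  proof
    fix y assume "y \<in> topspace E.Y"
    then obtain w where "w \<in> F" "y \<in> B w" using F(3) by auto
    then show "y \<in> (\<Union>j<k. V j)" using iB[of w] F(2) unfolding V_def by auto
  qed
  define W where "W j = {z \<in> topspace E. E.q z \<in> V j}" for j
  have qY: "E.q z \<in> topspace E.Y" if "z \<in> topspace E" for z using that by (auto simp: E.topspace_Y)
  have hom: "homotopic_with (\<lambda>_. True) (subtopology E (W j)) X fst snd" if j: "j < k" for j
  proof -
    let ?I = "top_of_set {0..1::real}"
    define Z where "Z = subtopology E {z \<in> topspace E. E.q z \<in> K j}"
    have tZ: "topspace Z = {z \<in> topspace E. E.q z \<in> K j}" unfolding Z_def by auto
    have "closedin E {z \<in> topspace E. E.q z \<in> K j}"
      using E.continuous_q K by (rule closedin_continuous_map_preimage)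
    then have "compact_space Z"
      unfolding Z_def using E.compact_X by (intro compact_space_subtopology closedin_compact_space)
    moreover have "Hausdorff_space Z"
      unfolding Z_def using E.Hausdorff_X by (rule Hausdorff_space_subtopology)
    ultimately have Zc: "compact_space Z" "normal_space Z" "t1_space Z"
      by (simp_all add: compact_Hausdorff_or_regular_imp_normal_space Hausdorff_imp_t1_space)
    obtain c where c: "c \<in> topspace E.Y" "homotopic_with (\<lambda>_. True) (subtopology E.Y (U j)) E.Y id (\<lambda>_. c)"
      using U j by blast
    have "continuous_map Z (subtopology E.Y (U j)) E.q"
      unfolding Z_def using E.continuous_q KU[of j]
      by (intro continuous_map_into_subtopology continuous_map_from_subtopology) auto
    then have "homotopic_with (\<lambda>_. True) Z E.Y (id \<circ> E.q) ((\<lambda>_. c) \<circ> E.q)"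
      by (intro homotopic_with_compose_continuous_map_right[OF c(2)]) auto
    then obtain h where h: "continuous_map (prod_topology ?I Z) E.Y h"
      "\<And>z. z \<in> topspace Z \<Longrightarrow> h (0, z) = E.q z" "\<And>z. z \<in> topspace Z \<Longrightarrow> h (1, z) = c"
      by (subst (asm) homotopic_with, simp) (auto simp: o_def)
    have loc: "\<exists>V R. openin E.Y V \<and> y \<in> V \<and> local_transport E E.Y E.q V R" if "y \<in> topspace E.Y" for y
    proof -
      obtain z where z: "z \<in> topspace E" "y = E.q z" using \<open>y \<in> topspace E.Y\<close> by (auto simp: E.topspace_Y)
      obtain W S \<gamma> where W: "z \<in> W" "E.slice W S \<gamma>" using slices[OF z(1)] by blast
      obtain R where "local_transport E E.Y E.q (E.q ` W) R" using E.slice_local_transport[OF W(2)] by blast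
      then show ?thesis using E.open_q_image[OF E.sliceD(1)[OF W(2)]] W(1) z(2) by blast
    qed
    have idZ: "continuous_map Z E (\<lambda>z. z)"
      unfolding Z_def by (intro continuous_map_from_subtopology) simp
    obtain f where f: "continuous_map Z E f" "\<And>z. z \<in> topspace Z \<Longrightarrow> E.q (f z) = c"
      "homotopic_with (\<lambda>_. True) Z E (\<lambda>z. z) f"
      using lift_homotopic[OF E.continuous_q loc Zc h(1) idZ] h(2,3) by (metis (no_types, lifting))
    obtain x0 y0 where z0: "(x0, y0) \<in> topspace E" "c = E.q (x0, y0)" using c(1) by (auto simp: E.topspace_Y)
    then obtain W0 S0 \<gamma> where W0: "(x0, y0) \<in> W0" "E.slice W0 S0 \<gamma>" using slices by blast
    note s0 = E.sliceD[OF W0(2)]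
    interpret group G by (rule group_G)
    \<comment> \<open>The only group element that carries (x0, y0) to f z. Its product with the
      slice coordinate of (x0, y0) is the slice coordinate of f z; solving for it shows that it
      depends continuously on z.\<close>
    define g where "g z = \<gamma> (f z) \<otimes>\<^bsub>G\<^esub> inv\<^bsub>G\<^esub> (\<gamma> (x0, y0))" for z
    have fE: "f z \<in> topspace E" if "z \<in> topspace Z" for z
      using f(1) that by (simp add: continuous_map_def Pi_iff)
    have fg: "f z \<in> W0 \<and> f z = (\<phi> (g z) x0, \<phi> (g z) y0)" if z: "z \<in> topspace Z" for z
    proof -
      have "E.q (x0, y0) = E.q (f z)" using f(2)[OF z] z0(2) by simp
      then obtain a where a: "a \<in> carrier G" "f z = \<delta> a (x0, y0)"
        using E.q_eq_iff[OF z0(1) fE[OF z]] by auto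
      have "g z = a"
        using a s0(5)[OF W0(1)] s0(8)[OF a(1) W0(1)] by (simp add: g_def m_assoc)
      then show ?thesis using a s0(7)[OF a(1) W0(1)] z0(1) by (simp add: diagonal_apply)
    qed
    have "continuous_map Z (subtopology E W0) f"
      using f(1) fg by (intro continuous_map_into_subtopology) auto
    from continuous_map_compose[OF this s0(4)] have "continuous_map Z T (\<lambda>z. \<gamma> (f z))" by (simp add: o_def)
    then have g: "continuous_map Z T g"
      unfolding g_def[abs_def] using s0(5)[OF W0(1)] topspace_T
      by (intro continuous_map_mult) simp_all
    have x0y0: "x0 \<in> topspace X" "y0 \<in> topspace X" using z0(1) by auto
    obtain p where p: "pathin X p" "p 0 = x0" "p 1 = y0"
      using X x0y0 unfolding path_connected_space_def by blast
    have "continuous_map (prod_topology ?I Z) X (\<lambda>w. \<phi> (g (snd w)) (p (fst w)))"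
      using continuous_map_compose[OF continuous_map_snd g]
        continuous_map_compose[OF continuous_map_fst p(1)[unfolded pathin_def]]
      by (intro continuous_map_act) (simp_all add: o_def)
    then have mid: "homotopic_with (\<lambda>_. True) Z X (\<lambda>z. \<phi> (g z) x0) (\<lambda>z. \<phi> (g z) y0)"
      using p(2,3) by (subst homotopic_with, simp) (intro exI[of _ "\<lambda>w. \<phi> (g (snd w)) (p (fst w))"], simp)
    have "homotopic_with (\<lambda>_. True) Z X (fst \<circ> (\<lambda>z. z)) (fst \<circ> f)"
      using f(3) by (rule homotopic_with_compose_continuous_map_left[OF _ continuous_map_fst]) auto
    then have 1: "homotopic_with (\<lambda>_. True) Z X fst (\<lambda>z. \<phi> (g z) x0)"
      by (rule homotopic_with_eq) (use fg in auto)
    have "homotopic_with (\<lambda>_. True) Z X (snd \<circ> (\<lambda>z. z)) (snd \<circ> f)"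
      using f(3) by (rule homotopic_with_compose_continuous_map_left[OF _ continuous_map_snd]) auto
    then have 2: "homotopic_with (\<lambda>_. True) Z X snd (\<lambda>z. \<phi> (g z) y0)"
      by (rule homotopic_with_eq) (use fg in auto)
    \<comment> \<open>The first component is deformed to g x0 along the lift, the path p moves g x0
      to g y0, and the deformation of the second component is followed backwards.\<close>
    have 3: "homotopic_with (\<lambda>_. True) Z X fst snd"
      using homotopic_with_trans[OF homotopic_with_trans[OF 1 mid] homotopic_with_symD[OF 2]] .
    have "continuous_map (subtopology E (W j)) Z (\<lambda>z. z)"
      unfolding Z_def using VK[of j]
      by (intro continuous_map_into_subtopology continuous_map_from_subtopology) (auto simp: W_def)
    from homotopic_with_compose_continuous_map_right[OF 3 this]
    show ?thesis by (simp add: o_def)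
  qed
  show "TC X \<le> m"
    unfolding m
  proof (rule TC_le[where U = W])
    show "(\<Union>i<k. W i) = topspace E"
    proof (intro subset_antisym subsetI)
      fix z assume "z \<in> topspace E"
      moreover from this obtain j where "j < k" "E.q z \<in> V j" using Vcov qY by blast
      ultimately show "z \<in> (\<Union>i<k. W i)" unfolding W_def by blast
    qed (simp add: W_def)
    show "openin E (W i)" for i
      unfolding W_def using E.continuous_q V by (rule openin_continuous_map_preimage)
  qed (rule hom)
qed

end

section \<open>Linear tubes about free orbits and fixed points\<close>

context compact_group_action
begin

lemma group_action_subgroup_restrict:
  assumes "orthogonal_representation G T H k \<rho>"
  shows "group_action (G\<lparr>carrier := H\<rparr>) (topspace (Euclidean_space k)) \<rho>"
  using assms by (simp add: orthogonal_representation_def continuous_action_def)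

text \<open>For trivial H every twisted class is a singleton, so the twisted product is the plain
  product of G and V. The tube becomes a homeomorphism F, whose inverse splits into a group
  coordinate \<kappa> and a slice coordinate \<nu>.\<close>

lemma free_tube:
  assumes lt: "linear_tube G T X \<phi> x H k \<rho> f" and H: "H = {\<one>\<^bsub>G\<^esub>}" and x: "x \<in> topspace X"
  obtains U F \<kappa> \<nu> where "openin X U" "x \<in> U"
    "continuous_map (prod_topology T (Euclidean_space k)) X F"
    "continuous_map (subtopology X U) T \<kappa>" "continuous_map (subtopology X U) (Euclidean_space k) \<nu>"
    "\<And>u. u \<in> U \<Longrightarrow> F (\<kappa> u, \<nu> u) = u"
    "\<And>g v. g \<in> carrier G \<Longrightarrow> v \<in> topspace (Euclidean_space k) \<Longrightarrow>
       F (g, v) \<in> U \<and> \<kappa> (F (g, v)) = g \<and> \<nu> (F (g, v)) = v"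
    "\<And>g h v. g \<in> carrier G \<Longrightarrow> h \<in> carrier G \<Longrightarrow> v \<in> topspace (Euclidean_space k) \<Longrightarrow>
       F (g \<otimes>\<^bsub>G\<^esub> h, v) = \<phi> g (F (h, v))"
proof -
  interpret group G by (rule group_G)
  let ?V = "topspace (Euclidean_space k)" and ?P = "prod_topology T (Euclidean_space k)"
  let ?tp = "twisted_product G T H k \<rho>"
  have orep: "orthogonal_representation G T H k \<rho>" and emb: "embedding_map ?tp X f"
    and op: "openin X (f ` topspace ?tp)"
    and eqv: "\<And>g g' v. g \<in> carrier G \<Longrightarrow> g' \<in> carrier G \<Longrightarrow> v \<in> ?V \<Longrightarrow>
        f (twisted_class G H k \<rho> (g \<otimes>\<^bsub>G\<^esub> g') v) = \<phi> g (f (twisted_class G H k \<rho> g' v))"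
    and orb: "f ` {twisted_class G H k \<rho> g (\<lambda>_. 0) | g. g \<in> carrier G} = orbit G \<phi> x"
    using lt unfolding linear_tube_def by blast+
  have \<rho>1: "\<rho> \<one>\<^bsub>G\<^esub> v = v" if "v \<in> ?V" for v
    using group_action.id_eq_one[OF group_action_subgroup_restrict[OF orep]] that
    by (metis (no_types, lifting) monoid.select_convs(2) monoid.surjective partial_object.update_convs(1) restrict_apply')
  have cls: "orbit (G\<lparr>carrier := H\<rparr>) (twisted_action G k \<rho>) p = {p}" if "p \<in> topspace ?P" for p
    using that \<rho>1 topspace_T by (auto simp: orbit_def twisted_action_def H)
  have op_tp: "openin ?tp W \<longleftrightarrow> W \<subseteq> (\<lambda>p. {p}) ` topspace ?P \<and> openin ?P {p \<in> topspace ?P. {p} \<in> W}" for W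
  proof -
    have "orbits (G\<lparr>carrier := H\<rparr>) (topspace ?P) (twisted_action G k \<rho>) = (\<lambda>p. {p}) ` topspace ?P"
      unfolding orbits_def Setcompr_eq_image by (rule image_cong[OF refl cls])
    moreover have "{p \<in> topspace ?P. orbit (G\<lparr>carrier := H\<rparr>) (twisted_action G k \<rho>) p \<in> W} = {p \<in> topspace ?P. {p} \<in> W}"
      using cls by (auto simp del: topspace_prod_topology)
    ultimately show ?thesis unfolding twisted_product_def openin_orbit_space by (simp only:)
  qed
  have "openin ?tp ((\<lambda>p. {p}) ` topspace ?P)"
  proof -
    have "{p \<in> topspace ?P. {p} \<in> (\<lambda>p. {p}) ` topspace ?P} = topspace ?P" by blast
    then show ?thesis unfolding op_tp using openin_topspace[of ?P] by (simp only: order_refl simp_thms)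
  qed
  then have top_tp: "topspace ?tp = (\<lambda>p. {p}) ` topspace ?P"
    using conjunct1[OF iffD1[OF op_tp openin_topspace]] openin_subset by (intro subset_antisym)
  have "homeomorphic_maps ?P ?tp (\<lambda>p. {p}) the_elem"
    unfolding homeomorphic_maps_def
  proof (intro conjI)
    show "continuous_map ?P ?tp (\<lambda>p. {p})"
      unfolding continuous_map_def using op_tp top_tp by (auto simp del: topspace_prod_topology)
    show "continuous_map ?tp ?P the_elem"
      unfolding continuous_map_def
    proof (intro conjI allI impI)
      show "the_elem \<in> topspace ?tp \<rightarrow> topspace ?P" using top_tp by (auto simp del: topspace_prod_topology)
      fix U assume U: "openin ?P U"
      have "{p \<in> topspace ?P. {p} \<in> {c \<in> topspace ?tp. the_elem c \<in> U}} = U"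
        using openin_subset[OF U] top_tp by (auto simp del: topspace_prod_topology)
      then show "openin ?tp {c \<in> topspace ?tp. the_elem c \<in> U}"
        using U top_tp unfolding op_tp by (auto simp del: topspace_prod_topology)
    qed
  qed (use top_tp in \<open>auto simp del: topspace_prod_topology\<close>)
  then have j: "homeomorphic_map ?P ?tp (\<lambda>p. {p})" using homeomorphic_map_maps by blast
  define U where "U = f ` topspace ?tp"
  define F where "F = f \<circ> (\<lambda>p. {p})"
  have "homeomorphic_map ?tp (subtopology X U) f" using emb by (simp add: embedding_map_def U_def)
  then have "homeomorphic_map ?P (subtopology X U) F"
    unfolding F_def by (rule homeomorphic_map_compose[OF j])
  then obtain r where r: "homeomorphic_maps ?P (subtopology X U) F r"
    using homeomorphic_map_maps by blast
  have UX: "U \<subseteq> topspace X" using op openin_subset unfolding U_def by blast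
  have rc: "continuous_map (subtopology X U) ?P r" using r by (simp add: homeomorphic_maps_def)
  have Fc: "continuous_map ?P (subtopology X U) F" using r by (simp add: homeomorphic_maps_def)
  have Fcls: "F (g, v) = f (twisted_class G H k \<rho> g v)" if "g \<in> carrier G" "v \<in> ?V" for g v
    using cls[of "(g, v)"] that topspace_T by (simp add: F_def twisted_class_def)
  show thesis
  proof (rule that[of U F "fst \<circ> r" "snd \<circ> r"])
    show "openin X U" using op by (simp add: U_def)
    have "x \<in> f ` {twisted_class G H k \<rho> g (\<lambda>_. 0) | g. g \<in> carrier G}" using orb q_refl[OF x] by simp
    then obtain g where g: "g \<in> carrier G" "x = f (twisted_class G H k \<rho> g (\<lambda>_. 0))" by blast
    have "(\<lambda>_. 0) \<in> ?V" by (simp add: topspace_Euclidean_space)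
    then have "x = F (g, \<lambda>_. 0)" using Fcls g by simp
    moreover have "F (g, \<lambda>_. 0) \<in> topspace (subtopology X U)"
      using Fc g(1) \<open>(\<lambda>_. 0) \<in> ?V\<close> topspace_T unfolding continuous_map_def by auto
    ultimately show "x \<in> U" by simp
    show "continuous_map ?P X F" using Fc by (simp add: continuous_map_in_subtopology)
    show "continuous_map (subtopology X U) T (fst \<circ> r)" using rc continuous_map_fst by (rule continuous_map_compose)
    show "continuous_map (subtopology X U) (Euclidean_space k) (snd \<circ> r)" using rc continuous_map_snd by (rule continuous_map_compose)
    show "F ((fst \<circ> r) u, (snd \<circ> r) u) = u" if "u \<in> U" for u
      using r that UX by (auto simp: homeomorphic_maps_def)
    show "F (g, v) \<in> U \<and> (fst \<circ> r) (F (g, v)) = g \<and> (snd \<circ> r) (F (g, v)) = v" if "g \<in> carrier G" "v \<in> ?V" for g v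
    proof -
      have gv: "(g, v) \<in> topspace ?P" using that topspace_T by simp
      then have "F (g, v) \<in> topspace (subtopology X U)" using Fc unfolding continuous_map_def by blast
      moreover have "r (F (g, v)) = (g, v)" using r gv unfolding homeomorphic_maps_def by blast
      ultimately show ?thesis by simp
    qed
    show "F (g \<otimes>\<^bsub>G\<^esub> h, v) = \<phi> g (F (h, v))" if "g \<in> carrier G" "h \<in> carrier G" "v \<in> ?V" for g h v
      using eqv[OF that] Fcls that by simp
  qed
qed

text \<open>For H = G the class of (g, v) is that of (1, \<rho> g v), and it contains no other pair
  with first entry 1. So the twisted product is V, and the tube is a chart about x in which G acts
  linearly.\<close>

lemma fixed_tube:
  assumes lt: "linear_tube G T X \<phi> x H k \<rho> f" and H: "H = carrier G"
    and x: "x \<in> topspace X" "\<And>g. g \<in> carrier G \<Longrightarrow> \<phi> g x = x"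
  obtains U F \<nu> where "openin X U" "x \<in> U"
    "continuous_map (Euclidean_space k) X F" "continuous_map (subtopology X U) (Euclidean_space k) \<nu>"
    "\<And>u. u \<in> U \<Longrightarrow> F (\<nu> u) = u"
    "\<And>v. v \<in> topspace (Euclidean_space k) \<Longrightarrow> F v \<in> U \<and> \<nu> (F v) = v"
    "\<And>g v. g \<in> carrier G \<Longrightarrow> v \<in> topspace (Euclidean_space k) \<Longrightarrow> \<phi> g (F v) = F (\<rho> g v)"
    "F (\<lambda>_. 0) = x"
proof -
  interpret group G by (rule group_G)
  let ?V = "topspace (Euclidean_space k)" and ?P = "prod_topology T (Euclidean_space k)"
  let ?tp = "twisted_product G T H k \<rho>"
  have GH: "G\<lparr>carrier := H\<rparr> = G" by (simp add: H)
  have orep: "orthogonal_representation G T H k \<rho>" and emb: "embedding_map ?tp X f"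
    and op: "openin X (f ` topspace ?tp)"
    and eqv: "\<And>g g' v. g \<in> carrier G \<Longrightarrow> g' \<in> carrier G \<Longrightarrow> v \<in> ?V \<Longrightarrow>
        f (twisted_class G H k \<rho> (g \<otimes>\<^bsub>G\<^esub> g') v) = \<phi> g (f (twisted_class G H k \<rho> g' v))"
    and orb: "f ` {twisted_class G H k \<rho> g (\<lambda>_. 0) | g. g \<in> carrier G} = orbit G \<phi> x"
    using lt unfolding linear_tube_def by blast+
  have ra: "group_action G ?V \<rho>" using group_action_subgroup_restrict[OF orep] GH by simp
  have \<rho>V: "\<rho> g v \<in> ?V" if "g \<in> carrier G" "v \<in> ?V" for g v
    using group_action.element_image[OF ra] that by blast
  have \<rho>m: "\<rho> (g \<otimes>\<^bsub>G\<^esub> h) v = \<rho> g (\<rho> h v)" if "g \<in> carrier G" "h \<in> carrier G" "v \<in> ?V" for g h v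
    using group_action.composition_rule[OF ra] that by blast
  have \<rho>1: "\<rho> \<one>\<^bsub>G\<^esub> v = v" if "v \<in> ?V" for v
    by (metis ra group_action.id_eq_one restrict_apply' that)
  have "subtopology T H = T" using H topspace_T by (metis subtopology_topspace)
  then have rc: "continuous_map ?P (Euclidean_space k) (\<lambda>(g, v). \<rho> g v)"
    using orep by (simp add: orthogonal_representation_def continuous_action_def)
  define c where "c p = orbit G (twisted_action G k \<rho>) p" for p
  have c: "c (g, v) = {(g \<otimes>\<^bsub>G\<^esub> inv\<^bsub>G\<^esub> h, \<rho> h v) | h. h \<in> carrier G}" if "g \<in> carrier G" "v \<in> ?V" for g v
    using that by (auto simp: c_def orbit_def twisted_action_def)
  have tc: "twisted_class G H k \<rho> g v = c (g, v)" for g v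
    by (simp add: twisted_class_def c_def GH)
  have c1: "c (g, v) = c (\<one>\<^bsub>G\<^esub>, \<rho> g v)" if g: "g \<in> carrier G" "v \<in> ?V" for g v
  proof (intro subset_antisym subsetI)
    fix p assume "p \<in> c (g, v)"
    then obtain h where h: "h \<in> carrier G" "p = (g \<otimes>\<^bsub>G\<^esub> inv\<^bsub>G\<^esub> h, \<rho> h v)" using c[OF g] by auto
    have "p = (\<one>\<^bsub>G\<^esub> \<otimes>\<^bsub>G\<^esub> inv\<^bsub>G\<^esub> (h \<otimes>\<^bsub>G\<^esub> inv\<^bsub>G\<^esub> g), \<rho> (h \<otimes>\<^bsub>G\<^esub> inv\<^bsub>G\<^esub> g) (\<rho> g v))"
      using h g \<rho>m[symmetric] by (simp add: inv_mult_group m_assoc)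
    moreover have "h \<otimes>\<^bsub>G\<^esub> inv\<^bsub>G\<^esub> g \<in> carrier G" using g h by simp
    ultimately show "p \<in> c (\<one>\<^bsub>G\<^esub>, \<rho> g v)" using c[OF one_closed \<rho>V[OF g]] by blast
  next
    fix p assume "p \<in> c (\<one>\<^bsub>G\<^esub>, \<rho> g v)"
    then obtain h where h: "h \<in> carrier G" "p = (\<one>\<^bsub>G\<^esub> \<otimes>\<^bsub>G\<^esub> inv\<^bsub>G\<^esub> h, \<rho> h (\<rho> g v))"
      using c[OF one_closed \<rho>V[OF g]] by auto
    have "p = (g \<otimes>\<^bsub>G\<^esub> inv\<^bsub>G\<^esub> (h \<otimes>\<^bsub>G\<^esub> g), \<rho> (h \<otimes>\<^bsub>G\<^esub> g) v)"
      using h g \<rho>m by (simp add: inv_mult_group m_assoc[symmetric])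
    moreover have "h \<otimes>\<^bsub>G\<^esub> g \<in> carrier G" using g h by simp
    ultimately show "p \<in> c (g, v)" using c[OF g] by blast
  qed
  have top_tp: "topspace ?tp = c ` topspace ?P"
    unfolding twisted_product_def topspace_orbit_space GH by (auto simp: orbits_def c_def)
  have op_tp: "openin ?tp W \<longleftrightarrow> W \<subseteq> c ` topspace ?P \<and> openin ?P {p \<in> topspace ?P. c p \<in> W}" for W
    unfolding twisted_product_def openin_orbit_space GH orbits_def Setcompr_eq_image c_def[abs_def] by (rule refl)
  define j where "j v = c (\<one>\<^bsub>G\<^esub>, v)" for v
  \<comment> \<open>Any representative may be chosen, since \<rho> g v is the same for all pairs (g,
    v) of a class.\<close>
  define j' where "j' = (\<lambda>C. (\<lambda>(g, v). \<rho> g v) (SOME p. p \<in> C))"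
  have j'c: "j' (c (g, v)) = \<rho> g v" if g: "g \<in> carrier G" "v \<in> ?V" for g v
  proof -
    have "(g \<otimes>\<^bsub>G\<^esub> inv\<^bsub>G\<^esub> \<one>\<^bsub>G\<^esub>, \<rho> \<one>\<^bsub>G\<^esub> v) \<in> c (g, v)" using c[OF g] by blast
    then have "(SOME p. p \<in> c (g, v)) \<in> c (g, v)" by (rule someI)
    then obtain h where h: "h \<in> carrier G" "(SOME p. p \<in> c (g, v)) = (g \<otimes>\<^bsub>G\<^esub> inv\<^bsub>G\<^esub> h, \<rho> h v)" using c[OF g] by auto
    then show ?thesis using g \<rho>m[symmetric] by (simp add: j'_def m_assoc)
  qed
  have "homeomorphic_maps (Euclidean_space k) ?tp j j'"
    unfolding homeomorphic_maps_def
  proof (intro conjI ballI)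
    have cc: "continuous_map ?P ?tp c"
      unfolding continuous_map_def using op_tp top_tp by (auto simp del: topspace_prod_topology)
    have "continuous_map (Euclidean_space k) ?P (\<lambda>v. (\<one>\<^bsub>G\<^esub>, v))"
      using topspace_T by (intro continuous_map_pairedI) simp_all
    from continuous_map_compose[OF this cc] show "continuous_map (Euclidean_space k) ?tp j"
      by (simp add: o_def j_def[abs_def])
    show "continuous_map ?tp (Euclidean_space k) j'"
      unfolding continuous_map_def
    proof (intro conjI allI impI)
      show "j' \<in> topspace ?tp \<rightarrow> ?V" using top_tp topspace_T j'c \<rho>V by auto
      fix U assume U: "openin (Euclidean_space k) U"
      have "{p \<in> topspace ?P. c p \<in> {C \<in> topspace ?tp. j' C \<in> U}} = {p \<in> topspace ?P. (\<lambda>(g, v). \<rho> g v) p \<in> U}"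
        using top_tp topspace_T j'c by auto
      moreover have "openin ?P {p \<in> topspace ?P. (\<lambda>(g, v). \<rho> g v) p \<in> U}"
        using rc U by (rule openin_continuous_map_preimage)
      ultimately show "openin ?tp {C \<in> topspace ?tp. j' C \<in> U}"
        unfolding op_tp using top_tp by (simp del: topspace_prod_topology)
    qed
    show "j' (j v) = v" if "v \<in> ?V" for v using j'c[OF one_closed that] \<rho>1 that by (simp add: j_def)
    show "j (j' C) = C" if C: "C \<in> topspace ?tp" for C
    proof -
      obtain g v where "g \<in> carrier G" "v \<in> ?V" "C = c (g, v)" using C top_tp topspace_T by auto
      then show ?thesis using j'c c1 by (simp add: j_def)
    qed
  qed
  then have j: "homeomorphic_map (Euclidean_space k) ?tp j" using homeomorphic_map_maps by blast
  define U where "U = f ` topspace ?tp"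
  define F where "F = f \<circ> j"
  have "homeomorphic_map ?tp (subtopology X U) f" using emb by (simp add: embedding_map_def U_def)
  then have "homeomorphic_map (Euclidean_space k) (subtopology X U) F"
    unfolding F_def by (rule homeomorphic_map_compose[OF j])
  then obtain r where r: "homeomorphic_maps (Euclidean_space k) (subtopology X U) F r"
    using homeomorphic_map_maps by blast
  have UX: "U \<subseteq> topspace X" using op openin_subset unfolding U_def by blast
  have Fc: "continuous_map (Euclidean_space k) (subtopology X U) F" using r by (simp add: homeomorphic_maps_def)
  have FU: "F v \<in> U" if "v \<in> ?V" for v
    using Fc that unfolding continuous_map_def by auto
  have V0: "(\<lambda>_. 0) \<in> ?V" by (simp add: topspace_Euclidean_space)
  have "F (\<lambda>_. 0) \<in> f ` {twisted_class G H k \<rho> g (\<lambda>_. 0) | g. g \<in> carrier G}"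
    unfolding F_def j_def tc o_def by blast
  then have F0: "F (\<lambda>_. 0) = x" unfolding orb using x(2) by (auto simp: orbit_def)
  show thesis
  proof (rule that[of U F r])
    show "openin X U" using op by (simp add: U_def)
    show "x \<in> U" using FU[OF V0] F0 by simp
    show "continuous_map (Euclidean_space k) X F" using Fc by (simp add: continuous_map_in_subtopology)
    show "continuous_map (subtopology X U) (Euclidean_space k) r" using r by (simp add: homeomorphic_maps_def)
    show "F (r u) = u" if "u \<in> U" for u using r that UX unfolding homeomorphic_maps_def by auto
    show "F v \<in> U \<and> r (F v) = v" if "v \<in> ?V" for v using FU[OF that] r that unfolding homeomorphic_maps_def by blast
    show "\<phi> g (F v) = F (\<rho> g v)" if "g \<in> carrier G" "v \<in> ?V" for g v
    proof -
      have "\<phi> g (F v) = f (c (g \<otimes>\<^bsub>G\<^esub> \<one>\<^bsub>G\<^esub>, v))"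
        using eqv[OF that(1) one_closed that(2)] by (simp add: F_def j_def tc)
      also have "\<dots> = F (\<rho> g v)" using c1[OF that] that by (simp add: F_def j_def)
      finally show ?thesis .
    qed
    show "F (\<lambda>_. 0) = x" by (rule F0)
  qed
qed

end

section \<open>Cubes in Euclidean space\<close>

text \<open>Cubes rather than balls, because the topology of \<open>Euclidean_space\<close> comes
  from a product: openness, compactness and smallness can be checked coordinate by
  coordinate.\<close>

definition open_cube :: "nat \<Rightarrow> (nat \<Rightarrow> real) \<Rightarrow> real \<Rightarrow> (nat \<Rightarrow> real) set" where
  "open_cube n c r = {w \<in> topspace (Euclidean_space n). \<forall>i<n. \<bar>w i - c i\<bar> < r}"

definition closed_cube :: "nat \<Rightarrow> (nat \<Rightarrow> real) \<Rightarrow> real \<Rightarrow> (nat \<Rightarrow> real) set" where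
  "closed_cube n c r = {w \<in> topspace (Euclidean_space n). \<forall>i<n. \<bar>w i - c i\<bar> \<le> r}"

lemma open_cube_subset_closed_cube: "open_cube n c r \<subseteq> closed_cube n c r"
  by (auto simp: open_cube_def closed_cube_def less_imp_le)

lemma continuous_map_Euclidean_coordinate:
  "continuous_map (Euclidean_space n) euclideanreal (\<lambda>w. w i)"
  unfolding Euclidean_space_def
  by (intro continuous_map_from_subtopology continuous_map_product_projection) simp

lemma Euclidean_space_eqI:
  "v \<in> topspace (Euclidean_space n) \<Longrightarrow> w \<in> topspace (Euclidean_space n) \<Longrightarrow> (\<And>i. i < n \<Longrightarrow> v i = w i) \<Longrightarrow> v = w"
  unfolding topspace_Euclidean_space by (rule ext, rename_tac i, case_tac "i < n") auto

lemma openin_open_cube: "openin (Euclidean_space n) (open_cube n c r)"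
proof -
  have "open_cube n c r = topspace (Euclidean_space n) \<inter>
      \<Inter> ((\<lambda>i. {w \<in> topspace (Euclidean_space n). w i \<in> {c i - r<..<c i + r}}) ` {..<n})"
    by (auto simp: open_cube_def abs_diff_less_iff)
  also have "openin (Euclidean_space n) \<dots>"
  proof (intro openin_Int_Inter)
    fix A assume "A \<in> (\<lambda>i. {w \<in> topspace (Euclidean_space n). w i \<in> {c i - r<..<c i + r}}) ` {..<n}"
    then obtain i where "A = {w \<in> topspace (Euclidean_space n). w i \<in> {c i - r<..<c i + r}}" by blast
    then show "openin (Euclidean_space n) A"
      using openin_continuous_map_preimage[OF continuous_map_Euclidean_coordinate, of "{c i - r<..<c i + r}"]
      by (simp only: open_openin[symmetric] open_greaterThanLessThan)
  qed simp_all
  finally show ?thesis .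
qed

lemma compactin_closed_cube: "compactin (Euclidean_space n) (closed_cube n c r)"
proof -
  have eq: "closed_cube n c r = PiE UNIV (\<lambda>i. if i < n then {c i - r..c i + r} else {0})"
    by (auto simp: closed_cube_def topspace_Euclidean_space PiE_iff abs_diff_le_iff split: if_splits)
  have "compactin (powertop_real UNIV) (closed_cube n c r)"
    unfolding eq compactin_PiE by auto
  then show ?thesis
    unfolding Euclidean_space_def compactin_subtopology
    by (auto simp: closed_cube_def topspace_Euclidean_space)
qed

text \<open>A basic open set restricts finitely many coordinates, so the minimum of their radii is
  positive; coordinates from n on vanish at both points.\<close>

lemma closed_cube_in_open:
  assumes W: "openin (Euclidean_space n) W" and c: "c \<in> W"
  obtains r where "r > 0" "closed_cube n c r \<subseteq> W"
proof -
  have cV: "c \<in> topspace (Euclidean_space n)" using W c openin_subset by blast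
  obtain S where S: "openin (powertop_real UNIV) S" "W = S \<inter> {x. \<forall>i\<ge>n. x i = 0}"
    using W unfolding Euclidean_space_def openin_subtopology by blast
  then obtain U where U: "finite {i. U i \<noteq> UNIV}" "\<And>i. open (U i)" "c \<in> PiE UNIV U" "PiE UNIV U \<subseteq> S"
    using c unfolding openin_product_topology_alt by auto
  have "\<exists>e>0. cball (c i) e \<subseteq> U i" for i
    using U(2)[of i] U(3) by (auto simp: open_contains_cball PiE_iff)
  then obtain e where e: "\<And>i. e i > 0" "\<And>i. cball (c i) (e i) \<subseteq> U i" by metis
  define r where "r = Min (insert 1 (e ` {i. U i \<noteq> UNIV}))"
  have "r > 0" unfolding r_def using U(1) e(1) by (subst Min_gr_iff) auto
  moreover have "closed_cube n c r \<subseteq> W"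
  proof
    fix w assume w: "w \<in> closed_cube n c r"
    have wi: "\<bar>w i - c i\<bar> \<le> r" for i
      using w cV \<open>r > 0\<close> by (cases "i < n") (auto simp: closed_cube_def topspace_Euclidean_space)
    have "w i \<in> U i" for i
    proof (cases "U i = UNIV")
      case False
      then have "r \<le> e i" unfolding r_def using U(1) by (intro Min_le) auto
      then have "w i \<in> cball (c i) (e i)" using wi[of i] by (simp add: dist_real_def abs_minus_commute)
      then show ?thesis using e(2) by blast
    qed auto
    then have "w \<in> S" using U(4) by (auto simp: PiE_iff)
    then show "w \<in> W" using S(2) w by (auto simp: closed_cube_def topspace_Euclidean_space)
  qed
  ultimately show thesis by (rule that)
qed

lemma contractible_open_cube:
  assumes c: "c \<in> topspace (Euclidean_space n)" and r: "r > 0"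
  shows "contractible_space (subtopology (Euclidean_space n) (open_cube n c r))"
proof -
  let ?Q = "subtopology (Euclidean_space n) (open_cube n c r)"
  have tQ: "topspace ?Q = open_cube n c r" by (auto simp: open_cube_def)
  let ?I = "top_of_set {0..1::real}"
  define h where "h = (\<lambda>p i. if i < n then (1 - fst p) * snd p i + fst p * c i else (0::real))" 
  have "continuous_map (prod_topology ?I ?Q) (Euclidean_space n) h"
    unfolding h_def continuous_map_componentwise_Euclidean_space
  proof (intro allI impI)
    fix i
    have 1: "continuous_map (prod_topology ?I ?Q) euclideanreal fst"
      using continuous_map_fst[of ?I ?Q] by (simp add: continuous_map_in_subtopology)
    have 2: "continuous_map (prod_topology ?I ?Q) euclideanreal (\<lambda>p. snd p i)"
      using continuous_map_compose[OF continuous_map_snd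
          continuous_map_from_subtopology[OF continuous_map_Euclidean_coordinate]] by (simp add: o_def)
    show "continuous_map (prod_topology ?I ?Q) euclideanreal (\<lambda>p. (1 - fst p) * snd p i + fst p * c i)"
      using 1 2 by (intro continuous_map_add continuous_map_real_mult continuous_map_diff) auto
  qed
  moreover have "h (t, w) \<in> open_cube n c r" if t: "t \<in> {0..1}" and w: "w \<in> open_cube n c r" for t w
  proof -
    have "\<bar>h (t, w) i - c i\<bar> < r" if "i < n" for i
    proof -
      have "h (t, w) i - c i = (1 - t) * (w i - c i)" using that by (simp add: h_def algebra_simps)
      then have "\<bar>h (t, w) i - c i\<bar> \<le> 1 * \<bar>w i - c i\<bar>"
        using t by (simp only: abs_mult) (intro mult_right_mono; simp)
      moreover have "\<bar>w i - c i\<bar> < r" using w that by (simp add: open_cube_def)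
      ultimately show ?thesis unfolding mult_1 by (rule le_less_trans)
    qed
    then show ?thesis by (simp add: open_cube_def topspace_Euclidean_space h_def)
  qed
  ultimately have "continuous_map (prod_topology ?I ?Q) ?Q h"
    using tQ by (intro continuous_map_into_subtopology) auto
  moreover have "h (0, w) = w" "h (1, w) = c" if "w \<in> open_cube n c r" for w
  proof -
    have wV: "w \<in> topspace (Euclidean_space n)" using that by (simp add: open_cube_def)
    show "h (0, w) = w" "h (1, w) = c"
      using wV c unfolding topspace_Euclidean_space by (auto simp: h_def)
  qed
  ultimately have "homotopic_with (\<lambda>_. True) ?Q ?Q id (\<lambda>_. c)"
    by (subst homotopic_with, simp) (use tQ in \<open>auto intro!: exI[of _ h]\<close>)
  then show ?thesis unfolding contractible_space_def by blast
qed

lemma contractible_space_continuous_inverse: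
  assumes "contractible_space A" "continuous_map A B r" "continuous_map B A s"
    and "\<And>y. y \<in> topspace B \<Longrightarrow> r (s y) = y"
  shows "contractible_space B"
  using assms by (intro contractible_space_retraction_map_image[of A _ r])
    (auto simp: retraction_map_def retraction_maps_def)

text \<open>B and C serve different ends: the contractible open B becomes a factor of a slice, while
  the compact C becomes a factor of the domain of a colouring, where the chart coordinates separate
  points.\<close>

lemma chart_cube:
  assumes ch: "is_chart n X (U, p)" and y: "y \<in> U"
  obtains B C where "openin X B" "y \<in> B" "B \<subseteq> C" "C \<subseteq> U" "compactin X C"
    "contractible_space (subtopology X B)"
    "\<And>i. continuous_map (subtopology X U) euclideanreal (\<lambda>x. p x i)"
    "\<And>a b. a \<in> U \<Longrightarrow> b \<in> U \<Longrightarrow> (\<And>i. i < n \<Longrightarrow> p a i = p b i) \<Longrightarrow> a = b"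
proof -
  let ?E = "Euclidean_space n"
  have U: "openin X U" "openin ?E (p ` U)" "homeomorphic_map (subtopology X U) (subtopology ?E (p ` U)) p"
    using ch by (auto simp: is_chart_def)
  have UX: "U \<subseteq> topspace X" using U(1) by (rule openin_subset)
  have pE: "p ` U \<subseteq> topspace ?E" using U(2) by (rule openin_subset)
  obtain s where s: "homeomorphic_maps (subtopology X U) (subtopology ?E (p ` U)) p s"
    using U(3) homeomorphic_map_maps by blast
  have pc: "continuous_map (subtopology X U) (subtopology ?E (p ` U)) p"
    and sc: "continuous_map (subtopology ?E (p ` U)) (subtopology X U) s"
    using s by (auto simp: homeomorphic_maps_def)
  have sp: "s (p x) = x" if "x \<in> U" for x using s that UX by (auto simp: homeomorphic_maps_def)
  obtain r where r: "r > 0" "closed_cube n (p y) r \<subseteq> p ` U"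
    using closed_cube_in_open[OF U(2)] y by blast
  have oU: "open_cube n (p y) r \<subseteq> p ` U" using r(2) open_cube_subset_closed_cube by blast
  define B where "B = s ` open_cube n (p y) r"
  define C where "C = s ` closed_cube n (p y) r"
  have BU: "B = {x \<in> topspace (subtopology X U). p x \<in> open_cube n (p y) r}"
  proof (intro subset_antisym subsetI)
    fix x assume "x \<in> B"
    then obtain w where w: "w \<in> open_cube n (p y) r" "x = s w" by (auto simp: B_def)
    then obtain u where "u \<in> U" "w = p u" using oU by blast
    then show "x \<in> {x \<in> topspace (subtopology X U). p x \<in> open_cube n (p y) r}" using w sp UX by auto
  next
    fix x assume "x \<in> {x \<in> topspace (subtopology X U). p x \<in> open_cube n (p y) r}"
    then show "x \<in> B" using sp[of x] unfolding B_def by force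
  qed
  show thesis
  proof (rule that[of B C])
    have pE': "continuous_map (subtopology X U) ?E p" using pc by (simp add: continuous_map_in_subtopology)
    have "openin (subtopology X U) B"
      unfolding BU using pE' openin_open_cube by (rule openin_continuous_map_preimage)
    then show "openin X B" using U(1) by (rule openin_trans_full)
    have "p y \<in> open_cube n (p y) r" using r(1) pE y by (auto simp: open_cube_def)
    then show "y \<in> B" unfolding BU using y UX by auto
    show "B \<subseteq> C" unfolding B_def C_def using open_cube_subset_closed_cube by (rule image_mono)
    have sU: "s w \<in> U" if "w \<in> p ` U" for w using that sp by auto
    show "C \<subseteq> U" unfolding C_def using r(2) sU by blast
    have "compactin (subtopology ?E (p ` U)) (closed_cube n (p y) r)"
      using compactin_closed_cube r(2) by (simp add: compactin_subtopology)
    then have "compactin (subtopology X U) C" unfolding C_def using sc by (rule image_compactin)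
    then show "compactin X C" by (simp add: compactin_subtopology)
    show "contractible_space (subtopology X B)"
    proof (rule contractible_space_continuous_inverse)
      show "contractible_space (subtopology ?E (open_cube n (p y) r))"
        using pE y r(1) by (intro contractible_open_cube) auto
      have "continuous_map (subtopology ?E (open_cube n (p y) r)) (subtopology X U) s"
        using sc oU by (rule continuous_map_from_subtopology_mono)
      then show "continuous_map (subtopology ?E (open_cube n (p y) r)) (subtopology X B) s"
        by (intro continuous_map_into_subtopology) (auto simp: continuous_map_in_subtopology B_def)
      have "continuous_map (subtopology X B) ?E p"
        using pE' by (rule continuous_map_from_subtopology_mono) (auto simp: BU)
      then show "continuous_map (subtopology X B) (subtopology ?E (open_cube n (p y) r)) p"
        by (intro continuous_map_into_subtopology) (auto simp: BU)
      show "s (p x) = x" if "x \<in> topspace (subtopology X B)" for x using that sp by (auto simp: BU)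
    qed
    show "continuous_map (subtopology X U) euclideanreal (\<lambda>x. p x i)" for i
      using continuous_map_compose[OF pE' continuous_map_Euclidean_coordinate] by (simp add: o_def)
    show "a = b" if ab: "a \<in> U" "b \<in> U" "\<And>i. i < n \<Longrightarrow> p a i = p b i" for a b
    proof -
      have "p a = p b" using pE ab by (intro Euclidean_space_eqI[of _ n]) auto
      then show ?thesis using sp ab by metis
    qed
  qed
qed

section \<open>Dimension bounds from injective parametrisations\<close>

text \<open>On the preimage of one chart of X the map becomes an injection from an open subset of (a
  + b)-space to n-space. With a piece of G and a slice it yields d + k \<le> n, with a piece of G
  and the fixed directions d + m \<le> n.\<close>

lemma prod_injection_dim_le:
  assumes A: "openin (Euclidean_space a) A" "A \<noteq> {}"
    and h: "continuous_map (prod_topology (subtopology (Euclidean_space a) A) (Euclidean_space b)) X h"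
    and inj: "inj_on h (A \<times> topspace (Euclidean_space b))"
    and charts: "\<And>x. x \<in> topspace X \<Longrightarrow> \<exists>U p. x \<in> U \<and> is_chart n X (U, p)"
  shows "a + b \<le> n"
proof -
  let ?E = "Euclidean_space (a + b)"
  define hd where "hd = (\<lambda>w i. if i < a then w i else (0::real))"
  define tl where "tl = (\<lambda>w i. if i < b then w (a + i) else (0::real))"
  have hd: "continuous_map ?E (Euclidean_space a) hd" and tl: "continuous_map ?E (Euclidean_space b) tl"
    unfolding hd_def tl_def continuous_map_componentwise_Euclidean_space
    by (simp_all add: continuous_map_Euclidean_coordinate)
  obtain w0 where w0: "w0 \<in> A" using A(2) by blast
  have w0a: "w0 \<in> topspace (Euclidean_space a)" using w0 openin_subset[OF A(1)] by blast
  \<comment> \<open>With all later coordinates zero, a point of A is also a point of (a + b)-space;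
    it witnesses that the final domain is non-empty.\<close>
  then have w0E: "w0 \<in> topspace ?E" by (simp add: topspace_Euclidean_space)
  have hd0: "hd w0 = w0" using w0a by (auto simp: hd_def topspace_Euclidean_space)
  define W1 where "W1 = {w \<in> topspace ?E. hd w \<in> A}"
  have W1: "openin ?E W1" unfolding W1_def using hd A(1) by (rule openin_continuous_map_preimage)
  define k where "k w = h (hd w, tl w)" for w
  have "continuous_map (subtopology ?E W1) (prod_topology (subtopology (Euclidean_space a) A) (Euclidean_space b)) (\<lambda>w. (hd w, tl w))"
    by (intro continuous_map_pairedI continuous_map_into_subtopology continuous_map_from_subtopology hd tl) (auto simp: W1_def)
  from continuous_map_compose[OF this h] have k: "continuous_map (subtopology ?E W1) X k"
    by (simp add: o_def k_def[abs_def])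
  have tW1: "topspace (subtopology ?E W1) = W1" by (auto simp: W1_def)
  have w0W: "w0 \<in> W1" unfolding W1_def using w0E hd0 w0 by simp
  then have "k w0 \<in> topspace X" using k tW1 unfolding continuous_map_def by blast
  then obtain U p where U: "k w0 \<in> U" "is_chart n X (U, p)" using charts by blast
  have Uo: "openin X U" "homeomorphic_map (subtopology X U) (subtopology (Euclidean_space n) (p ` U)) p"
    using U(2) by (auto simp: is_chart_def)
  define W where "W = {w \<in> topspace (subtopology ?E W1). k w \<in> U}"
  have "openin (subtopology ?E W1) W" unfolding W_def using k Uo(1) by (rule openin_continuous_map_preimage)
  then have W: "openin ?E W" using W1 by (rule openin_trans_full)
  have kW: "continuous_map (subtopology ?E W) (subtopology X U) k"
  proof (rule continuous_map_into_subtopology)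
    show "continuous_map (subtopology ?E W) X k"
      using k by (rule continuous_map_from_subtopology_mono) (auto simp: W_def)
  qed (auto simp: W_def)
  have "continuous_map (subtopology X U) (Euclidean_space n) p"
    using homeomorphic_imp_continuous_map[OF Uo(2)] by (simp add: continuous_map_in_subtopology)
  with kW have "continuous_map (subtopology ?E W) (Euclidean_space n) (p \<circ> k)"
    by (rule continuous_map_compose)
  moreover have "inj_on (p \<circ> k) W"
  proof (rule inj_onI)
    fix v w assume vw: "v \<in> W" "w \<in> W" "(p \<circ> k) v = (p \<circ> k) w"
    have "inj_on p (topspace (subtopology X U))" using Uo(2) by (rule homeomorphic_imp_injective_map)
    moreover have "topspace (subtopology X U) = U" using openin_subset[OF Uo(1)] by auto
    ultimately have "k v = k w" using vw by (auto simp: W_def inj_on_def)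
    then have eq: "(hd v, tl v) = (hd w, tl w)"
      using inj vw openin_subset[OF W] tl unfolding k_def
      by (intro inj_onD[OF inj]) (auto simp: W_def W1_def continuous_map_def)
    have "v i = w i" if "i < a + b" for i
    proof (cases "i < a")
      case True
      moreover have "hd v i = hd w i" using eq by simp
      ultimately show ?thesis by (simp add: hd_def)
    next
      case False
      moreover have "tl v (i - a) = tl w (i - a)" using eq by simp
      moreover have "i - a < b" "a + (i - a) = i" using that False by simp_all
      ultimately show ?thesis by (simp add: tl_def)
    qed
    then show "v = w" using vw openin_subset[OF W] by (intro Euclidean_space_eqI[of _ "a + b"]) auto
  qed
  moreover have "w0 \<in> W" unfolding W_def tW1 using w0W U(1) by simp
  ultimately show ?thesis
    using Euclidean_space_injection_dim_le[OF W] by blast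
qed

text \<open>The dimension of G enters the estimates through this map alone: an open piece of d-space
  that injects into G.\<close>

lemma chart_parametrization:
  assumes "is_chart d T (U, p)" "g \<in> U"
  obtains A s where "openin (Euclidean_space d) A" "A \<noteq> {}"
    "continuous_map (subtopology (Euclidean_space d) A) T s" "inj_on s A"
proof -
  have U: "openin T U" "openin (Euclidean_space d) (p ` U)" 
    "homeomorphic_map (subtopology T U) (subtopology (Euclidean_space d) (p ` U)) p"
    using assms(1) by (auto simp: is_chart_def)
  obtain s where s: "homeomorphic_maps (subtopology T U) (subtopology (Euclidean_space d) (p ` U)) p s"
    using U(3) homeomorphic_map_maps by blast
  show thesis
  proof (rule that[OF U(2)])
    show "p ` U \<noteq> {}" using assms(2) by blast
    show "continuous_map (subtopology (Euclidean_space d) (p ` U)) T s"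
      using s by (simp add: homeomorphic_maps_def continuous_map_in_subtopology)
    have "s (p u) = u" if "u \<in> U" for u
      using s that openin_subset[OF U(1)] by (auto simp: homeomorphic_maps_def)
    then show "inj_on s (p ` U)" by (auto simp: inj_on_def)
  qed
qed

section \<open>From coloured covers to TC and LS category\<close>

text \<open>The null-homotopies of the small sets may end at different points. Path-connectedness
  redirects them all to one c0, and only then is a disjoint union of such sets
  null-homotopic.\<close>

lemma colorable_LS_cat_le:
  assumes Y: "normal_space Y" "path_connected_space Y" "topspace Y \<noteq> {}" and col: "colorable Y N (topspace Y)"
    and loc: "\<And>y. y \<in> topspace Y \<Longrightarrow> \<exists>V c. openin Y V \<and> y \<in> V \<and>
      homotopic_with (\<lambda>_. True) (subtopology Y V) Y id (\<lambda>_. c)"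
  shows "LS_cat Y \<le> enat (Suc N)"
proof -
  obtain c0 where c0: "c0 \<in> topspace Y" using Y(3) by blast
  define \<U> where "\<U> = {V. openin Y V \<and> homotopic_with (\<lambda>_. True) (subtopology Y V) Y id (\<lambda>_. c0)}"
  have "\<exists>V\<in>\<U>. y \<in> V" if y: "y \<in> topspace Y" for y
  proof -
    obtain V c where V: "openin Y V" "y \<in> V" "homotopic_with (\<lambda>_. True) (subtopology Y V) Y id (\<lambda>_. c)"
      using loc[OF y] by blast
    have "y \<in> topspace (subtopology Y V)" using V(2) y by simp
    moreover have "continuous_map (subtopology Y V) Y (\<lambda>_. c)"
      using homotopic_with_imp_continuous_maps[OF V(3)] by (rule conjunct2)
    ultimately have "c \<in> topspace Y" unfolding continuous_map_def by blast
    then have "homotopic_with (\<lambda>_. True) (subtopology Y V) Y (\<lambda>_. c) (\<lambda>_. c0)"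
      using path_connected_space_imp_path_component_of[OF Y(2)] c0 by (simp add: homotopic_constant_maps)
    from homotopic_with_trans[OF V(3) this] show ?thesis using V(1,2) unfolding \<U>_def by blast
  qed
  then have "topspace Y \<subseteq> \<Union>\<U>" by blast
  then obtain \<O> where \<O>: "\<And>j. j \<le> N \<Longrightarrow> pairwise disjnt (\<O> j)"
    "\<And>j W. j \<le> N \<Longrightarrow> W \<in> \<O> j \<Longrightarrow> openin Y W \<and> (\<exists>U\<in>\<U>. W \<subseteq> U)"
    "(\<Union>j\<le>N. \<Union>(\<O> j)) = topspace Y"
    using colorable_topspaceD[OF Y(1) col, of \<U>] by (auto simp: \<U>_def)
  show ?thesis
  proof (rule LS_cat_le[where U = "\<lambda>j. \<Union>(\<O> j)"])
    show "(\<Union>i<Suc N. \<Union> (\<O> i)) = topspace Y" using \<O>(3) by (simp add: lessThan_Suc_atMost)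
    fix i assume "i < Suc N"
    then have i: "i \<le> N" by simp
    show "openin Y (\<Union> (\<O> i))" using \<O>(2)[OF i] by (intro openin_Union) blast
    have "homotopic_with (\<lambda>_. True) (subtopology Y (\<Union> (\<O> i))) Y id (\<lambda>_. c0)"
    proof (rule homotopic_with_Union_disjoint_open[OF \<O>(1)[OF i]])
      fix W assume "W \<in> \<O> i"
      then obtain U where W: "openin Y W" "U \<in> \<U>" "W \<subseteq> U" using \<O>(2)[OF i] by blast
      then show "openin Y W" by blast
      have "homotopic_with (\<lambda>_. True) (subtopology Y U) Y id (\<lambda>_. c0)" using W(2) by (simp add: \<U>_def)
      moreover have "continuous_map (subtopology Y W) (subtopology Y U) id"
        using W(3) by (intro continuous_map_into_subtopology continuous_map_from_subtopology) auto
      ultimately have "homotopic_with (\<lambda>_. True) (subtopology Y W) Y (id \<circ> id) ((\<lambda>_. c0) \<circ> id)"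
        by (rule homotopic_with_compose_continuous_map_right) simp
      then show "homotopic_with (\<lambda>_. True) (subtopology Y W) Y id (\<lambda>_. c0)" by (simp add: o_def id_def)
    qed
    then show "\<exists>c\<in>topspace Y. homotopic_with (\<lambda>_. True) (subtopology Y (\<Union> (\<O> i))) Y id (\<lambda>_. c)"
      using c0 by blast
  qed
qed

context diagonal_square
begin

text \<open>Colours are counted on the orbit space and pulled back. Invariance makes W the full
  preimage of its image, so its homotopy is available over an open set of orbits.\<close>

lemma colorable_TC_le:
  assumes col: "colorable E.Y N (topspace E.Y)"
    and loc: "\<And>z. z \<in> topspace E \<Longrightarrow> \<exists>W. openin E W \<and> z \<in> W \<and> (\<forall>g\<in>carrier G. \<forall>e\<in>W. \<delta> g e \<in> W) \<and>
      homotopic_with (\<lambda>_. True) (subtopology E W) X fst snd"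
  shows "TC X \<le> enat (Suc N)"
proof -
  define \<U> where "\<U> = {V. openin E.Y V \<and>
    homotopic_with (\<lambda>_. True) (subtopology E {z \<in> topspace E. E.q z \<in> V}) X fst snd}"
  have "\<exists>V\<in>\<U>. y \<in> V" if "y \<in> topspace E.Y" for y
  proof -
    obtain z where z: "z \<in> topspace E" "y = E.q z" using \<open>y \<in> topspace E.Y\<close> by (auto simp: E.topspace_Y)
    obtain W where W: "openin E W" "z \<in> W" "\<forall>g\<in>carrier G. \<forall>e\<in>W. \<delta> g e \<in> W"
      "homotopic_with (\<lambda>_. True) (subtopology E W) X fst snd"
      using loc[OF z(1)] by blast
    have WE: "W \<subseteq> topspace E" using W(1) by (rule openin_subset)
    have "{z \<in> topspace E. E.q z \<in> E.q ` W} = W"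
    proof (intro subset_antisym subsetI)
      fix e assume "e \<in> {z \<in> topspace E. E.q z \<in> E.q ` W}"
      then obtain w where w: "e \<in> topspace E" "w \<in> W" "E.q w = E.q e" by auto
      then obtain g where "g \<in> carrier G" "e = \<delta> g w" using E.q_eq_iff[of w e] WE by auto
      then show "e \<in> W" using W(3) w by blast
    qed (use WE in auto)
    then have "E.q ` W \<in> \<U>" unfolding \<U>_def using W(4) E.open_q_image[OF W(1)] by simp
    then show ?thesis using z W(2) by blast
  qed
  then have "topspace E.Y \<subseteq> \<Union>\<U>" by blast
  then obtain \<O> where \<O>: "\<And>j. j \<le> N \<Longrightarrow> pairwise disjnt (\<O> j)"
    "\<And>j W. j \<le> N \<Longrightarrow> W \<in> \<O> j \<Longrightarrow> openin E.Y W \<and> (\<exists>U\<in>\<U>. W \<subseteq> U)"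
    "(\<Union>j\<le>N. \<Union>(\<O> j)) = topspace E.Y"
    using colorable_topspaceD[OF E.normal_Y col, of \<U>] by (auto simp: \<U>_def)
  define R where "R V = {z \<in> topspace E. E.q z \<in> V}" for V
  have R: "openin E (R V)" if "openin E.Y V" for V
    unfolding R_def using E.continuous_q that by (rule openin_continuous_map_preimage)
  show ?thesis
  proof (rule TC_le[where U = "\<lambda>j. \<Union>(R ` \<O> j)"])
    show "(\<Union>i<Suc N. \<Union> (R ` \<O> i)) = topspace E"
    proof (intro subset_antisym subsetI)
      fix z assume z: "z \<in> topspace E"
      then have "E.q z \<in> (\<Union>j\<le>N. \<Union>(\<O> j))" unfolding \<O>(3) by (auto simp: E.topspace_Y)
      then obtain j V where "j \<le> N" "V \<in> \<O> j" "E.q z \<in> V" by auto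
      then show "z \<in> (\<Union>i<Suc N. \<Union> (R ` \<O> i))" using z unfolding R_def by (auto simp: less_Suc_eq_le)
    qed (auto simp: R_def)
    fix i assume "i < Suc N"
    then have i: "i \<le> N" by simp
    show "openin E (\<Union> (R ` \<O> i))" using \<O>(2)[OF i] R by (intro openin_Union) blast
    show "homotopic_with (\<lambda>_. True) (subtopology E (\<Union> (R ` \<O> i))) X fst snd"
    proof (rule homotopic_with_Union_disjoint_open)
      show "pairwise disjnt (R ` \<O> i)"
        by (rule pairwise_imageI) (use \<O>(1)[OF i] in \<open>auto simp: pairwise_def disjnt_def R_def\<close>)
      fix A assume "A \<in> R ` \<O> i"
      then obtain W U where W: "A = R W" "openin E.Y W" "U \<in> \<U>" "W \<subseteq> U" using \<O>(2)[OF i] by blast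
      then show "openin E A" using R by blast
      have 1: "homotopic_with (\<lambda>_. True) (subtopology E (R U)) X fst snd" using W(3) by (simp add: \<U>_def R_def)
      have "continuous_map (subtopology E A) (subtopology E (R U)) (\<lambda>z. z)"
        using W(1,4) by (intro continuous_map_into_subtopology continuous_map_from_subtopology) (auto simp: R_def)
      from homotopic_with_compose_continuous_map_right[OF 1 this]
      show "homotopic_with (\<lambda>_. True) (subtopology E A) X fst snd" by (simp add: o_def)
    qed
  qed
qed

text \<open>The map \<open>\<sigma>\<close> moves the component with trivial stabiliser to the first place.\<close>
lemma free_slice:
  fixes \<sigma> :: "'b \<times> 'b \<Rightarrow> 'b \<times> 'b"
  assumes \<sigma>: "\<sigma> = (\<lambda>z. z) \<or> \<sigma> = prod.swap" and z: "z \<in> topspace E"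
    and charts: "\<And>y. y \<in> topspace X \<Longrightarrow> \<exists>U p. y \<in> U \<and> is_chart n X (U, p)"
    and tube: "linear_tube G T X \<phi> (fst (\<sigma> z)) {\<one>\<^bsub>G\<^esub>} k \<rho> f" and N: "k + n \<le> N"
  obtains W S \<gamma> V K where "z \<in> W" "E.slice W S \<gamma>" "contractible_space (subtopology E S)"
    "openin E.Y V" "E.q z \<in> V" "V \<subseteq> K" "colorable E.Y N K"
proof -
  interpret group G by (rule group_G)
  let ?V = "topspace (Euclidean_space k)"
  have \<sigma>\<sigma>: "\<sigma> (\<sigma> e) = e" for e using \<sigma> by auto
  have \<sigma>E: "\<sigma> e \<in> topspace E" if "e \<in> topspace E" for e using \<sigma> that by auto
  have \<sigma>c: "continuous_map E E \<sigma>"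
  proof -
    have "continuous_map E E (\<lambda>p. (snd p, fst p))"
      by (intro continuous_map_pairedI continuous_map_fst continuous_map_snd)
    then have "continuous_map E E prod.swap" by (rule continuous_map_eq) auto
    then show ?thesis using \<sigma> by auto
  qed
  define a where "a e = fst (\<sigma> e)" for e
  define b where "b e = snd (\<sigma> e)" for e
  have ab: "\<sigma> e = (a e, b e)" for e by (simp add: a_def b_def)
  have aX: "a e \<in> topspace X" "b e \<in> topspace X" if "e \<in> topspace E" for e
    using \<sigma>E[OF that] ab[of e] by auto
  have ac: "continuous_map E X a" "continuous_map E X b"
    using continuous_map_compose[OF \<sigma>c continuous_map_fst] continuous_map_compose[OF \<sigma>c continuous_map_snd]
    by (simp_all add: o_def a_def[abs_def] b_def[abs_def])
  have \<sigma>\<delta>: "\<sigma> (\<delta> g e) = (\<phi> g (a e), \<phi> g (b e))" if "e \<in> topspace E" for g e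
    using \<sigma> that by (cases e) (auto simp: diagonal_apply a_def b_def)
  have \<delta>\<sigma>: "\<delta> g (\<sigma> (x, y)) = \<sigma> (\<phi> g x, \<phi> g y)" if "x \<in> topspace X" "y \<in> topspace X" for g x y
    using \<sigma> that by (auto simp: diagonal_apply)
  obtain U F \<kappa> \<nu> where U: "openin X U" "a z \<in> U"
    and F: "continuous_map (prod_topology T (Euclidean_space k)) X F"
    and \<kappa>: "continuous_map (subtopology X U) T \<kappa>" and \<nu>: "continuous_map (subtopology X U) (Euclidean_space k) \<nu>"
    and FU: "\<And>u. u \<in> U \<Longrightarrow> F (\<kappa> u, \<nu> u) = u"
    and \<kappa>F: "\<And>g v. g \<in> carrier G \<Longrightarrow> v \<in> ?V \<Longrightarrow> F (g, v) \<in> U \<and> \<kappa> (F (g, v)) = g \<and> \<nu> (F (g, v)) = v"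
    and Fm: "\<And>g h v. g \<in> carrier G \<Longrightarrow> h \<in> carrier G \<Longrightarrow> v \<in> ?V \<Longrightarrow> F (g \<otimes>\<^bsub>G\<^esub> h, v) = \<phi> g (F (h, v))"
    using free_tube[OF tube refl] aX(1)[OF z] unfolding a_def by blast
  have UX: "U \<subseteq> topspace X" using U(1) by (rule openin_subset)
  have tU: "topspace (subtopology X U) = U" using UX by auto
  have \<kappa>G: "\<kappa> u \<in> carrier G" and \<nu>V: "\<nu> u \<in> ?V" if "u \<in> U" for u
    using \<kappa> \<nu> that tU topspace_T unfolding continuous_map_def by blast+
  have \<kappa>\<phi>: "\<phi> g u \<in> U \<and> \<kappa> (\<phi> g u) = g \<otimes>\<^bsub>G\<^esub> \<kappa> u \<and> \<nu> (\<phi> g u) = \<nu> u" if "g \<in> carrier G" "u \<in> U" for g u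
  proof -
    have "F (g \<otimes>\<^bsub>G\<^esub> \<kappa> u, \<nu> u) = \<phi> g u" using Fm[OF that(1) \<kappa>G[OF that(2)] \<nu>V[OF that(2)]] FU[OF that(2)] by simp
    then show ?thesis using \<kappa>F[OF m_closed[OF that(1) \<kappa>G[OF that(2)]] \<nu>V[OF that(2)]] by simp
  qed
  define \<gamma> where "\<gamma> e = \<kappa> (a e)" for e
  define \<beta> where "\<beta> e = \<phi> (inv\<^bsub>G\<^esub> (\<gamma> e)) (b e)" for e
  have "\<beta> z \<in> topspace X" unfolding \<beta>_def \<gamma>_def using \<kappa>G[OF U(2)] aX(2)[OF z] by (simp add: act_closed)
  then obtain Uc p where ch: "\<beta> z \<in> Uc" "is_chart n X (Uc, p)" using charts by blast
  obtain B C where B: "openin X B" "\<beta> z \<in> B" "B \<subseteq> C" "C \<subseteq> Uc" "compactin X C"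
    "contractible_space (subtopology X B)"
    and pc: "\<And>i. continuous_map (subtopology X Uc) euclideanreal (\<lambda>x. p x i)"
    and pinj: "\<And>a b. a \<in> Uc \<Longrightarrow> b \<in> Uc \<Longrightarrow> (\<And>i. i < n \<Longrightarrow> p a i = p b i) \<Longrightarrow> a = b"
    using chart_cube[OF ch(2,1)] by blast
  have CX: "C \<subseteq> topspace X" using B(5) by (rule compactin_subset_topspace)
  have BX: "B \<subseteq> topspace X" using B(1) by (rule openin_subset)
  define W1 where "W1 = {e \<in> topspace E. a e \<in> U}"
  define W where "W = {e \<in> topspace (subtopology E W1). \<beta> e \<in> B}"
  have W1: "openin E W1" unfolding W1_def using ac(1) U(1) by (rule openin_continuous_map_preimage)
  have aW1: "continuous_map (subtopology E W1) (subtopology X U) a"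
    using ac(1) by (intro continuous_map_into_subtopology continuous_map_from_subtopology) (auto simp: W1_def)
  have \<gamma>W1: "continuous_map (subtopology E W1) T \<gamma>"
    using continuous_map_compose[OF aW1 \<kappa>] by (simp add: o_def \<gamma>_def[abs_def])
  have \<beta>W1: "continuous_map (subtopology E W1) X \<beta>"
    unfolding \<beta>_def[abs_def]
    by (intro continuous_map_act continuous_map_minv \<gamma>W1 continuous_map_from_subtopology ac)
  have "openin (subtopology E W1) W" unfolding W_def using \<beta>W1 B(1) by (rule openin_continuous_map_preimage)
  then have W: "openin E W" using W1 by (rule openin_trans_full)
  have WD: "e \<in> W \<longleftrightarrow> e \<in> topspace E \<and> a e \<in> U \<and> \<beta> e \<in> B" for e by (auto simp: W_def W1_def)
  \<comment> \<open>The slice is a product: the free component has group coordinate one, the other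
    runs through the chart cube B.\<close>
  define S where "S = (\<lambda>(v, y). \<sigma> (F (\<one>\<^bsub>G\<^esub>, v), y)) ` (?V \<times> B)"
  have FX: "F (\<one>\<^bsub>G\<^esub>, v) \<in> U" "\<kappa> (F (\<one>\<^bsub>G\<^esub>, v)) = \<one>\<^bsub>G\<^esub>" "\<nu> (F (\<one>\<^bsub>G\<^esub>, v)) = v" if "v \<in> ?V" for v
    using \<kappa>F[OF one_closed that] by auto
  have sE: "\<sigma> (F (\<one>\<^bsub>G\<^esub>, v), y) \<in> topspace E" if "v \<in> ?V" "y \<in> topspace X" for v y
    using FX[OF that(1)] UX that(2) by (intro \<sigma>E) auto
  have SW: "\<sigma> (F (\<one>\<^bsub>G\<^esub>, v), y) \<in> W" if "v \<in> ?V" "y \<in> B" for v y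
  proof -
    have "y \<in> topspace X" using that(2) BX by blast
    then show ?thesis
      unfolding WD using FX[OF that(1)] sE[OF that(1)] that(2) by (simp add: \<beta>_def \<gamma>_def a_def b_def \<sigma>\<sigma> act_one)
  qed
  have reduce: "\<delta> (inv\<^bsub>G\<^esub> (\<gamma> e)) e = \<sigma> (F (\<one>\<^bsub>G\<^esub>, \<nu> (a e)), \<beta> e)" if e: "e \<in> topspace E" "a e \<in> U" for e
  proof -
    have g: "\<gamma> e \<in> carrier G" using \<kappa>G[OF e(2)] by (simp add: \<gamma>_def)
    have "\<phi> (inv\<^bsub>G\<^esub> (\<gamma> e)) (a e) = F (inv\<^bsub>G\<^esub> (\<gamma> e) \<otimes>\<^bsub>G\<^esub> \<gamma> e, \<nu> (a e))"
      using Fm[OF inv_closed[OF g] g \<nu>V[OF e(2)]] FU[OF e(2)] by (simp add: \<gamma>_def)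
    then have "\<phi> (inv\<^bsub>G\<^esub> (\<gamma> e)) (a e) = F (\<one>\<^bsub>G\<^esub>, \<nu> (a e))" using g by simp
    then show ?thesis
      using \<delta>\<sigma>[OF aX[OF e(1)], of "inv\<^bsub>G\<^esub> (\<gamma> e)"] by (simp add: \<beta>_def ab[symmetric] \<sigma>\<sigma>)
  qed
  have equivariant: "\<delta> g e \<in> W \<and> \<gamma> (\<delta> g e) = g \<otimes>\<^bsub>G\<^esub> \<gamma> e" if g: "g \<in> carrier G" and e: "e \<in> W" for g e
  proof -
    have eE: "e \<in> topspace E" "a e \<in> U" "\<beta> e \<in> B" using e unfolding WD by auto
    have ad: "a (\<delta> g e) = \<phi> g (a e)" "b (\<delta> g e) = \<phi> g (b e)" using \<sigma>\<delta>[OF eE(1)] by (simp_all add: a_def b_def)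
    have ga: "\<gamma> e \<in> carrier G" using \<kappa>G[OF eE(2)] by (simp add: \<gamma>_def)
    have \<gamma>: "\<gamma> (\<delta> g e) = g \<otimes>\<^bsub>G\<^esub> \<gamma> e" using \<kappa>\<phi>[OF g eE(2)] ad by (simp add: \<gamma>_def)
    have "\<beta> (\<delta> g e) = \<phi> (inv\<^bsub>G\<^esub> (\<gamma> e) \<otimes>\<^bsub>G\<^esub> inv\<^bsub>G\<^esub> g) (\<phi> g (b e))"
      unfolding \<beta>_def \<gamma> using g ga ad by (simp add: inv_mult_group)
    also have "\<dots> = \<beta> e" using g ga aX(2)[OF eE(1)] by (simp add: \<beta>_def act_mult act_closed act_inv)
    finally show ?thesis unfolding WD using \<gamma> eE \<kappa>\<phi>[OF g eE(2)] ad E.act_closed[OF g eE(1)] by simp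
  qed
  have slice: "E.slice W S \<gamma>"
    unfolding E.slice_def
  proof (intro conjI ballI)
    show "openin E W" by (rule W)
    show "S \<subseteq> W" unfolding S_def using SW by auto
    show "continuous_map (subtopology E W) T \<gamma>"
      using \<gamma>W1 by (rule continuous_map_from_subtopology_mono) (auto simp: W_def)
    show "\<delta> (inv\<^bsub>G\<^esub> (\<gamma> e)) e \<in> S" if "e \<in> W" for e
      using reduce[of e] \<nu>V[of "a e"] that unfolding WD S_def by auto
    show "\<delta> g e \<in> W" "\<gamma> (\<delta> g e) = g \<otimes>\<^bsub>G\<^esub> \<gamma> e" if "g \<in> carrier G" "e \<in> W" for g e
      using equivariant[OF that] by auto
  qed
  have r: "continuous_map (prod_topology (Euclidean_space k) Q) E (\<lambda>(v, y). \<sigma> (F (\<one>\<^bsub>G\<^esub>, v), y))"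
    if Q: "continuous_map Q X (\<lambda>y. y)" for Q
  proof -
    have 1: "continuous_map (prod_topology (Euclidean_space k) Q) (prod_topology T (Euclidean_space k)) (\<lambda>w. (\<one>\<^bsub>G\<^esub>, fst w))"
      using topspace_T by (intro continuous_map_pairedI continuous_map_fst) simp
    have 2: "continuous_map (prod_topology (Euclidean_space k) Q) X snd"
      using continuous_map_compose[OF continuous_map_snd Q] by (simp add: o_def)
    have "continuous_map (prod_topology (Euclidean_space k) Q) E (\<lambda>w. (F (\<one>\<^bsub>G\<^esub>, fst w), snd w))"
      using continuous_map_compose[OF 1 F] 2 by (intro continuous_map_pairedI) (simp_all add: o_def)
    from continuous_map_compose[OF this \<sigma>c] show ?thesis by (simp add: o_def case_prod_unfold)
  qed
  have S: "contractible_space (subtopology E S)"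
  proof (rule contractible_space_continuous_inverse)
    show "contractible_space (prod_topology (Euclidean_space k) (subtopology X B))"
      using B(6) by (simp add: contractible_space_prod_topology)
    have "continuous_map (prod_topology (Euclidean_space k) (subtopology X B)) E (\<lambda>(v, y). \<sigma> (F (\<one>\<^bsub>G\<^esub>, v), y))"
      by (rule r) (simp add: continuous_map_from_subtopology)
    then show "continuous_map (prod_topology (Euclidean_space k) (subtopology X B)) (subtopology E S) (\<lambda>(v, y). \<sigma> (F (\<one>\<^bsub>G\<^esub>, v), y))"
      by (rule continuous_map_into_subtopology) (auto simp: S_def)
    have SW1: "S \<subseteq> W1" using E.sliceD(2)[OF slice] by (auto simp: W_def)
    have "continuous_map (subtopology E S) (Euclidean_space k) (\<lambda>e. \<nu> (a e))"
      using continuous_map_from_subtopology_mono[OF continuous_map_compose[OF aW1 \<nu>] SW1] by (simp add: o_def)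
    moreover have "continuous_map (subtopology E S) (subtopology X B) b"
      using ac(2) by (intro continuous_map_into_subtopology continuous_map_from_subtopology) (auto simp: S_def b_def \<sigma>\<sigma>)
    ultimately show "continuous_map (subtopology E S) (prod_topology (Euclidean_space k) (subtopology X B)) (\<lambda>e. (\<nu> (a e), b e))"
      by (rule continuous_map_pairedI)
    fix e assume "e \<in> topspace (subtopology E S)"
    then obtain v y where "v \<in> ?V" "y \<in> B" "e = \<sigma> (F (\<one>\<^bsub>G\<^esub>, v), y)" unfolding S_def by auto
    then show "(case (\<nu> (a e), b e) of (v, y) \<Rightarrow> \<sigma> (F (\<one>\<^bsub>G\<^esub>, v), y)) = e"
      using FX by (simp add: a_def b_def \<sigma>\<sigma>)
  qed
  define c where "c = \<nu> (a z)"
  \<comment> \<open>Cutting down to a closed cube around c makes the domain compact; any positive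
    radius would do.\<close>
  define D where "D = subtopology (prod_topology (Euclidean_space k) X) (closed_cube k c 1 \<times> C)"
  have cV: "c \<in> ?V" unfolding c_def by (rule \<nu>V[OF U(2)])
  have DV: "closed_cube k c 1 \<subseteq> ?V" by (auto simp: closed_cube_def)
  have tD: "topspace D = closed_cube k c 1 \<times> C" using DV CX by (auto simp: D_def)
  define Q where "Q w = E.q (\<sigma> (F (\<one>\<^bsub>G\<^esub>, fst w), snd w))" for w
  \<comment> \<open>The first k coordinates come from the slice and the next n from the chart; zeros
    fill up to N, which may exceed k + n.\<close>
  define \<epsilon> where "\<epsilon> i w = (if i < k then fst w i else if i < k + n then p (snd w) (i - k) else 0)" for i and w :: "(nat \<Rightarrow> real) \<times> 'b"
  have "colorable E.Y N (Q ` topspace D)"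
  proof (rule colorable_coordinates[OF _ _ E.Hausdorff_Y])
    show "compact_space D"
      unfolding D_def using compactin_closed_cube B(5) by (intro compact_space_subtopology) (simp add: compactin_Times)
    have "continuous_map D E (\<lambda>(v, y). \<sigma> (F (\<one>\<^bsub>G\<^esub>, v), y))"
      unfolding D_def by (intro continuous_map_from_subtopology r) simp
    from continuous_map_compose[OF this E.continuous_q] show "continuous_map D E.Y Q"
      by (simp add: o_def Q_def[abs_def] case_prod_unfold)
    have 1: "continuous_map D euclideanreal (\<lambda>w. fst w i)" for i
      unfolding D_def using continuous_map_compose[OF continuous_map_fst continuous_map_Euclidean_coordinate]
      by (intro continuous_map_from_subtopology) (simp add: o_def)
    have "continuous_map D (subtopology X Uc) snd"
      using B(4) tD unfolding D_def
      by (intro continuous_map_into_subtopology continuous_map_from_subtopology continuous_map_snd) auto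
    from continuous_map_compose[OF this pc] have 2: "continuous_map D euclideanreal (\<lambda>w. p (snd w) i)" for i
      by (simp add: o_def)
    show "continuous_map D euclideanreal (\<epsilon> i)" for i
      unfolding \<epsilon>_def[abs_def] using 1 2 by (cases "i < k"; cases "i < k + n") simp_all
    fix w w' assume w: "w \<in> topspace D" "w' \<in> topspace D"
    obtain v y v' y' where vy: "w = (v, y)" "w' = (v', y')" by (cases w; cases w') auto
    have v: "v \<in> ?V" "v' \<in> ?V" and y: "y \<in> C" "y' \<in> C" using w vy tD DV by auto
    have yX: "y \<in> topspace X" "y' \<in> topspace X" using y CX by auto
    have iff: "w = w' \<longleftrightarrow> (\<forall>i<N. \<epsilon> i w = \<epsilon> i w')"
    proof
      assume *: "\<forall>i<N. \<epsilon> i w = \<epsilon> i w'"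
      have "v i = v' i" if "i < k" for i
        using *[rule_format, of i] that N by (simp add: \<epsilon>_def vy)
      then have "v = v'" using v by (intro Euclidean_space_eqI)
      moreover have "p y i = p y' i" if "i < n" for i
        using *[rule_format, of "k + i"] that N by (simp add: \<epsilon>_def vy)
      then have "y = y'" using y B(4) by (intro pinj) auto
      ultimately show "w = w'" by (simp add: vy)
    qed simp
    have "w = w'" if "Q w = Q w'"
    proof -
      have "E.q (\<sigma> (F (\<one>\<^bsub>G\<^esub>, v), y)) = E.q (\<sigma> (F (\<one>\<^bsub>G\<^esub>, v'), y'))" using that by (simp add: Q_def vy)
      then obtain g where g: "g \<in> carrier G" "\<sigma> (F (\<one>\<^bsub>G\<^esub>, v'), y') = \<delta> g (\<sigma> (F (\<one>\<^bsub>G\<^esub>, v), y))"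
        using E.q_eq_iff[OF sE[OF v(1) yX(1)] sE[OF v(2) yX(2)]] by auto
      have FvX: "F (\<one>\<^bsub>G\<^esub>, v) \<in> topspace X" using FX(1)[OF v(1)] UX by blast
      have "\<sigma> (F (\<one>\<^bsub>G\<^esub>, v'), y') = \<sigma> (\<phi> g (F (\<one>\<^bsub>G\<^esub>, v)), \<phi> g y)"
        using g(2) \<delta>\<sigma>[OF FvX yX(1)] by simp
      then have "\<sigma> (\<sigma> (F (\<one>\<^bsub>G\<^esub>, v'), y')) = \<sigma> (\<sigma> (\<phi> g (F (\<one>\<^bsub>G\<^esub>, v)), \<phi> g y))" by simp
      then have eq: "F (\<one>\<^bsub>G\<^esub>, v') = \<phi> g (F (\<one>\<^bsub>G\<^esub>, v))" "y' = \<phi> g y" unfolding \<sigma>\<sigma> by auto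
      \<comment> \<open>Both slice points have group coordinate one, so the element g joining them
        is the identity, and equal orbits mean equal points.\<close>
      have "F (\<one>\<^bsub>G\<^esub>, v') = F (g, v)" using eq(1) Fm[OF g(1) one_closed v(1)] g(1) by simp
      then have "\<one>\<^bsub>G\<^esub> = g" and "v' = v" using FX[OF v(2)] \<kappa>F[OF g(1) v(1)] by simp_all
      moreover have "y' = y" using eq(2) \<open>\<one>\<^bsub>G\<^esub> = g\<close>[symmetric] act_one[OF yX(1)] by simp
      ultimately show ?thesis by (simp add: vy)
    qed
    then show "Q w = Q w' \<longleftrightarrow> (\<forall>i<N. \<epsilon> i w = \<epsilon> i w')" using iff by blast
  qed
  \<comment> \<open>The pairs of W whose slice coordinate lies in the open cube; the image of this
    open set is the neighbourhood V of the conclusion.\<close>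
  moreover define O' where "O' = {e \<in> topspace (subtopology E W). \<nu> (a e) \<in> open_cube k c 1}"
  have "openin E O'"
  proof (rule openin_trans_full[OF _ W])
    have "continuous_map (subtopology E W1) (Euclidean_space k) (\<lambda>e. \<nu> (a e))"
      using continuous_map_compose[OF aW1 \<nu>] by (simp add: o_def)
    then have "continuous_map (subtopology E W) (Euclidean_space k) (\<lambda>e. \<nu> (a e))"
      by (rule continuous_map_from_subtopology_mono) (auto simp: W_def)
    then show "openin (subtopology E W) O'"
      unfolding O'_def using openin_open_cube by (rule openin_continuous_map_preimage)
  qed
  then have "openin E.Y (E.q ` O')" by (rule E.open_q_image)
  moreover have "E.q ` O' \<subseteq> Q ` topspace D"
  proof
    fix y assume "y \<in> E.q ` O'"
    then obtain e where e: "e \<in> W" "\<nu> (a e) \<in> open_cube k c 1" "y = E.q e" by (auto simp: O'_def)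
    have eE: "e \<in> topspace E" "a e \<in> U" "\<beta> e \<in> B" using e unfolding WD by auto
    have "\<gamma> e \<in> carrier G" using \<kappa>G[OF eE(2)] by (simp add: \<gamma>_def)
    then have "y = E.q (\<delta> (inv\<^bsub>G\<^esub> (\<gamma> e)) e)" using e(3) eE(1) E.q_act inv_closed by metis
    then have "y = Q (\<nu> (a e), \<beta> e)" unfolding reduce[OF eE(1,2)] Q_def by simp
    moreover have "(\<nu> (a e), \<beta> e) \<in> topspace D"
      using e(2) eE(3) B(3) open_cube_subset_closed_cube unfolding tD by blast
    ultimately show "y \<in> Q ` topspace D" by blast
  qed
  moreover have zW: "z \<in> W" unfolding WD using z U(2) B(2) by simp
  moreover have "z \<in> O'" unfolding O'_def using zW z cV by (simp add: open_cube_def c_def)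
  then have "E.q z \<in> E.q ` O'" by (rule imageI)
  ultimately show thesis by (intro that[OF zW slice S])
qed

end

section \<open>Fixed points\<close>

context compact_group_action
begin

definition Fix where
  "Fix = {x \<in> topspace X. \<forall>g\<in>carrier G. \<phi> g x = x}"

lemma closedin_Fix: "closedin X Fix"
proof -
  interpret group G by (rule group_G)
  have "Fix = (\<Inter>g\<in>carrier G. {x \<in> topspace X. \<phi> g x = x})"
    using one_closed by (auto simp: Fix_def)
  also have "closedin X \<dots>"
  proof (intro closedin_INT)
    show "carrier G \<noteq> {}" using one_closed by blast
    fix g assume "g \<in> carrier G"
    then have "continuous_map X X (\<lambda>x. \<phi> g x)"
      using topspace_T continuous_map_id[unfolded id_def] by (intro continuous_map_act) simp_all
    with Hausdorff_X show "closedin X {x \<in> topspace X. \<phi> g x = x}"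
      using continuous_map_id[unfolded id_def] by (intro closedin_continuous_maps_eq)
  qed
  finally show ?thesis .
qed

lemma stabilizer_Fix: "x \<in> Fix \<Longrightarrow> stabilizer G \<phi> x = carrier G"
  by (auto simp: Fix_def stabilizer_def)

lemma stabilizer_eq_carrier_imp_Fix: "x \<in> topspace X \<Longrightarrow> stabilizer G \<phi> x = carrier G \<Longrightarrow> x \<in> Fix"
  by (auto simp: Fix_def stabilizer_def)

text \<open>
  In a linear tube about a fixed point the fixed points form a linear subspace, so if they contain an
  open set, they are the whole tube.
\<close>
lemma Fix_interior_empty:
  assumes ls: "locally_smooth_action G T X \<phi>" and conn: "connected_space X"
    and nt: "nontrivial_action G X \<phi>" and W: "openin X W" "W \<subseteq> Fix"
  shows "W = {}"
proof -
  \<comment> \<open>The interior of \<open>Fix\<close>. It turns out to be closed as well, so by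
    connectedness it is empty or everything, and the latter contradicts non-triviality.\<close>
  define I where "I = \<Union>{A. openin X A \<and> A \<subseteq> Fix}"
  have Io: "openin X I" unfolding I_def by (intro openin_Union) blast
  have IF: "I \<subseteq> Fix" unfolding I_def by blast
  have IA: "A \<subseteq> I" if "openin X A" "A \<subseteq> Fix" for A unfolding I_def using that by blast
  have "\<exists>A. openin X A \<and> y \<in> A \<and> A \<subseteq> topspace X - I" if y: "y \<in> topspace X - I" for y
  proof (cases "y \<in> Fix")
    case False
    have "openin X (topspace X - Fix)" using closedin_Fix by blast
    then show ?thesis using False y IF by (intro exI[of _ "topspace X - Fix"]) blast
  next
    case True
    obtain k \<rho> f where "linear_tube G T X \<phi> y (stabilizer G \<phi> y) k \<rho> f"
      using ls y unfolding locally_smooth_action_def by blast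
    then have lt: "linear_tube G T X \<phi> y (carrier G) k \<rho> f" unfolding stabilizer_Fix[OF True] .
    let ?V = "topspace (Euclidean_space k)"
    have fy: "y \<in> topspace X" "\<And>g. g \<in> carrier G \<Longrightarrow> \<phi> g y = y" using True by (auto simp: Fix_def)
    obtain U F \<nu> where U: "openin X U" "y \<in> U"
      and F: "continuous_map (Euclidean_space k) X F" and \<nu>: "continuous_map (subtopology X U) (Euclidean_space k) \<nu>"
      and F\<nu>: "\<And>u. u \<in> U \<Longrightarrow> F (\<nu> u) = u"
      and \<nu>F: "\<And>v. v \<in> ?V \<Longrightarrow> F v \<in> U \<and> \<nu> (F v) = v"
      and F\<rho>: "\<And>g v. g \<in> carrier G \<Longrightarrow> v \<in> ?V \<Longrightarrow> \<phi> g (F v) = F (\<rho> g v)"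
      using fixed_tube[OF lt refl fy] by metis
    have UX: "U \<subseteq> topspace X" using U(1) by (rule openin_subset)
    have orep: "orthogonal_representation G T (carrier G) k \<rho>" using lt by (simp add: linear_tube_def)
    have \<rho>V: "\<rho> g v \<in> ?V" if "g \<in> carrier G" "v \<in> ?V" for g v
      using group_action.element_image[OF group_action_subgroup_restrict[OF orep]] that by simp
    have lin: "\<rho> g (\<lambda>i. a * v i + b * w i) = (\<lambda>i. a * \<rho> g v i + b * \<rho> g w i)"
      if "g \<in> carrier G" "v \<in> ?V" "w \<in> ?V" for g v w a b
      using orep that unfolding orthogonal_representation_def by blast
    have "U \<inter> I = {}"
    proof (rule ccontr)
      assume "U \<inter> I \<noteq> {}"
      then obtain u A where u: "u \<in> U" "u \<in> A" "openin X A" "A \<subseteq> Fix" unfolding I_def by blast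
      define v0 where "v0 = \<nu> u"
      have v0: "v0 \<in> ?V" "F v0 = u"
        using \<nu> u(1) UX F\<nu>[OF u(1)] unfolding v0_def continuous_map_def by auto
      have fixV: "\<rho> g v = v" if "v \<in> ?V" "F v \<in> Fix" "g \<in> carrier G" for v g
      proof -
        have "F (\<rho> g v) = F v" using F\<rho>[OF that(3,1)] that(2,3) by (simp add: Fix_def)
        then show ?thesis using \<nu>F[OF that(1)] \<nu>F[OF \<rho>V[OF that(3,1)]] by metis
      qed
      have "F v \<in> Fix" if v: "v \<in> ?V" for v
      proof -
        \<comment> \<open>The line through v0 in direction v. For some small t \<noteq> 0 both v0
          and \<open>\<tau> t\<close> are invariant, and linearity then makes v invariant. The
          factor 1 matches the shape of \<open>lin\<close>.\<close>
        define \<tau> where "\<tau> t = (\<lambda>i. 1 * v0 i + t * v i)" for t :: real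
        have \<tau>V: "\<tau> t \<in> ?V" for t using v0(1) v by (simp add: \<tau>_def topspace_Euclidean_space)
        have "continuous_map euclideanreal (Euclidean_space k) \<tau>"
          unfolding Euclidean_space_def
        proof (rule continuous_map_into_subtopology)
          show "continuous_map euclideanreal (powertop_real UNIV) \<tau>"
            unfolding continuous_map_componentwise_UNIV \<tau>_def
            by (auto intro!: continuous_intros)
          show "\<tau> \<in> topspace euclideanreal \<rightarrow> {x. \<forall>i\<ge>k. x i = 0}"
            using \<tau>V by (simp add: topspace_Euclidean_space)
        qed
        from continuous_map_compose[OF this F] have "continuous_map euclideanreal X (\<lambda>t. F (\<tau> t))" by (simp add: o_def)
        from openin_continuous_map_preimage[OF this u(3)] have op: "open {t. F (\<tau> t) \<in> A}" by simp
        have "\<tau> 0 = v0" by (simp add: \<tau>_def)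
        then have "0 \<in> {t. F (\<tau> t) \<in> A}" using u(2) v0(2) by simp
        with op obtain e where e: "e > 0" "ball 0 e \<subseteq> {t. F (\<tau> t) \<in> A}" using open_contains_ball by blast
        define t where "t = e / 2"
        have "t \<in> ball 0 e" using e(1) by (simp add: t_def)
        then have "F (\<tau> t) \<in> A" using e(2) by blast
        then have t: "t \<noteq> 0" "F (\<tau> t) \<in> Fix" using e(1) u(4) by (auto simp: t_def)
        have "\<rho> g v = v" if g: "g \<in> carrier G" for g
        proof -
          have "\<rho> g v0 = v0" using v0 u(2,4) g by (intro fixV) auto
          then have "\<rho> g (\<tau> t) = (\<lambda>i. 1 * v0 i + t * \<rho> g v i)" unfolding \<tau>_def using lin[OF g v0(1) v, of 1 t] by simp
          moreover have "\<rho> g (\<tau> t) = \<tau> t" using \<tau>V t(2) g by (rule fixV)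
          ultimately have eq: "(\<lambda>i. 1 * v0 i + t * \<rho> g v i) = \<tau> t" by simp
          have "\<rho> g v i = v i" for i using fun_cong[OF eq, of i] t(1) by (simp add: \<tau>_def)
          then show ?thesis by (rule ext)
        qed
        then show ?thesis using F\<rho> v \<nu>F[OF v] UX by (auto simp: Fix_def)
      qed
      moreover have "\<nu> w \<in> ?V" if "w \<in> U" for w
        using \<nu> that UX unfolding continuous_map_def by auto
      ultimately have "U \<subseteq> Fix" using F\<nu> by (metis subsetI)
      then show False using IA[OF U(1)] U(2) y by blast
    qed
    then show ?thesis using U UX by blast
  qed
  then have "openin X (topspace X - I)" by (subst openin_subopen) blast
  then have "closedin X I" using openin_subset[OF Io] by (simp add: closedin_def)
  then have "I = {} \<or> I = topspace X" using conn Io unfolding connected_space_clopen_in by blast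
  moreover have "I \<noteq> topspace X" using IF nt by (auto simp: nontrivial_action_def Fix_def)
  ultimately show ?thesis using IA[OF W] by blast
qed

text \<open>
  Let \<open>e\<^sub>1, \<dots>, e\<^sub>m\<close> be a maximal orthonormal system of invariant vectors.  Its coordinates determine an
  invariant vector, and \<open>m + d \<le> n\<close> because \<open>(g, u) \<mapsto> \<rho> g w\<^sub>0 + \<Sum>\<^sub>i u\<^sub>i e\<^sub>i\<close> is injective: the inner product
  of \<open>\<rho> g w\<^sub>0\<close> with an invariant vector does not depend on \<open>g\<close>.
\<close>
lemma fixed_coordinates:
  assumes orep: "orthogonal_representation G T (carrier G) k \<rho>"
    and F: "continuous_map (Euclidean_space k) X F" "inj_on F (topspace (Euclidean_space k))"
    and w0: "w0 \<in> topspace (Euclidean_space k)" "inj_on (\<lambda>g. \<rho> g w0) (carrier G)"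
    and A: "openin (Euclidean_space d) A" "A \<noteq> {}" "continuous_map (subtopology (Euclidean_space d) A) T s" "inj_on s A"
    and charts: "\<And>y. y \<in> topspace X \<Longrightarrow> \<exists>U p. y \<in> U \<and> is_chart n X (U, p)"
  obtains m l where "d + m \<le> n" "\<And>i. continuous_map (Euclidean_space k) euclideanreal (l i)"
    "\<And>v v'. v \<in> topspace (Euclidean_space k) \<Longrightarrow> v' \<in> topspace (Euclidean_space k) \<Longrightarrow>
       (\<And>g. g \<in> carrier G \<Longrightarrow> \<rho> g v = v) \<Longrightarrow> (\<And>g. g \<in> carrier G \<Longrightarrow> \<rho> g v' = v') \<Longrightarrow>
       (\<And>i. i < m \<Longrightarrow> l i v = l i v') \<Longrightarrow> v = v'"
proof -
  let ?V = "topspace (Euclidean_space k)"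
  define ip where "ip v w = (\<Sum>i<k. v i * w i)" for v w :: "nat \<Rightarrow> real"
  define VG where "VG = {v \<in> ?V. \<forall>g\<in>carrier G. \<rho> g v = v}"
  have \<rho>V: "\<rho> g v \<in> ?V" if "g \<in> carrier G" "v \<in> ?V" for g v
    using group_action.element_image[OF group_action_subgroup_restrict[OF orep]] that by simp
  have lin: "\<rho> g (\<lambda>i. a * v i + b * w i) = (\<lambda>i. a * \<rho> g v i + b * \<rho> g w i)"
    if "g \<in> carrier G" "v \<in> ?V" "w \<in> ?V" for g v w a b
    using orep that unfolding orthogonal_representation_def by blast
  have orth: "ip (\<rho> g v) (\<rho> g w) = ip v w" if "g \<in> carrier G" "v \<in> ?V" "w \<in> ?V" for g v w
    using orep that unfolding orthogonal_representation_def ip_def by blast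
  have VG_lin: "(\<lambda>i. a * v i + b * w i) \<in> VG" if "v \<in> VG" "w \<in> VG" for a b v w
    using that lin by (auto simp: VG_def topspace_Euclidean_space)
  have ip_lin: "ip (\<lambda>i. a * v i + b * w i) u = a * ip v u + b * ip w u" for a b v w u
    by (simp add: ip_def sum.distrib sum_distrib_left algebra_simps)
  have ip_0: "v = (\<lambda>_. 0)" if "v \<in> ?V" "ip v v = 0" for v
  proof -
    have "\<forall>i\<in>{..<k}. v i * v i = 0"
      using that(2) unfolding ip_def by (subst (asm) sum_nonneg_eq_0_iff) auto
    then show ?thesis using that(1) by (intro Euclidean_space_eqI) (auto simp: topspace_Euclidean_space)
  qed
  have "subtopology T (carrier G) = T" using topspace_T by (metis subtopology_topspace)
  then have rc: "continuous_map (prod_topology T (Euclidean_space k)) (Euclidean_space k) (\<lambda>(g, v). \<rho> g v)"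
    using orep by (simp add: orthogonal_representation_def continuous_action_def)
  have sG: "s w \<in> carrier G" if "w \<in> A" for w
    using A(3) that openin_subset[OF A(1)] topspace_T unfolding continuous_map_def by auto
  define ON where "ON m e \<longleftrightarrow> (\<forall>i<m. e i \<in> VG) \<and> (\<forall>i<m. \<forall>j<m. ip (e i) (e j) = (if i = j then 1 else 0))"
    for m and e :: "nat \<Rightarrow> nat \<Rightarrow> real"
  \<comment> \<open>This serves twice: as the estimate itself and as the reason why a largest
    orthonormal system exists.\<close>
  have bound: "d + m \<le> n" if ON: "ON m e" for m e
  proof -
    have eV: "e i \<in> VG" if "i < m" for i using ON that by (simp add: ON_def)
    define P where "P u = (\<lambda>j. \<Sum>i<m. u i * e i j)" for u :: "nat \<Rightarrow> real"
    have PV: "P u \<in> ?V" for u using eV by (auto simp: P_def VG_def topspace_Euclidean_space)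
    have ipP: "ip (P u) (e l) = u l" if "l < m" for u l
    proof -
      have "ip (P u) (e l) = (\<Sum>j<k. \<Sum>i<m. u i * (e i j * e l j))"
        by (simp add: ip_def P_def sum_distrib_right mult.assoc)
      also have "\<dots> = (\<Sum>i<m. u i * ip (e i) (e l))"
        by (subst sum.swap) (simp add: ip_def sum_distrib_left)
      also have "\<dots> = (\<Sum>i<m. if i = l then u i else 0)"
        using ON \<open>l < m\<close> by (intro sum.cong) (auto simp: ON_def)
      also have "\<dots> = u l" using \<open>l < m\<close> by simp
      finally show ?thesis .
    qed
    define h where "h p = F (\<lambda>j. P (snd p) j + \<rho> (s (fst p)) w0 j)" for p
    let ?D = "prod_topology (subtopology (Euclidean_space d) A) (Euclidean_space m)"
    have addV: "(\<lambda>j. P u j + \<rho> (s w) w0 j) \<in> ?V" if "w \<in> A" for u w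
      using PV[of u] \<rho>V[OF sG[OF that] w0(1)] by (simp add: topspace_Euclidean_space)
    show ?thesis
    proof (rule prod_injection_dim_le[OF A(1,2) _ _ charts])
      have 1: "continuous_map ?D euclideanreal (\<lambda>p. snd p i)" for i
        using continuous_map_compose[OF continuous_map_snd continuous_map_Euclidean_coordinate] by (simp add: o_def)
      have Peq: "P u = (\<lambda>j. if j < k then P u j else 0)" for u
        using PV[of u] by (auto simp: topspace_Euclidean_space)
      have "continuous_map ?D (Euclidean_space k) (\<lambda>p j. if j < k then P (snd p) j else 0)"
        unfolding continuous_map_componentwise_Euclidean_space P_def
        by (intro allI impI continuous_map_sum continuous_map_real_mult 1) simp_all
      then have "continuous_map ?D (Euclidean_space k) (\<lambda>p. P (snd p))"
        by (rule continuous_map_eq) (rule Peq[symmetric])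
      moreover have "continuous_map ?D (Euclidean_space k) (\<lambda>p. \<rho> (s (fst p)) w0)"
      proof -
        have "continuous_map ?D (prod_topology T (Euclidean_space k)) (\<lambda>p. (s (fst p), w0))"
          using continuous_map_compose[OF continuous_map_fst A(3)] w0(1)
          by (intro continuous_map_pairedI) (simp_all add: o_def)
        from continuous_map_compose[OF this rc] show ?thesis by (simp add: o_def)
      qed
      ultimately have "continuous_map ?D (Euclidean_space k) (\<lambda>p j. P (snd p) j + \<rho> (s (fst p)) w0 j)"
        by (rule continuous_map_Euclidean_space_add)
      from continuous_map_compose[OF this F(1)] show "continuous_map ?D X h"
        by (simp add: o_def h_def[abs_def])
      show "inj_on h (A \<times> topspace (Euclidean_space m))"
      proof (rule inj_onI)
        fix p p' assume p: "p \<in> A \<times> topspace (Euclidean_space m)" "p' \<in> A \<times> topspace (Euclidean_space m)" "h p = h p'"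
        obtain w u w' u' where wu: "p = (w, u)" "p' = (w', u')" by (cases p; cases p') auto
        have w: "w \<in> A" "w' \<in> A" and u: "u \<in> topspace (Euclidean_space m)" "u' \<in> topspace (Euclidean_space m)"
          using p wu by auto
        have eq: "(\<lambda>j. P u j + \<rho> (s w) w0 j) = (\<lambda>j. P u' j + \<rho> (s w') w0 j)"
          using p(3) addV w unfolding h_def wu by (intro inj_onD[OF F(2)]) auto
        \<comment> \<open>Pairing with \<open>e l\<close> gives u l plus a constant free of the
          group element. So u is recovered first, and then \<open>\<rho> (s w) w0\<close> and with
          it w.\<close>
        have val: "ip (\<lambda>j. P u j + \<rho> (s w) w0 j) (e l) = u l + ip w0 (e l)" if "l < m" "w \<in> A" for u w l
        proof -
          have "ip (\<rho> (s w) w0) (e l) = ip (\<rho> (s w) w0) (\<rho> (s w) (e l))"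
            using eV[OF that(1)] sG[OF that(2)] by (simp add: VG_def)
          also have "\<dots> = ip w0 (e l)" using eV[OF that(1)] sG[OF that(2)] w0(1) by (intro orth) (auto simp: VG_def)
          finally show ?thesis using ip_lin[of 1 "P u" 1 "\<rho> (s w) w0" "e l"] ipP[OF that(1)] by simp
        qed
        have "u l = u' l" if "l < m" for l using val[OF that w(1), of u] val[OF that w(2), of u'] eq by simp
        then have "u = u'" using u by (intro Euclidean_space_eqI)
        then have "\<rho> (s w) w0 = \<rho> (s w') w0" using fun_cong[OF eq] by (intro ext) simp
        then have "s w = s w'" using sG w by (intro inj_onD[OF w0(2)])
        then have "w = w'" using w by (intro inj_onD[OF A(4)])
        then show "p = p'" using wu \<open>u = u'\<close> by simp
      qed
    qed
  qed
  define m where "m = (GREATEST m. \<exists>e. ON m e)"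
  have bd: "\<And>m. \<exists>e. ON m e \<Longrightarrow> m \<le> n" using bound by (meson add_leD2)
  have "ON 0 (\<lambda>_ _. 0)" by (simp add: ON_def)
  then have ex0: "\<exists>e. ON 0 e" by blast
  have "\<exists>e. ON m e" unfolding m_def using ex0 bd by (rule GreatestI_nat)
  then obtain e where e: "ON m e" by blast
  have eV: "e i \<in> VG" if "i < m" for i using e that by (simp add: ON_def)
  have maximal: "m' \<le> m" if "ON m' e'" for m' e'
    unfolding m_def using that bd by (intro Greatest_le_nat) blast+
  have ip_comm: "ip v w = ip w v" for v w by (simp add: ip_def mult.commute)
  \<comment> \<open>A non-zero invariant vector orthogonal to the system could be normalised and
    appended, against maximality.\<close>
  have complete: "v = (\<lambda>_. 0)" if v: "v \<in> VG" "\<And>i. i < m \<Longrightarrow> ip v (e i) = 0" for v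
  proof (rule ccontr)
    assume "v \<noteq> (\<lambda>_. 0)"
    then have "ip v v \<noteq> 0" using ip_0 v(1) by (auto simp: VG_def)
    moreover have "ip v v \<ge> 0" unfolding ip_def by (intro sum_nonneg) simp
    ultimately have pos: "ip v v > 0" by simp
    define c where "c = 1 / sqrt (ip v v)"
    \<comment> \<open>The summand with factor 0 gives u the shape of a linear combination of two
      vectors, as in \<open>VG_lin\<close>.\<close>
    define u where "u = (\<lambda>i. c * v i + 0 * v i)"
    have uVG: "u \<in> VG" unfolding u_def using v(1) v(1) by (rule VG_lin)
    have ue: "ip u (e i) = 0" if "i < m" for i unfolding u_def ip_lin using v(2)[OF that] by simp
    have "ip u u = c * c * ip v v" unfolding u_def by (simp add: ip_def sum_distrib_left algebra_simps)
    also have "\<dots> = 1" using pos by (simp add: c_def)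
    finally have uu: "ip u u = 1" .
    have "ON (Suc m) (e(m := u))"
      unfolding ON_def
    proof (intro conjI allI impI)
      show "(e(m := u)) i \<in> VG" if "i < Suc m" for i
        using that uVG eV[of i] by (cases "i = m") simp_all
      fix i j assume ij: "i < Suc m" "j < Suc m"
      have ee: "ip (e i) (e j) = (if i = j then 1 else 0)" if "i < m" "j < m"
        using e that unfolding ON_def by blast
      consider "i = m" "j = m" | "i = m" "j < m" | "i < m" "j = m" | "i < m" "j < m" using ij by linarith
      then show "ip ((e(m := u)) i) ((e(m := u)) j) = (if i = j then 1 else 0)"
        using ue[of i] ue[of j] uu ip_comm[of "e i" u] ee by cases simp_all
    qed
    from maximal[OF this] show False by simp
  qed
  show thesis
  proof (rule that[of m "\<lambda>i v. ip v (e i)"])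
    show "d + m \<le> n" using bound[OF e] .
    show "continuous_map (Euclidean_space k) euclideanreal (\<lambda>v. ip v (e i))" for i
      unfolding ip_def
      by (intro continuous_map_sum continuous_map_real_mult continuous_map_Euclidean_coordinate) simp_all
    fix v v' assume v: "v \<in> ?V" "v' \<in> ?V" "\<And>g. g \<in> carrier G \<Longrightarrow> \<rho> g v = v" "\<And>g. g \<in> carrier G \<Longrightarrow> \<rho> g v' = v'"
      "\<And>i. i < m \<Longrightarrow> ip v (e i) = ip v' (e i)"
    have vG: "v \<in> VG" "v' \<in> VG" using v by (auto simp: VG_def)
    \<comment> \<open>Invariant vectors with equal coordinates have a difference that is orthogonal
      to the system, hence zero.\<close>
    have "(\<lambda>i. 1 * v i + (- 1) * v' i) = (\<lambda>_. 0)"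
    proof (rule complete)
      show "(\<lambda>i. 1 * v i + (- 1) * v' i) \<in> VG" by (rule VG_lin[OF vG])
      show "ip (\<lambda>i. 1 * v i + (- 1) * v' i) (e i) = 0" if "i < m" for i
        unfolding ip_lin using v(5)[OF that] by simp
    qed
    then have "1 * v i + (- 1) * v' i = 0" for i by (rule fun_cong)
    then show "v = v'" by (intro ext) (simp add: algebra_simps)
  qed
qed

text \<open>The tube about x is not contained in \<open>Fix\<close>, so by semi-freeness it contains
  a free point u, and g \<mapsto> \<open>\<rho> g (\<nu> u)\<close> is injective. This is the input
  of \<open>fixed_coordinates\<close>; the m functions obtained are asserted to separate fixed
  points only.\<close>

lemma fixed_point_chart:
  assumes ls: "locally_smooth_action G T X \<phi>" and conn: "connected_space X"
    and nt: "nontrivial_action G X \<phi>" and sf: "semi_free_action G X \<phi>"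
    and A: "openin (Euclidean_space d) A" "A \<noteq> {}" "continuous_map (subtopology (Euclidean_space d) A) T s" "inj_on s A"
    and charts: "\<And>y. y \<in> topspace X \<Longrightarrow> \<exists>U p. y \<in> U \<and> is_chart n X (U, p)"
    and x: "x \<in> Fix"
  obtains U F \<nu> k m l where "openin X U" "x \<in> U" "\<And>g u. g \<in> carrier G \<Longrightarrow> u \<in> U \<Longrightarrow> \<phi> g u \<in> U"
    "continuous_map (Euclidean_space k) X F" "continuous_map (subtopology X U) (Euclidean_space k) \<nu>"
    "\<And>u. u \<in> U \<Longrightarrow> F (\<nu> u) = u"
    "\<And>v. v \<in> topspace (Euclidean_space k) \<Longrightarrow> F v \<in> U \<and> \<nu> (F v) = v"
    "d + m \<le> n" "\<And>i. continuous_map (Euclidean_space k) euclideanreal (l i)"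
    "\<And>v v'. v \<in> topspace (Euclidean_space k) \<Longrightarrow> v' \<in> topspace (Euclidean_space k) \<Longrightarrow>
       F v \<in> Fix \<Longrightarrow> F v' \<in> Fix \<Longrightarrow> (\<And>i. i < m \<Longrightarrow> l i v = l i v') \<Longrightarrow> v = v'"
proof -
  interpret group G by (rule group_G)
  have fx: "x \<in> topspace X" "\<And>g. g \<in> carrier G \<Longrightarrow> \<phi> g x = x" using x by (auto simp: Fix_def)
  obtain k \<rho> f where "linear_tube G T X \<phi> x (stabilizer G \<phi> x) k \<rho> f"
    using ls fx unfolding locally_smooth_action_def by blast
  then have lt: "linear_tube G T X \<phi> x (carrier G) k \<rho> f" unfolding stabilizer_Fix[OF x] .
  let ?V = "topspace (Euclidean_space k)"
  obtain U F \<nu> where U: "openin X U" "x \<in> U"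
    and F: "continuous_map (Euclidean_space k) X F" and \<nu>: "continuous_map (subtopology X U) (Euclidean_space k) \<nu>"
    and F\<nu>: "\<And>u. u \<in> U \<Longrightarrow> F (\<nu> u) = u"
    and \<nu>F: "\<And>v. v \<in> ?V \<Longrightarrow> F v \<in> U \<and> \<nu> (F v) = v"
    and F\<rho>: "\<And>g v. g \<in> carrier G \<Longrightarrow> v \<in> ?V \<Longrightarrow> \<phi> g (F v) = F (\<rho> g v)"
    using fixed_tube[OF lt refl fx] by metis
  have UX: "U \<subseteq> topspace X" using U(1) by (rule openin_subset)
  have orep: "orthogonal_representation G T (carrier G) k \<rho>" using lt by (simp add: linear_tube_def)
  have \<rho>V: "\<rho> g v \<in> ?V" if "g \<in> carrier G" "v \<in> ?V" for g v
    using group_action.element_image[OF group_action_subgroup_restrict[OF orep]] that by simp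
  have \<nu>V: "\<nu> u \<in> ?V" if "u \<in> U" for u using \<nu> that UX unfolding continuous_map_def by auto
  have injF: "inj_on F ?V" by (rule inj_on_inverseI[of _ \<nu>]) (use \<nu>F in blast)
  obtain u where u: "u \<in> U" "u \<notin> Fix" using Fix_interior_empty[OF ls conn nt U(1)] U(2) by blast
  have uX: "u \<in> topspace X" using u(1) UX by blast
  have "stabilizer G \<phi> u = {\<one>\<^bsub>G\<^esub>}"
    using sf u(2) uX stabilizer_eq_carrier_imp_Fix unfolding semi_free_action_def by blast
  then have free: "g = \<one>\<^bsub>G\<^esub>" if "g \<in> carrier G" "\<phi> g u = u" for g
    using that unfolding stabilizer_def by blast
  have inj: "inj_on (\<lambda>g. \<rho> g (\<nu> u)) (carrier G)"
  proof (rule inj_onI)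
    fix g h assume gh: "g \<in> carrier G" "h \<in> carrier G" "\<rho> g (\<nu> u) = \<rho> h (\<nu> u)"
    have "\<phi> g u = \<phi> h u" using F\<rho>[OF gh(1) \<nu>V[OF u(1)]] F\<rho>[OF gh(2) \<nu>V[OF u(1)]] gh(3) F\<nu>[OF u(1)] by simp
    then have "\<phi> (inv\<^bsub>G\<^esub> h \<otimes>\<^bsub>G\<^esub> g) u = u" using gh uX by (simp add: act_mult act_inv)
    then have 1: "inv\<^bsub>G\<^esub> h \<otimes>\<^bsub>G\<^esub> g = \<one>\<^bsub>G\<^esub>" using gh by (intro free) auto
    have "h = h \<otimes>\<^bsub>G\<^esub> (inv\<^bsub>G\<^esub> h \<otimes>\<^bsub>G\<^esub> g)" unfolding 1 using gh by simp
    also have "\<dots> = g" using gh by (simp add: m_assoc[symmetric])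
    finally show "g = h" by simp
  qed
  obtain m l where ml: "d + m \<le> n" "\<And>i. continuous_map (Euclidean_space k) euclideanreal (l i)"
    and l: "\<And>v v'. v \<in> ?V \<Longrightarrow> v' \<in> ?V \<Longrightarrow>
       (\<And>g. g \<in> carrier G \<Longrightarrow> \<rho> g v = v) \<Longrightarrow> (\<And>g. g \<in> carrier G \<Longrightarrow> \<rho> g v' = v') \<Longrightarrow>
       (\<And>i. i < m \<Longrightarrow> l i v = l i v') \<Longrightarrow> v = v'"
    by (rule fixed_coordinates[OF orep F injF \<nu>V[OF u(1)] inj A charts]) blast+
  have fixV: "\<rho> g v = v" if "v \<in> ?V" "F v \<in> Fix" "g \<in> carrier G" for v g
  proof -
    have "F (\<rho> g v) = F v" using F\<rho>[OF that(3,1)] that(2,3) by (simp add: Fix_def)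
    then show ?thesis using \<nu>F[OF that(1)] \<nu>F[OF \<rho>V[OF that(3,1)]] by metis
  qed
  show thesis
  proof (rule that[OF U _ F \<nu> F\<nu> \<nu>F ml])
    show "\<phi> g u \<in> U" if "g \<in> carrier G" "u \<in> U" for g u
      using F\<rho>[OF that(1) \<nu>V[OF that(2)]] F\<nu>[OF that(2)] \<nu>F[OF \<rho>V[OF that(1) \<nu>V[OF that(2)]]] by simp
    show "v = v'" if "v \<in> ?V" "v' \<in> ?V" "F v \<in> Fix" "F v' \<in> Fix" "\<And>i. i < m \<Longrightarrow> l i v = l i v'" for v v'
      by (rule l[OF that(1,2) fixV[OF that(1,3)] fixV[OF that(2,4)] that(5)])
  qed
qed

end

context diagonal_square
begin

text \<open>Both tubes are contractible, so on their product W the two projections are homotopic at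
  once. On pairs of fixed points each orbit is a single pair, and the two charts provide m + m'
  \<le> 2 (n - d) \<le> 2 n - d coordinates; other pairs are not coloured here.\<close>

lemma fixed_pair:
  assumes pc: "path_connected_space X"
    and ls: "locally_smooth_action G T X \<phi>" and conn: "connected_space X"
    and nt: "nontrivial_action G X \<phi>" and sf: "semi_free_action G X \<phi>"
    and A: "openin (Euclidean_space d) A" "A \<noteq> {}" "continuous_map (subtopology (Euclidean_space d) A) T s" "inj_on s A"
    and charts: "\<And>y. y \<in> topspace X \<Longrightarrow> \<exists>U p. y \<in> U \<and> is_chart n X (U, p)"
    and xy: "x \<in> Fix" "y \<in> Fix"
  obtains W V K where "openin E W" "(x, y) \<in> W" "\<And>g e. g \<in> carrier G \<Longrightarrow> e \<in> W \<Longrightarrow> \<delta> g e \<in> W"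
    "homotopic_with (\<lambda>_. True) (subtopology E W) X fst snd"
    "openin E.Y V" "E.q (x, y) \<in> V" "V \<inter> E.q ` (Fix \<times> Fix) \<subseteq> K" "colorable E.Y (2 * n - d) K"
proof -
  obtain U F \<nu> k m l where U: "openin X U" "x \<in> U" "\<And>g u. g \<in> carrier G \<Longrightarrow> u \<in> U \<Longrightarrow> \<phi> g u \<in> U"
    and F: "continuous_map (Euclidean_space k) X F" and \<nu>: "continuous_map (subtopology X U) (Euclidean_space k) \<nu>"
    and F\<nu>: "\<And>u. u \<in> U \<Longrightarrow> F (\<nu> u) = u"
    and \<nu>F: "\<And>v. v \<in> topspace (Euclidean_space k) \<Longrightarrow> F v \<in> U \<and> \<nu> (F v) = v"
    and m: "d + m \<le> n" and lc: "\<And>i. continuous_map (Euclidean_space k) euclideanreal (l i)"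
    and l: "\<And>v v'. v \<in> topspace (Euclidean_space k) \<Longrightarrow> v' \<in> topspace (Euclidean_space k) \<Longrightarrow>
       F v \<in> Fix \<Longrightarrow> F v' \<in> Fix \<Longrightarrow> (\<And>i. i < m \<Longrightarrow> l i v = l i v') \<Longrightarrow> v = v'"
    by (rule fixed_point_chart[OF ls conn nt sf A charts xy(1)]) blast+
  obtain U' F' \<nu>' k' m' l' where U': "openin X U'" "y \<in> U'" "\<And>g u. g \<in> carrier G \<Longrightarrow> u \<in> U' \<Longrightarrow> \<phi> g u \<in> U'"
    and F': "continuous_map (Euclidean_space k') X F'" and \<nu>': "continuous_map (subtopology X U') (Euclidean_space k') \<nu>'"
    and F\<nu>': "\<And>u. u \<in> U' \<Longrightarrow> F' (\<nu>' u) = u"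
    and \<nu>F': "\<And>v. v \<in> topspace (Euclidean_space k') \<Longrightarrow> F' v \<in> U' \<and> \<nu>' (F' v) = v"
    and m': "d + m' \<le> n" and lc': "\<And>i. continuous_map (Euclidean_space k') euclideanreal (l' i)"
    and l': "\<And>v v'. v \<in> topspace (Euclidean_space k') \<Longrightarrow> v' \<in> topspace (Euclidean_space k') \<Longrightarrow>
       F' v \<in> Fix \<Longrightarrow> F' v' \<in> Fix \<Longrightarrow> (\<And>i. i < m' \<Longrightarrow> l' i v = l' i v') \<Longrightarrow> v = v'"
    by (rule fixed_point_chart[OF ls conn nt sf A charts xy(2)]) blast+
  let ?V = "topspace (Euclidean_space k)" and ?V' = "topspace (Euclidean_space k')"
  have UX: "U \<subseteq> topspace X" using U(1) by (rule openin_subset)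
  have UX': "U' \<subseteq> topspace X" using U'(1) by (rule openin_subset)
  have \<nu>V: "\<nu> u \<in> ?V" if "u \<in> U" for u using \<nu> that UX unfolding continuous_map_def by auto
  have \<nu>V': "\<nu>' u \<in> ?V'" if "u \<in> U'" for u using \<nu>' that UX' unfolding continuous_map_def by auto
  define W where "W = U \<times> U'"
  have W: "openin E W" unfolding W_def using U(1) U'(1) by (simp add: openin_prod_Times_iff)
  have inv: "\<delta> g e \<in> W" if ge: "g \<in> carrier G" "e \<in> W" for g e
  proof -
    obtain a b where ab: "e = (a, b)" "a \<in> U" "b \<in> U'" using ge(2) by (auto simp: W_def)
    then have "(a, b) \<in> topspace X \<times> topspace X" using UX UX' by auto
    then show ?thesis using U(3)[OF ge(1) ab(2)] U'(3)[OF ge(1) ab(3)] ab(1) by (simp add: diagonal_apply W_def)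
  qed
  have "contractible_space (subtopology X U)"
    using \<nu> F \<nu>F F\<nu> by (intro contractible_space_continuous_inverse[OF contractible_Euclidean_space[of k], of _ F \<nu>]
        continuous_map_into_subtopology) auto
  moreover have "contractible_space (subtopology X U')"
    using \<nu>' F' \<nu>F' F\<nu>' by (intro contractible_space_continuous_inverse[OF contractible_Euclidean_space[of k'], of _ F' \<nu>']
        continuous_map_into_subtopology) auto
  ultimately have "contractible_space (subtopology E W)"
    by (simp add: W_def subtopology_Times contractible_space_prod_topology)
  then have hom: "homotopic_with (\<lambda>_. True) (subtopology E W) X fst snd"
    using pc by (intro homotopic_from_contractible_space conjI continuous_map_from_subtopology
        continuous_map_fst continuous_map_snd)
  \<comment> \<open>\<open>Fix\<close> is closed, so the fixed vectors in the cube form a compact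
    set; on the product of two such sets the orbit map is injective.\<close>
  define C where "C = closed_cube k (\<nu> x) 1 \<inter> {v \<in> ?V. F v \<in> Fix}"
  define C' where "C' = closed_cube k' (\<nu>' y) 1 \<inter> {v \<in> ?V'. F' v \<in> Fix}"
  have C: "compactin (Euclidean_space k) C" unfolding C_def
    by (intro compact_Int_closedin compactin_closed_cube closedin_continuous_map_preimage[OF F closedin_Fix])
  have C': "compactin (Euclidean_space k') C'" unfolding C'_def
    by (intro compact_Int_closedin compactin_closed_cube closedin_continuous_map_preimage[OF F' closedin_Fix])
  have CD: "v \<in> ?V" "F v \<in> Fix" if "v \<in> C" for v using that by (auto simp: C_def)
  have CD': "v \<in> ?V'" "F' v \<in> Fix" if "v \<in> C'" for v using that by (auto simp: C'_def)
  define D where "D = subtopology (prod_topology (Euclidean_space k) (Euclidean_space k')) (C \<times> C')"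
  have tD: "topspace D = C \<times> C'" using CD(1) CD'(1) by (auto simp: D_def)
  define Q where "Q w = E.q (F (fst w), F' (snd w))" for w
  define \<epsilon> where "\<epsilon> i w = (if i < m then l i (fst w) else if i < m + m' then l' (i - m) (snd w) else 0)"
    for i and w :: "(nat \<Rightarrow> real) \<times> (nat \<Rightarrow> real)"
  have "colorable E.Y (2 * n - d) (Q ` topspace D)"
  proof (rule colorable_coordinates[OF _ _ E.Hausdorff_Y])
    show "compact_space D"
      unfolding D_def using C C' by (intro compact_space_subtopology) (simp add: compactin_Times)
    have "continuous_map (prod_topology (Euclidean_space k) (Euclidean_space k')) E (\<lambda>w. (F (fst w), F' (snd w)))"
      using continuous_map_compose[OF continuous_map_fst F] continuous_map_compose[OF continuous_map_snd F']
      by (intro continuous_map_pairedI) (simp_all add: o_def)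
    from continuous_map_from_subtopology[OF continuous_map_compose[OF this E.continuous_q]]
    show "continuous_map D E.Y Q" by (simp add: o_def Q_def[abs_def] D_def)
    have 1: "continuous_map D euclideanreal (\<lambda>w. l i (fst w))" for i
      unfolding D_def using continuous_map_compose[OF continuous_map_fst lc]
      by (intro continuous_map_from_subtopology) (simp add: o_def)
    have 2: "continuous_map D euclideanreal (\<lambda>w. l' i (snd w))" for i
      unfolding D_def using continuous_map_compose[OF continuous_map_snd lc']
      by (intro continuous_map_from_subtopology) (simp add: o_def)
    show "continuous_map D euclideanreal (\<epsilon> i)" for i
      unfolding \<epsilon>_def[abs_def] using 1 2 by (cases "i < m"; cases "i < m + m'") simp_all
    fix w w' assume w: "w \<in> topspace D" "w' \<in> topspace D"
    obtain v y v' y' where vy: "w = (v, y)" "w' = (v', y')" by (cases w; cases w') auto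
    have v: "v \<in> C" "v' \<in> C" and y: "y \<in> C'" "y' \<in> C'" using w vy tD by auto
    have iff: "w = w' \<longleftrightarrow> (\<forall>i<2 * n - d. \<epsilon> i w = \<epsilon> i w')"
    proof
      assume *: "\<forall>i<2 * n - d. \<epsilon> i w = \<epsilon> i w'"
      have "l i v = l i v'" if "i < m" for i
        using *[rule_format, of i] that m by (simp add: \<epsilon>_def vy)
      then have "v = v'" using CD[OF v(1)] CD[OF v(2)] by (intro l)
      moreover have "l' i y = l' i y'" if "i < m'" for i
        using *[rule_format, of "m + i"] that m m' by (simp add: \<epsilon>_def vy)
      then have "y = y'" using CD'[OF y(1)] CD'[OF y(2)] by (intro l')
      ultimately show "w = w'" by (simp add: vy)
    qed simp
    have "w = w'" if QQ: "Q w = Q w'"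
    proof -
      have fX: "(F v, F' y) \<in> topspace E" "(F v', F' y') \<in> topspace E"
        using CD[OF v(1)] CD[OF v(2)] CD'[OF y(1)] CD'[OF y(2)] by (auto simp: Fix_def)
      have "E.q (F v, F' y) = E.q (F v', F' y')" using QQ by (simp add: Q_def vy)
      then obtain g where g: "g \<in> carrier G" "(F v', F' y') = \<delta> g (F v, F' y)"
        using E.q_eq_iff[OF fX] by auto
      have "\<phi> g (F v) = F v" "\<phi> g (F' y) = F' y" using g(1) CD(2)[OF v(1)] CD'(2)[OF y(1)] by (auto simp: Fix_def)
      then have "F v' = F v" "F' y' = F' y" using g(2) fX(1) by (simp_all add: diagonal_apply)
      then have "v' = v" "y' = y"
        using \<nu>F[OF CD(1)[OF v(1)]] \<nu>F[OF CD(1)[OF v(2)]] \<nu>F'[OF CD'(1)[OF y(1)]] \<nu>F'[OF CD'(1)[OF y(2)]] by metis+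
      then show ?thesis by (simp add: vy)
    qed
    then show "Q w = Q w' \<longleftrightarrow> (\<forall>i<2 * n - d. \<epsilon> i w = \<epsilon> i w')" using iff by blast
  qed
  moreover define B where "B = {u \<in> topspace (subtopology X U). \<nu> u \<in> open_cube k (\<nu> x) 1}"
  moreover define B' where "B' = {u \<in> topspace (subtopology X U'). \<nu>' u \<in> open_cube k' (\<nu>' y) 1}"
  have "openin X B"
    unfolding B_def using openin_continuous_map_preimage[OF \<nu> openin_open_cube] U(1) by (rule openin_trans_full)
  moreover have "openin X B'"
    unfolding B'_def using openin_continuous_map_preimage[OF \<nu>' openin_open_cube] U'(1) by (rule openin_trans_full)
  ultimately have "openin E (B \<times> B')" by (simp add: openin_prod_Times_iff)
  then have V: "openin E.Y (E.q ` (B \<times> B'))" by (rule E.open_q_image)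
  have VK: "E.q ` (B \<times> B') \<inter> E.q ` (Fix \<times> Fix) \<subseteq> Q ` topspace D"
  proof
    fix t assume t: "t \<in> E.q ` (B \<times> B') \<inter> E.q ` (Fix \<times> Fix)"
    obtain a b where ab: "t = E.q (a, b)" "a \<in> B" "b \<in> B'" using IntD1[OF t] by auto
    obtain a' b' where ab': "t = E.q (a', b')" "a' \<in> Fix" "b' \<in> Fix" using IntD2[OF t] by auto
    have aU: "a \<in> U" "\<nu> a \<in> open_cube k (\<nu> x) 1" and bU: "b \<in> U'" "\<nu>' b \<in> open_cube k' (\<nu>' y) 1"
      using ab by (auto simp: B_def B'_def)
    have X: "(a', b') \<in> topspace E" "(a, b) \<in> topspace E" using ab' aU(1) bU(1) UX UX' by (auto simp: Fix_def)
    obtain g where g: "g \<in> carrier G" "(a, b) = \<delta> g (a', b')"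
      using E.q_eq_iff[OF X] ab(1) ab'(1) by auto
    \<comment> \<open>The orbit of a pair of fixed points is that pair alone, so (a, b) is itself
      such a pair.\<close>
    then have "a = a'" "b = b'" using ab'(2,3) X(1) by (auto simp: diagonal_apply Fix_def)
    then have "\<nu> a \<in> C" "\<nu>' b \<in> C'"
      using ab' aU bU F\<nu> F\<nu>' \<nu>V \<nu>V' subsetD[OF open_cube_subset_closed_cube aU(2)]
        subsetD[OF open_cube_subset_closed_cube bU(2)] unfolding C_def C'_def by auto
    moreover have "t = Q (\<nu> a, \<nu>' b)" using ab(1) aU bU F\<nu> F\<nu>' by (simp add: Q_def)
    ultimately show "t \<in> Q ` topspace D" unfolding tD by blast
  qed
  have xW: "(x, y) \<in> W" using U(2) U'(2) by (simp add: W_def)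
  have "x \<in> B" "y \<in> B'" using U(2) U'(2) UX UX' \<nu>V \<nu>V' by (auto simp: B_def B'_def open_cube_def)
  then have "E.q (x, y) \<in> E.q ` (B \<times> B')" by blast
  from that[OF W xW inv hom V this VK] show thesis by (simp add: \<open>colorable E.Y (2 * n - d) (Q ` topspace D)\<close>)
qed

lemma slice_planner:
  assumes "path_connected_space X" "E.slice W S \<gamma>" "contractible_space (subtopology E S)"
  shows "openin E W \<and> (\<forall>g\<in>carrier G. \<forall>e\<in>W. \<delta> g e \<in> W) \<and>
      homotopic_with (\<lambda>_. True) (subtopology E W) X fst snd"
  using E.sliceD(1,7)[OF assms(2)] slice_homotopic_endpoints[OF assms] by blast

end

text \<open>The tube injects a d-dimensional piece of G times the slice into X. Together with a
  chart for the other component this leaves k + n \<le> 2 n - d coordinates near a free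
  pair.\<close>

lemma free_tube_dim:
  assumes "compact_group_action G T X \<phi>" "linear_tube G T X \<phi> x {\<one>\<^bsub>G\<^esub>} k \<rho> f" "x \<in> topspace X"
    and A: "openin (Euclidean_space d) A" "A \<noteq> {}" "continuous_map (subtopology (Euclidean_space d) A) T s" "inj_on s A"
    and charts: "\<And>y. y \<in> topspace X \<Longrightarrow> \<exists>U p. y \<in> U \<and> is_chart n X (U, p)"
  shows "d + k \<le> n"
proof -
  interpret compact_group_action G T X \<phi> by (rule assms(1))
  have sG: "s w \<in> carrier G" if "w \<in> A" for w
    using A(3) that openin_subset[OF A(1)] topspace_T unfolding continuous_map_def by auto
  obtain U F \<kappa> \<nu> where F: "continuous_map (prod_topology T (Euclidean_space k)) X F"
    and \<kappa>F: "\<And>g v. g \<in> carrier G \<Longrightarrow> v \<in> topspace (Euclidean_space k) \<Longrightarrow>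
       F (g, v) \<in> U \<and> \<kappa> (F (g, v)) = g \<and> \<nu> (F (g, v)) = v"
    by (rule free_tube[OF assms(2) refl assms(3)]) blast
  show ?thesis
  proof (rule prod_injection_dim_le[OF A(1,2) _ _ charts])
    let ?D = "prod_topology (subtopology (Euclidean_space d) A) (Euclidean_space k)"
    have "continuous_map ?D (prod_topology T (Euclidean_space k)) (\<lambda>p. (s (fst p), snd p))"
      using continuous_map_compose[OF continuous_map_fst A(3)]
      by (intro continuous_map_pairedI continuous_map_snd) (simp add: o_def)
    from continuous_map_compose[OF this F] show "continuous_map ?D X (\<lambda>p. F (s (fst p), snd p))" by (simp add: o_def)
    show "inj_on (\<lambda>p. F (s (fst p), snd p)) (A \<times> topspace (Euclidean_space k))"
    proof (rule inj_onI)
      fix p p' assume p: "p \<in> A \<times> topspace (Euclidean_space k)" "p' \<in> A \<times> topspace (Euclidean_space k)"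
        "F (s (fst p), snd p) = F (s (fst p'), snd p')"
      have pp: "fst p \<in> A" "snd p \<in> topspace (Euclidean_space k)" "fst p' \<in> A" "snd p' \<in> topspace (Euclidean_space k)"
        using p by auto
      note 1 = \<kappa>F[OF sG[OF pp(1)] pp(2)] and 2 = \<kappa>F[OF sG[OF pp(3)] pp(4)]
      have "s (fst p) = s (fst p')" and snd: "snd p = snd p'"
        using 1[unfolded p(3)] 2 by simp_all
      then have "fst p = fst p'" using pp(1,3) by (intro inj_onD[OF A(4)])
      then show "p = p'" using snd by (rule prod_eqI)
    qed
  qed
qed

section \<open>Assembly of the two estimates\<close>

lemma smooth_manifold_chart:
  assumes "smooth_manifold n X A" "y \<in> topspace X"
  shows "\<exists>U p. y \<in> U \<and> is_chart n X (U, p)"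
proof -
  have cover: "(\<Union>(U, p)\<in>A. U) = topspace X" and chart: "\<forall>c\<in>A. is_chart n X c"
    using assms(1) by (simp_all add: smooth_manifold_def smooth_atlas_def)
  have "y \<in> (\<Union>(U, p)\<in>A. U)" unfolding cover by (rule assms(2))
  then obtain U p where Up: "(U, p) \<in> A" "y \<in> U" by auto
  have "is_chart n X (U, p)" using chart Up(1) by (rule bspec)
  with Up(2) show ?thesis by blast
qed

lemma compact_group_action_lie_group:
  assumes "compact_lie_group d G T A" "compact_space X" "Hausdorff_space X" "continuous_action G T X \<phi>"
  shows "compact_group_action G T X \<phi>"
  using assms unfolding compact_lie_group_def lie_group_def smooth_map_def
  by (intro compact_group_action.intro) blast+

theorem corollary5p3:
  fixes G :: "'g monoid" and TG :: "'g topology" and AG :: "'g chart set"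
    and X :: "'a topology" and AX :: "'a chart set"
    and \<phi> :: "'g \<Rightarrow> 'a \<Rightarrow> 'a" and d n :: nat
  assumes "compact_lie_group d G TG AG"
    and "closed_smooth_manifold n X AX" "connected_space X" "topspace X \<noteq> {}"
    and "locally_smooth_action G TG X \<phi>"
  shows "(nontrivial_action G X \<phi> \<and> semi_free_action G X \<phi> \<longrightarrow>
            ereal_of_enat (TC X) \<le> ereal (2 * real n - real d + 1)) \<and>
         (free_action G X \<phi> \<longrightarrow>
            TC X \<le> LS_cat (orbit_space G (prod_topology X X) (diagonal_action (topspace X) \<phi>)) \<and>
            ereal_of_enat (LS_cat (orbit_space G (prod_topology X X) (diagonal_action (topspace X) \<phi>)))
              \<le> ereal (2 * real n - real d + 1))"
proof -
  have charts: "\<exists>U p. y \<in> U \<and> is_chart n X (U, p)" if "y \<in> topspace X" for y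
    using assms(2) that smooth_manifold_chart by (auto simp: closed_smooth_manifold_def)
  have X: "compact_space X" "Hausdorff_space X"
    using assms(2) by (simp_all add: closed_smooth_manifold_def smooth_manifold_def)
  have act: "continuous_action G TG X \<phi>" using assms(5) by (simp add: locally_smooth_action_def)
  have cga: "compact_group_action G TG X \<phi>"
    using compact_group_action_lie_group[OF assms(1) X act] .
  interpret diagonal_square G TG X \<phi> unfolding diagonal_square_def by (rule cga)
  interpret group G by (rule group_G)
  have "path_connected_space X"
    using locally_path_connected_space_charts[OF charts] assms(3) path_connected_eq_connected_space by blast
  note pc = this
  have "smooth_manifold d TG AG" using assms(1) by (simp add: compact_lie_group_def lie_group_def)
  then obtain Ug pg where "\<one>\<^bsub>G\<^esub> \<in> Ug" "is_chart d TG (Ug, pg)"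
    using smooth_manifold_chart one_closed topspace_T by metis
  then obtain A s where A: "openin (Euclidean_space d) A" "A \<noteq> {}"
    "continuous_map (subtopology (Euclidean_space d) A) TG s" "inj_on s A"
    using chart_parametrization by metis
  have tube: "\<exists>k \<rho> f. linear_tube G TG X \<phi> x {\<one>\<^bsub>G\<^esub>} k \<rho> f \<and> d + k \<le> n"
    if x: "x \<in> topspace X" "stabilizer G \<phi> x = {\<one>\<^bsub>G\<^esub>}" for x
  proof -
    obtain k \<rho> f where "linear_tube G TG X \<phi> x (stabilizer G \<phi> x) k \<rho> f"
      using assms(5) x(1) unfolding locally_smooth_action_def by blast
    then have lt: "linear_tube G TG X \<phi> x {\<one>\<^bsub>G\<^esub>} k \<rho> f" unfolding x(2) .
    have "d + k \<le> n" by (rule free_tube_dim[OF cga lt x(1) A]) (rule charts)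
    with lt show ?thesis by blast
  qed
  \<comment> \<open>One component with trivial stabiliser is enough, since it already makes the
    stabiliser of the pair trivial.\<close>
  have slice: "\<exists>W S \<gamma> V K. z \<in> W \<and> E.slice W S \<gamma> \<and> contractible_space (subtopology E S) \<and>
      openin E.Y V \<and> E.q z \<in> V \<and> V \<subseteq> K \<and> colorable E.Y (2 * n - d) K"
    if z: "z \<in> topspace E" and st: "stabilizer G \<phi> (fst z) = {\<one>\<^bsub>G\<^esub>} \<or> stabilizer G \<phi> (snd z) = {\<one>\<^bsub>G\<^esub>}" for z
  proof -
    obtain \<sigma> :: "'a \<times> 'a \<Rightarrow> 'a \<times> 'a" where \<sigma>: "\<sigma> = (\<lambda>z. z) \<or> \<sigma> = prod.swap" "stabilizer G \<phi> (fst (\<sigma> z)) = {\<one>\<^bsub>G\<^esub>}"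
      using st by (metis fst_swap)
    have "fst (\<sigma> z) \<in> topspace X" using \<sigma>(1) z by auto
    then obtain k \<rho> f where k: "linear_tube G TG X \<phi> (fst (\<sigma> z)) {\<one>\<^bsub>G\<^esub>} k \<rho> f" "d + k \<le> n"
      using tube \<sigma>(2) by blast
    have kn: "k + n \<le> 2 * n - d" using k(2) by simp
    show ?thesis by (rule free_slice[OF \<sigma>(1) z _ k(1) kn]) (rule charts, assumption, blast)
  qed
  \<comment> \<open>The point with trivial stabiliser is there for d \<le> n, which identifies the
    natural number 2 * n - d with the real difference.\<close>
  have bound: "ereal_of_enat c \<le> ereal (2 * real n - real d + 1)"
    if "c \<le> enat (Suc (2 * n - d))" "x \<in> topspace X" "stabilizer G \<phi> x = {\<one>\<^bsub>G\<^esub>}" for c x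
  proof -
    have "d \<le> n" using tube[OF that(2,3)] by auto
    have "ereal_of_enat c \<le> ereal_of_enat (enat (Suc (2 * n - d)))"
      using that(1) by (simp only: ereal_of_enat_le_iff)
    also have "\<dots> = ereal (2 * real n - real d + 1)" using \<open>d \<le> n\<close> by (simp add: of_nat_diff)
    finally show ?thesis .
  qed
  show ?thesis
  proof (intro conjI impI, goal_cases)
    case 1
    then have nt: "nontrivial_action G X \<phi>" and sf: "semi_free_action G X \<phi>" by auto
    have dich: "x \<in> Fix \<or> stabilizer G \<phi> x = {\<one>\<^bsub>G\<^esub>}" if "x \<in> topspace X" for x
      using sf that stabilizer_eq_carrier_imp_Fix unfolding semi_free_action_def by blast
    have nfix: "stabilizer G \<phi> (fst z) = {\<one>\<^bsub>G\<^esub>} \<or> stabilizer G \<phi> (snd z) = {\<one>\<^bsub>G\<^esub>}"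
      if "z \<in> topspace E" "z \<notin> Fix \<times> Fix" for z
      using that dich[of "fst z"] dich[of "snd z"] by (cases z) auto
    obtain x0 where x0: "x0 \<in> topspace X" "x0 \<notin> Fix" using nt by (auto simp: nontrivial_action_def Fix_def)
    have "TC X \<le> enat (Suc (2 * n - d))"
    proof (rule colorable_TC_le)
      show "colorable E.Y (2 * n - d) (topspace E.Y)"
      proof (rule colorable_topspace[OF E.compact_Y E.Hausdorff_Y])
        \<comment> \<open>Closedness of the orbit map makes the image of the pairs of fixed points
          admissible as the exceptional set of \<open>colorable_topspace\<close>.\<close>
        show "closedin E.Y (E.q ` (Fix \<times> Fix))"
          using E.closed_q closedin_Fix unfolding closed_map_def by (simp add: closedin_prod_Times_iff)
        show "\<exists>V K. openin E.Y V \<and> t \<in> V \<and> colorable E.Y (2 * n - d) K \<and> V \<inter> E.q ` (Fix \<times> Fix) \<subseteq> K"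
          if t: "t \<in> E.q ` (Fix \<times> Fix)" for t
        proof -
          obtain x y where xy: "x \<in> Fix" "y \<in> Fix" "t = E.q (x, y)" using t by auto
          show ?thesis
            unfolding xy(3) by (rule fixed_pair[OF pc assms(5,3) nt sf A _ xy(1,2)]) (rule charts, assumption, blast)
        qed
        show "\<exists>V K. openin E.Y V \<and> t \<in> V \<and> colorable E.Y (2 * n - d) K \<and> V \<subseteq> K"
          if t: "t \<in> topspace E.Y - E.q ` (Fix \<times> Fix)" for t
        proof -
          obtain z where z: "z \<in> topspace E" "t = E.q z" using t unfolding E.topspace_Y by blast
          then have "z \<notin> Fix \<times> Fix" using t by blast
          from slice[OF z(1) nfix[OF z(1) this]] show ?thesis using z(2) by blast
        qed
      qed
      show "\<exists>W. openin E W \<and> z \<in> W \<and> (\<forall>g\<in>carrier G. \<forall>e\<in>W. \<delta> g e \<in> W) \<and>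
          homotopic_with (\<lambda>_. True) (subtopology E W) X fst snd" if z: "z \<in> topspace E" for z
      proof (cases "z \<in> Fix \<times> Fix")
        case True
        then obtain x y where xy: "x \<in> Fix" "y \<in> Fix" "z = (x, y)" by auto
        show ?thesis
            unfolding xy(3) by (rule fixed_pair[OF pc assms(5,3) nt sf A _ xy(1,2)]) (rule charts, assumption, blast)
      next
        case False
        then obtain W S \<gamma> where W: "z \<in> W" "E.slice W S \<gamma>" "contractible_space (subtopology E S)"
          using slice[OF z nfix[OF z]] by blast
        show ?thesis using slice_planner[OF pc W(2,3)] W(1) by (intro exI[of _ W] conjI) simp_all
      qed
    qed
    note TC = this
    \<comment> \<open>Non-triviality provides the point x0 outside \<open>Fix\<close>, and
      semi-freeness makes it free.\<close>
    have "stabilizer G \<phi> x0 = {\<one>\<^bsub>G\<^esub>}" using dich[OF x0(1)] x0(2) by blast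
    from bound[OF TC x0(1) this] show ?case .
  next
    case 2
    then have st: "stabilizer G \<phi> x = {\<one>\<^bsub>G\<^esub>}" if "x \<in> topspace X" for x
      using that by (simp add: free_action_def)
    show ?case
    proof (rule TC_le_LS_cat[OF pc])
      fix z assume z: "z \<in> topspace E"
      then have "stabilizer G \<phi> (fst z) = {\<one>\<^bsub>G\<^esub>}" by (cases z) (simp add: st)
      then obtain W S \<gamma> where "z \<in> W" "E.slice W S \<gamma>" using slice[OF z] by blast
      then show "\<exists>W S \<gamma>. z \<in> W \<and> E.slice W S \<gamma>" by (intro exI conjI)
    qed
  next
    case 3
    then have st: "stabilizer G \<phi> x = {\<one>\<^bsub>G\<^esub>}" if "x \<in> topspace X" for x
      using that by (simp add: free_action_def)
    have st': "stabilizer G \<phi> (fst z) = {\<one>\<^bsub>G\<^esub>}" if "z \<in> topspace E" for z using that by (cases z) (simp add: st)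
    have free: "\<exists>W S \<gamma> V K. z \<in> W \<and> E.slice W S \<gamma> \<and> contractible_space (subtopology E S) \<and>
      openin E.Y V \<and> E.q z \<in> V \<and> V \<subseteq> K \<and> colorable E.Y (2 * n - d) K" if "z \<in> topspace E" for z
      by (rule slice[OF that disjI1[OF st'[OF that]]])
    have EY: "t \<in> E.q ` topspace E" if "t \<in> topspace E.Y" for t using that E.topspace_Y by simp
    obtain x0 where x0: "x0 \<in> topspace X" using assms(4) by blast
    have "LS_cat E.Y \<le> enat (Suc (2 * n - d))"
    proof (rule colorable_LS_cat_le[OF E.normal_Y])
      have "path_connected_space E" using pc by (simp add: path_connected_space_prod_topology)
      then show "path_connected_space E.Y"
        using path_connectedin_continuous_map_image[OF E.continuous_q] E.topspace_Y path_connectedin_topspace by metis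
      show "topspace E.Y \<noteq> {}" using x0 unfolding E.topspace_Y by auto
      show "colorable E.Y (2 * n - d) (topspace E.Y)"
      \<comment> \<open>In the free case the exceptional set is empty.\<close>
      proof (rule colorable_topspace[OF E.compact_Y E.Hausdorff_Y closedin_empty])
        fix t assume "t \<in> topspace E.Y - {}"
        then have "t \<in> topspace E.Y" by simp
        then obtain z where z: "z \<in> topspace E" "t = E.q z" using EY by blast
        from free[OF z(1)] show "\<exists>V K. openin E.Y V \<and> t \<in> V \<and> colorable E.Y (2 * n - d) K \<and> V \<subseteq> K"
          unfolding z(2) by blast
      qed simp
      show "\<exists>V c. openin E.Y V \<and> t \<in> V \<and> homotopic_with (\<lambda>_. True) (subtopology E.Y V) E.Y id (\<lambda>_. c)"
        if t: "t \<in> topspace E.Y" for t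
      proof -
        obtain z where z: "z \<in> topspace E" "t = E.q z" using EY[OF t] by blast
        obtain W S \<gamma> where W: "z \<in> W" "E.slice W S \<gamma>" "contractible_space (subtopology E S)"
          using free[OF z(1)] by blast
        obtain c where "homotopic_with (\<lambda>_. True) (subtopology E.Y (E.q ` W)) E.Y id (\<lambda>_. c)"
          using E.slice_nullhomotopic[OF W(2,3)] .
        moreover have "t \<in> E.q ` W" unfolding z(2) using W(1) by (rule imageI)
        ultimately show ?thesis using E.open_q_image[OF E.sliceD(1)[OF W(2)]] by (intro exI conjI)
      qed
    qed
    from bound[OF this x0 st[OF x0]] show ?case .
  qed
qed


end
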